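(* Let $\mathbf t=(t_0,u_0,t_1,u_1)\in\mathbb C^4$ be generic (in the sense specified in the context). (a) $\mathbb G\circ\mathbb F=\mathcal N\,\mathrm{id}_{\mathcal A}$ and $\mathbb F\circ\mathbb G=\mathcal N\,\mathrm{id}_F$, where $\mathcal N=\langle1,1\rangle_{\mathbf t}\,w(-\gamma_0)$. (b) For $\gamma\in-\Gamma$ with $w(-\gamma)\ne0$, $$\frac{\langle E(\cdot,\gamma),E(\cdot,\gamma)\rangle_{\mathbf t}}{\langle1,1\rangle_{\mathbf t}}=\frac{w(-\gamma_0)}{w(-\gamma)}.$$
   Context: $\mathbb N=\{1,2,\dots\}$; $\mathcal A=\mathbb C[x]$; $(a,b,c,d)=(t_1+u_1,t_1-u_1,t_0+u_0+\frac12,t_0-u_0+\frac12)$. Generic means: $t_0,t_1\ne0$; $t_0+t_1\notin-\frac12\mathbb N$; $a,b,c,d\notin-\frac12\mathbb Z_{\ge0}$; no sum of two of $a,b,c,d$ (at distinct positions) lies in $\mathbb Z$. Operators on $\mathcal A$: $(T_0f)(x)=t_0f(x)+\frac{(c-x)(d-x)}{1-2x}(f(1-x)-f(x))$, $(T_1f)(x)=t_1f(x)+\frac{(a+x)(b+x)}{2x}(f(-x)-f(x))$, $Y=T_0+T_1$. $\gamma_{2n}=t_0+t_1+n$ ($n\ge0$), $\gamma_{2n-1}=-(t_0+t_1+n)$ ($n\ge1$); $p_m$ is the unique monic polynomial of degree $m$ with $Yp_m=\gamma_mp_m$; $x_0=t_1+u_1$; $E(x,\gamma_m)=p_m(x)/p_m(-x_0)$.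 $\Gamma=\{-\gamma_m:m\in\mathbb Z_{\ge0}\}$ (so $-\Gamma=\{\gamma_m\}$), and $F$ is the space of finitely supported functions $\Gamma\to\mathbb C$. $\Gamma(\cdot)$ also denotes the Gamma function, $\Gamma(\alpha\pm\beta)=\Gamma(\alpha+\beta)\Gamma(\alpha-\beta)$, and $1/\Gamma$ is the entire reciprocal Gamma function. Form: $\langle f,g\rangle_{\mathbf t}=\frac1{2\pi i}\int_{\mathcal C}f(x)g(x)\Delta(x)dx$ with $$\Delta(x)=\frac{\Gamma(a+x)\Gamma(a+1-x)\Gamma(b+x)\Gamma(b+1-x)\Gamma(c\pm x)\Gamma(d\pm x)}{\Gamma(2x)\Gamma(1-2x)},$$ $\mathcal C$ a contour along the imaginary axis from $-i\infty$ to $i\infty$, indented so that it separates $a+n,b+n,c+n,d+n$ from $-(a+n),-(b+n),-(c+n),-(d+n)$ ($n\in\mathbb Z_{\ge0}$), with $\mathcal C=-\mathcal C$ as a set. Dual parameters: $(\tilde a,\tilde b,\tilde c,\tilde d)=(t_1+t_0,\,t_1-t_0,\,u_1+u_0+\frac12,\,u_1-u_0+\frac12)$. Weight $w$ on $\Gamma$: $$w(\gamma)=(-1)^{n-1}\frac{\Gamma(\tilde a+\gamma)\Gamma(\tilde b+\gamma)\Gamma(\tilde b+1-\gamma)\Gamma(\tilde c\pm\gamma)\Gamma(\tilde d\pm\gamma)}{\Gamma(\gamma-\tilde a)\Gamma(2\gamma)\Gamma(1-2\gamma)},\quad\gamma=\tilde a+n,\ n\in\mathbb N,$$ $$w(\gamma)=(-1)^{n}\frac{\Gamma(\tilde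 a+1-\gamma)\Gamma(\tilde b+\gamma)\Gamma(\tilde b+1-\gamma)\Gamma(\tilde c\pm\gamma)\Gamma(\tilde d\pm\gamma)}{\Gamma(1-\gamma-\tilde a)\Gamma(2\gamma)\Gamma(1-2\gamma)},\quad\gamma=-(\tilde a+n),\ n\in\mathbb Z_{\ge0}.$$ Transforms: $\mathbb F:\mathcal A\to F$, $(\mathbb Fp)(\gamma)=\langle p,E(\cdot,-\gamma)\rangle_{\mathbf t}$; $\mathbb G:F\to\mathcal A$, $(\mathbb Gf)(x)=\sum_{\gamma\in\Gamma}f(\gamma)E(x,-\gamma)w(\gamma)$. *)

theory Defs
  imports "HOL-Analysis.Analysis" "HOL-Computational_Algebra.Polynomial"
begin

section \<open>Parameters\<close>

record params =
  t0 :: complex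
  u0 :: complex
  t1 :: complex
  u1 :: complex

definition par_a :: "params \<Rightarrow> complex" where "par_a t = t1 t + u1 t"
definition par_b :: "params \<Rightarrow> complex" where "par_b t = t1 t - u1 t"
definition par_c :: "params \<Rightarrow> complex" where "par_c t = t0 t + u0 t + 1 / 2"
definition par_d :: "params \<Rightarrow> complex" where "par_d t = t0 t - u0 t + 1 / 2"

definition dual_a :: "params \<Rightarrow> complex" where "dual_a t = t1 t + t0 t"
definition dual_b :: "params \<Rightarrow> complex" where "dual_b t = t1 t - t0 t"
definition dual_c :: "params \<Rightarrow> complex" where "dual_c t = u1 t + u0 t + 1 / 2"
definition dual_d :: "params \<Rightarrow> complex" where "dual_d t = u1 t - u0 t + 1 / 2"

definition generic :: "params \<Rightarrow> bool" where
  "generic t \<longleftrightarrow>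
     t0 t \<noteq> 0 \<and> t1 t \<noteq> 0 \<and>
     (\<forall>n::nat. n \<ge> 1 \<longrightarrow> t0 t + t1 t \<noteq> - (of_nat n / 2)) \<and>
     (\<forall>e \<in> {par_a t, par_b t, par_c t, par_d t}. \<forall>n::nat. e \<noteq> - (of_nat n / 2)) \<and>
     par_a t + par_b t \<notin> \<int> \<and> par_a t + par_c t \<notin> \<int> \<and> par_a t + par_d t \<notin> \<int> \<and>
     par_b t + par_c t \<notin> \<int> \<and> par_b t + par_d t \<notin> \<int> \<and> par_c t + par_d t \<notin> \<int>"


section \<open>The operators and their eigenfunctions\<close>

text \<open>
  Both polynomial divisions are exact, since f(1-x) - f(x) vanishes at x = 1/2 and
  f(-x) - f(x) vanishes at x = 0; the two lemmas give the resulting pointwise formulas.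
\<close>

definition T0 :: "params \<Rightarrow> complex poly \<Rightarrow> complex poly" where
  "T0 t f = smult (t0 t) f +
     ([:par_c t, -1:] * [:par_d t, -1:] * (pcompose f [:1, -1:] - f)) div [:1, -2:]"

definition T1 :: "params \<Rightarrow> complex poly \<Rightarrow> complex poly" where
  "T1 t f = smult (t1 t) f +
     ([:par_a t, 1:] * [:par_b t, 1:] * (pcompose f [:0, -1:] - f)) div [:0, 2:]"

definition Y :: "params \<Rightarrow> complex poly \<Rightarrow> complex poly" where
  "Y t f = T0 t f + T1 t f"

lemma linear_factor_dvd:
  fixes p :: "complex poly"
  assumes "s \<noteq> 0" "poly p (- (r / s)) = 0"
  shows "[:r, s:] dvd p"
proof -
  have "[:r / s, 1:] dvd p"
    using assms(2) poly_eq_0_iff_dvd[of p "- (r / s)"] by simp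
  moreover have "[:r, s:] = smult s [:r / s, 1:]"
    using assms(1) by simp
  ultimately show ?thesis
    using assms(1) by (metis smult_dvd)
qed

lemma poly_T0:
  assumes "x \<noteq> 1 / 2"
  shows "poly (T0 t f) x =
    t0 t * poly f x +
    (par_c t - x) * (par_d t - x) / (1 - 2 * x) * (poly f (1 - x) - poly f x)"
proof -
  let ?q = "[:par_c t, -1:] * [:par_d t, -1:] * (pcompose f [:1, -1:] - f)"
  have "[:1, -2:] dvd ?q"
    by (rule linear_factor_dvd) (simp_all add: poly_pcompose)
  then have "?q div [:1, -2:] * [:1, -2:] = ?q"
    by (rule dvd_div_mult_self)
  then have "poly (?q div [:1, -2:]) x * poly [:1, -2:] x = poly ?q x"
    by (metis poly_mult)
  then have *: "poly (?q div [:1, -2:]) x * (1 - 2 * x) =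
      (par_c t - x) * (par_d t - x) * (poly f (1 - x) - poly f x)"
    by (simp add: poly_pcompose algebra_simps)
  have nz: "1 - 2 * x \<noteq> 0"
    using assms by (auto simp: field_simps)
  have "poly (?q div [:1, -2:]) x =
      (par_c t - x) * (par_d t - x) / (1 - 2 * x) * (poly f (1 - x) - poly f x)"
    unfolding times_divide_eq_left using nz * by (simp only: nonzero_eq_divide_eq not_False_eq_True)
  then show ?thesis
    unfolding T0_def by (simp only: poly_add poly_smult)
qed

lemma poly_T1:
  assumes "x \<noteq> 0"
  shows "poly (T1 t f) x =
    t1 t * poly f x +
    (par_a t + x) * (par_b t + x) / (2 * x) * (poly f (- x) - poly f x)"
proof -
  let ?q = "[:par_a t, 1:] * [:par_b t, 1:] * (pcompose f [:0, -1:] - f)"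
  have "[:0, 2:] dvd ?q"
    by (rule linear_factor_dvd) (simp_all add: poly_pcompose)
  then have "?q div [:0, 2:] * [:0, 2:] = ?q"
    by (rule dvd_div_mult_self)
  then have "poly (?q div [:0, 2:]) x * poly [:0, 2:] x = poly ?q x"
    by (metis poly_mult)
  then have *: "poly (?q div [:0, 2:]) x * (2 * x) =
      (par_a t + x) * (par_b t + x) * (poly f (- x) - poly f x)"
    by (simp add: poly_pcompose algebra_simps)
  have nz: "2 * x \<noteq> 0"
    using assms by simp
  have "poly (?q div [:0, 2:]) x =
      (par_a t + x) * (par_b t + x) / (2 * x) * (poly f (- x) - poly f x)"
    unfolding times_divide_eq_left using nz * by (simp only: nonzero_eq_divide_eq not_False_eq_True)
  then show ?thesis
    unfolding T1_def by (simp only: poly_add poly_smult)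
qed

definition gam :: "params \<Rightarrow> nat \<Rightarrow> complex" where
  "gam t m = (if even m then t0 t + t1 t + of_nat (m div 2)
              else - (t0 t + t1 t + of_nat ((m + 1) div 2)))"

definition eigenpoly :: "params \<Rightarrow> nat \<Rightarrow> complex poly" where
  "eigenpoly t m = (THE p. lead_coeff p = 1 \<and> degree p = m \<and> Y t p = smult (gam t m) p)"

definition x0 :: "params \<Rightarrow> complex" where "x0 t = t1 t + u1 t"

text \<open>
  \<open>E t g\<close> is the polynomial E(x, g) in x, for g one of the eigenvalues \<open>gam t m\<close>;
  for generic parameters these are pairwise distinct, so that m is determined by g.
\<close>

definition E :: "params \<Rightarrow> complex \<Rightarrow> complex poly" where
  "E t g = (let p = eigenpoly t (THE m. gam t m = g) in smult (1 / poly p (- x0 t)) p)"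


section \<open>The bilinear form on polynomials\<close>

text \<open>\<open>rGamma\<close> is the entire function 1/Gamma.\<close>

definition Delta :: "params \<Rightarrow> complex \<Rightarrow> complex" where
  "Delta t x =
     Gamma (par_a t + x) * Gamma (par_a t + 1 - x) *
     Gamma (par_b t + x) * Gamma (par_b t + 1 - x) *
     Gamma (par_c t + x) * Gamma (par_c t - x) *
     Gamma (par_d t + x) * Gamma (par_d t - x) *
     rGamma (2 * x) * rGamma (1 - 2 * x)"

text \<open>
  For a curve C running from minus to plus infinity along the imaginary axis, apart from a bounded
  indentation, a point lies to the right (left) of C if it can be joined, avoiding C, to
  the far positive (negative) real axis.
\<close>

definition right_of_curve :: "(real \<Rightarrow> complex) \<Rightarrow> complex \<Rightarrow> bool" where
  "right_of_curve C z \<longleftrightarrow>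
     (\<forall>\<^sub>F r in at_top. connected_component (- range C) z (of_real r))"

definition left_of_curve :: "(real \<Rightarrow> complex) \<Rightarrow> complex \<Rightarrow> bool" where
  "left_of_curve C z \<longleftrightarrow>
     (\<forall>\<^sub>F r in at_bot. connected_component (- range C) z (of_real r))"

definition admissible_contour :: "params \<Rightarrow> (real \<Rightarrow> complex) \<Rightarrow> bool" where
  "admissible_contour t C \<longleftrightarrow>
     (\<exists>R. C piecewise_C1_differentiable_on {-R..R} \<and>
          (\<forall>s. \<bar>s\<bar> \<ge> R \<longrightarrow> C s = \<i> * of_real s)) \<and>
     uminus ` range C = range C \<and>
     (\<forall>e \<in> {par_a t, par_b t, par_c t, par_d t}. \<forall>n::nat.
        right_of_curve C (e + of_nat n) \<and> left_of_curve C (- (e + of_nat n)))"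

text \<open>The contour integral is written out along the parametrization of C by the real line.\<close>

definition form :: "params \<Rightarrow> (real \<Rightarrow> complex) \<Rightarrow> complex poly \<Rightarrow> complex poly \<Rightarrow> complex" where
  "form t C f g = 1 / (2 * of_real pi * \<i>) *
     integral UNIV (\<lambda>s. poly f (C s) * poly g (C s) * Delta t (C s) * vector_derivative C (at s))"


section \<open>The dual side\<close>

definition spec :: "params \<Rightarrow> complex set" where
  "spec t = range (\<lambda>m. - gam t m)"

definition fin_fun :: "params \<Rightarrow> (complex \<Rightarrow> complex) set" where
  "fin_fun t = {f. finite {g. f g \<noteq> 0} \<and> (\<forall>g. g \<notin> spec t \<longrightarrow> f g = 0)}"

text \<open>
  The two cases are exclusive, and n is determined by g, as soon as t0 + t1 is not a negative
  half-integer or integer; together they exhaust \<open>spec t\<close>.  The value 0 elsewhere is irrelevant.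
\<close>

definition weight :: "params \<Rightarrow> complex \<Rightarrow> complex" where
  "weight t g =
     (if \<exists>n::nat. n \<ge> 1 \<and> g = dual_a t + of_nat n then
        (let n = (THE n::nat. n \<ge> 1 \<and> g = dual_a t + of_nat n) in
          (-1) ^ (n - 1) *
          Gamma (dual_a t + g) * Gamma (dual_b t + g) * Gamma (dual_b t + 1 - g) *
          Gamma (dual_c t + g) * Gamma (dual_c t - g) *
          Gamma (dual_d t + g) * Gamma (dual_d t - g) *
          rGamma (g - dual_a t) * rGamma (2 * g) * rGamma (1 - 2 * g))
      else if \<exists>n::nat. g = - (dual_a t + of_nat n) then
        (let n = (THE n::nat. g = - (dual_a t + of_nat n)) in
          (-1) ^ n *
          Gamma (dual_a t + 1 - g) * Gamma (dual_b t + g) * Gamma (dual_b t + 1 - g) *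
          Gamma (dual_c t + g) * Gamma (dual_c t - g) *
          Gamma (dual_d t + g) * Gamma (dual_d t - g) *
          rGamma (1 - g - dual_a t) * rGamma (2 * g) * rGamma (1 - 2 * g))
      else 0)"


section \<open>The transforms\<close>

text \<open>Functions on \<open>spec t\<close> are represented by their extension by 0 to all complex numbers.\<close>

definition transF :: "params \<Rightarrow> (real \<Rightarrow> complex) \<Rightarrow> complex poly \<Rightarrow> complex \<Rightarrow> complex" where
  "transF t C p = (\<lambda>g. if g \<in> spec t then form t C p (E t (- g)) else 0)"

definition transG :: "params \<Rightarrow> (complex \<Rightarrow> complex) \<Rightarrow> complex poly" where
  "transG t f = (\<Sum>g | g \<in> spec t \<and> f g \<noteq> 0. smult (f g * weight t g) (E t (- g)))"

definition norm_const :: "params \<Rightarrow> (real \<Rightarrow> complex) \<Rightarrow> complex" where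
  "norm_const t C = form t C 1 1 * weight t (- gam t 0)"

end

theory Submission
  imports Defs "HOL-Complex_Analysis.Complex_Analysis" "HOL-Real_Asymp.Real_Asymp"
begin

text \<open>
  The operators T0, T1 and V = x + T1, W = x - 1/2 - T0 all have scalar squares, and Y = V - W - 1/2.
  Hence T1 exchanges, up to a scalar correction, the eigenspaces of Y for g and -g, and V those for
  g and -1 - g; starting from the constant 1 these two steps alternately produce all eigenpolynomials.
  T1 and V act at the point -x0 by scalars, and they are self-adjoint, so each step multiplies the
  value at -x0 and the squared norm by explicit factors, and the quotient of norm and squared value
  changes exactly by the inverse of the change of the weight.

  T1 and T0 are self-adjoint because A * Delta and B * Delta, where A and B are the coefficients of
  the reflections, are invariant under x -> -x and x -> 1 - x, and both reflections carry the contour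
  to one which separates the same poles.

  If <1,1> vanished, so would the whole form by orthogonality.  Multiplying Delta by a suitable
  polynomial raises a, b, c, d by an integer until their real parts are positive, and the contour can
  then be moved to the imaginary axis.  All moments of an exponentially decaying function on this
  axis would vanish, which forces that function to be zero.
\<close>

section \<open>The operators and their eigenpolynomials\<close>

text \<open>The parameters are complex, so the form has no positivity to rely on, and the total mass
  needs an argument of its own; the moment argument takes the place of a closed evaluation of the
  integral. Nonvanishing serves the quotient in (b), whereas the inversion formulas are identities
  between products of norms and weights. The contour is given only topologically, by the components
  of its complement. Winding numbers of closed-up truncations are the link between this description
  and Cauchy's theorem. The reflection x -> 1 - x moves the contour from the line of real part 0 to
  that of real part 1. Deforming it back is possible because the coefficient of this reflection in
  \<open>T0\<close> turns \<open>Gamma (c - x)\<close> and \<open>Gamma (d - x)\<close> into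
  \<open>Gamma (c + 1 - x)\<close> and \<open>Gamma (d + 1 - x)\<close>, which removes the poles at
  c and d. For convergence a crude estimate is enough: Gamma decays in vertical strips at the rate
  pi / 2, but the rate 1 suffices, since eight such factors outweigh the growth rate
  \<open>2 * pi\<close> of the two reciprocal Gamma factors.\<close>

lemma poly_eqI_cofinite:
  fixes p q :: "'a::{idom,ring_char_0} poly"
  assumes "finite S" "\<And>x. x \<notin> S \<Longrightarrow> poly p x = poly q x"
  shows "p = q"
proof (rule ccontr)
  assume "p \<noteq> q"
  hence "finite {x. poly (p - q) x = 0}" by (intro poly_roots_finite) auto
  moreover have "- S \<subseteq> {x. poly (p - q) x = 0}" using assms(2) by auto
  ultimately have "finite (- S)" by (rule rev_finite_subset)
  with assms(1) have "finite (UNIV :: 'a set)" by (metis finite_compl finite)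
  thus False using infinite_UNIV_char_0 by blast
qed

text \<open>The pointwise formulas for \<open>T1\<close> and \<open>T0\<close> divide by
  \<open>2 * x\<close> and \<open>1 - 2 * x\<close>, so operator identities are tested away from
  these two zeros.\<close>

lemma poly_eqI_generic:
  fixes p q :: "complex poly"
  assumes "\<And>x. x \<noteq> 0 \<Longrightarrow> x \<noteq> 1 / 2 \<Longrightarrow> poly p x = poly q x"
  shows "p = q"
  by (rule poly_eqI_cofinite[of "{0, 1/2}"]) (use assms in auto)

lemma T1_add: "T1 t (f + g) = T1 t f + T1 t g"
  by (rule poly_eqI_generic) (simp add: poly_T1 field_simps)

lemma T1_smult: "T1 t (smult c f) = smult c (T1 t f)"
  by (rule poly_eqI_generic) (simp add: poly_T1 field_simps)

lemma T0_add: "T0 t (f + g) = T0 t f + T0 t g"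
proof (rule poly_eqI_generic)
  fix x :: complex assume "x \<noteq> 1 / 2"
  thus "poly (T0 t (f + g)) x = poly (T0 t f + T0 t g) x"
    by (simp only: poly_T0 poly_add not_False_eq_True) algebra
qed

lemma T0_smult: "T0 t (smult c f) = smult c (T0 t f)"
proof (rule poly_eqI_generic)
  fix x :: complex assume "x \<noteq> 1 / 2"
  thus "poly (T0 t (smult c f)) x = poly (smult c (T0 t f)) x"
    by (simp only: poly_T0 poly_smult not_False_eq_True) algebra
qed

text \<open>
  Up to sign, V and W are the other two generators of the rank one degenerate double affine Hecke
  algebra.
\<close>

definition V :: "params \<Rightarrow> complex poly \<Rightarrow> complex poly" where
  "V t f = [:0, 1:] * f + T1 t f"

definition W :: "params \<Rightarrow> complex poly \<Rightarrow> complex poly" where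
  "W t f = [:- 1 / 2, 1:] * f - T0 t f"

text \<open>The coefficient \<open>A\<close> of the reflection s satisfies
  \<open>A x + A (- x) = par_a t + par_b t = 2 * t1 t\<close>; for an operator of the form t1 + A (s
  - 1) this is exactly what makes its square a scalar.\<close>

lemma T1_T1: "T1 t (T1 t f) = smult ((t1 t)\<^sup>2) f"
proof (rule poly_eqI_generic)
  fix x :: complex assume x: "x \<noteq> 0" "x \<noteq> 1/2"
  define A where "A = (\<lambda>x. (par_a t + x) * (par_b t + x) / (2 * x))"
  have "A x + A (-x) = 2 * t1 t"
    using x by (simp add: A_def par_a_def par_b_def field_simps)
  hence A: "A (-x) = 2 * t1 t - A x" by (simp add: algebra_simps)
  have T: "poly (T1 t g) y = t1 t * poly g y + A y * (poly g (-y) - poly g y)" if "y \<noteq> 0" for g y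
    unfolding A_def by (rule poly_T1[OF that])
  show "poly (T1 t (T1 t f)) x = poly (smult ((t1 t)\<^sup>2) f) x"
    using x by (simp add: T A algebra_simps power2_eq_square)
qed

text \<open>The same mechanism for x -> 1 - x, now with
  \<open>B x + B (1 - x) = par_c t + par_d t - 1 = 2 * t0 t\<close>.\<close>

lemma T0_T0: "T0 t (T0 t f) = smult ((t0 t)\<^sup>2) f"
proof (rule poly_eqI_generic)
  fix x :: complex assume x: "x \<noteq> 0" "x \<noteq> 1/2"
  define B where "B = (\<lambda>x. (par_c t - x) * (par_d t - x) / (1 - 2 * x))"
  have nz: "1 - 2 * x \<noteq> 0" using x by (auto simp: field_simps)
  have "B x * (1 - 2 * x) = (par_c t - x) * (par_d t - x)" using nz by (simp add: B_def)
  moreover have "B (1 - x) * (1 - 2 * x) = - ((par_c t - (1 - x)) * (par_d t - (1 - x)))"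
  proof -
    have "1 - 2 * (1 - x) = - (1 - 2 * x)" by simp
    thus ?thesis using nz unfolding B_def by (simp only: minus_divide_divide divide_minus_right) simp
  qed
  ultimately have "(B x + B (1 - x)) * (1 - 2 * x) =
      (par_c t - x) * (par_d t - x) - (par_c t - (1 - x)) * (par_d t - (1 - x))"
    by (simp only: distrib_right) simp
  also have "\<dots> = 2 * t0 t * (1 - 2 * x)"
    by (simp add: par_c_def par_d_def field_simps)
  finally have "B x + B (1 - x) = 2 * t0 t" using nz by (simp only: mult_cancel_right) simp
  hence B: "B (1 - x) = 2 * t0 t - B x" by (simp add: algebra_simps)
  have T: "poly (T0 t g) y = t0 t * poly g y + B y * (poly g (1-y) - poly g y)" if "y \<noteq> 1/2" for g y
    unfolding B_def by (rule poly_T0[OF that])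
  have x': "1 - x \<noteq> 1/2" using x by (auto simp: field_simps)
  show "poly (T0 t (T0 t f)) x = poly (smult ((t0 t)\<^sup>2) f) x"
    using x by (simp add: T[OF x(2)] T[OF x'] B algebra_simps power2_eq_square)
qed

text \<open>Multiplication by x changes sign under the reflection, so the reflected terms in x T1 +
  T1 x cancel and a multiplication operator is left. It is constant because \<open>(par_a t + x) *
  (par_b t + x) = (t1 t + x)\<^sup>2 - (u1 t)\<^sup>2\<close>.\<close>

lemma V_V: "V t (V t f) = smult ((u1 t)\<^sup>2) f"
proof (rule poly_eqI_generic)
  fix x :: complex assume x: "x \<noteq> 0" "x \<noteq> 1/2"
  define A where "A = (par_a t + x) * (par_b t + x) / (2 * x)"
  have A: "A * (2 * x) = (t1 t)\<^sup>2 - (u1 t)\<^sup>2 + 2 * t1 t * x + x\<^sup>2"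
    using x by (simp add: A_def par_a_def par_b_def field_simps power2_eq_square)
  have T: "poly (T1 t g) x = t1 t * poly g x + A * (poly g (-x) - poly g x)" for g
    unfolding A_def by (rule poly_T1[OF x(1)])
  have "poly (V t (V t f)) x = poly (T1 t (T1 t f)) x +
      x * (x * poly f x + poly (T1 t f) x) + poly (T1 t ([:0,1:] * f)) x"
    unfolding V_def T1_add by (simp add: algebra_simps)
  also have "\<dots> = (t1 t)\<^sup>2 * poly f x + x\<^sup>2 * poly f x + 2 * t1 t * x * poly f x - A * (2 * x) * poly f x"
    unfolding T1_T1 T by (simp add: algebra_simps power2_eq_square)
  also have "\<dots> = (u1 t)\<^sup>2 * poly f x" unfolding A by (simp add: algebra_simps)
  finally show "poly (V t (V t f)) x = poly (smult ((u1 t)\<^sup>2) f) x" by simp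
qed

text \<open>Here x - 1/2 is the multiplier that is odd under x -> 1 - x, and the numerator of
  \<open>B\<close> is again a difference of two squares.\<close>

lemma W_W: "W t (W t f) = smult ((u0 t)\<^sup>2) f"
proof (rule poly_eqI_generic)
  fix x :: complex assume x: "x \<noteq> 0" "x \<noteq> 1/2"
  define B where "B = (par_c t - x) * (par_d t - x) / (1 - 2 * x)"
  have nz: "1 - 2 * x \<noteq> 0" using x by (auto simp: field_simps)
  have "B * (1 - 2 * x) = (par_c t - x) * (par_d t - x)" using nz by (simp add: B_def)
  also have "\<dots> = (t0 t + 1/2 - x)\<^sup>2 - (u0 t)\<^sup>2"
    by (simp add: par_c_def par_d_def algebra_simps power2_eq_square)
  finally have B: "B * (1 - 2 * x) = (t0 t + 1/2 - x)\<^sup>2 - (u0 t)\<^sup>2" .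
  have T: "poly (T0 t g) x = t0 t * poly g x + B * (poly g (1-x) - poly g x)" for g
    unfolding B_def by (rule poly_T0[OF x(2)])
  have Tm: "T0 t (f - g) = T0 t f - T0 t g" for f g
    using T0_add[of t f "smult (-1) g"] T0_smult[of t "-1" g] by simp
  have "poly (W t (W t f)) x = poly (T0 t (T0 t f)) x +
      (x - 1/2) * ((x - 1/2) * poly f x - poly (T0 t f) x) - poly (T0 t ([:-1/2,1:] * f)) x"
    unfolding W_def Tm by (simp del: times_divide_eq_left add: field_simps)
  also have "\<dots> = (t0 t)\<^sup>2 * poly f x + (x-1/2)\<^sup>2 * poly f x - 2 * t0 t * (x - 1/2) * poly f x - B * (1 - 2 * x) * poly f x"
    unfolding T0_T0 T by (simp add: field_simps power2_eq_square)
  also have "\<dots> = (u0 t)\<^sup>2 * poly f x" unfolding B by (simp add: field_simps power2_eq_square)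
  finally show "poly (W t (W t f)) x = poly (smult ((u0 t)\<^sup>2) f) x" by simp
qed

lemma Y_eq: "Y t f = W t f * [:-1:] + V t f - smult (1/2) f"
  by (rule poly_eqI_generic) (simp add: Y_def V_def W_def algebra_simps)

lemma T1_diff: "T1 t (f - g) = T1 t f - T1 t g"
  using T1_add[of t f "smult (-1) g"] T1_smult[of t "-1" g] by simp

lemma T0_diff: "T0 t (f - g) = T0 t f - T0 t g"
  using T0_add[of t f "smult (-1) g"] T0_smult[of t "-1" g] by simp

lemma Y_add: "Y t (f + g) = Y t f + Y t g"
  by (simp add: Y_def T1_add T0_add)

lemma Y_smult: "Y t (smult c f) = smult c (Y t f)"
  by (simp add: Y_def T1_smult T0_smult smult_add_right)

lemma Y_diff: "Y t (f - g) = Y t f - Y t g"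
  by (simp add: Y_def T1_diff T0_diff)

lemma W_add: "W t (f + g) = W t f + W t g"
  by (simp add: W_def T0_add smult_add_right algebra_simps)

lemma W_smult: "W t (smult c f) = smult c (W t f)"
  by (simp add: W_def T0_smult smult_diff_right)

text \<open>Applying \<open>T0\<close> twice to \<open>p\<close>, with
  \<open>T0 t p = smult g p - T1 t p\<close>, expresses \<open>T0 t (T1 t p)\<close> by
  \<open>p\<close> and \<open>T1 t p\<close>. So \<open>Y\<close> is triangular on their span, with
  diagonal entries \<open>g\<close> and \<open>- g\<close>.\<close>

lemma Y_T1_eigen:
  assumes "Y t p = smult g p"
  shows "Y t (T1 t p) = smult (- g) (T1 t p) + smult (g\<^sup>2 + (t1 t)\<^sup>2 - (t0 t)\<^sup>2) p"
proof -
  have T0p: "T0 t p = smult g p - T1 t p"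
    using assms by (simp add: Y_def algebra_simps)
  have "smult ((t0 t)\<^sup>2) p = T0 t (T0 t p)" by (simp add: T0_T0)
  also have "\<dots> = smult (g\<^sup>2) p - smult g (T1 t p) - T0 t (T1 t p)"
    by (subst T0p) (simp add: T0_diff T0_smult T0p smult_diff_right power2_eq_square)
  finally have "T0 t (T1 t p) = smult (g\<^sup>2) p - smult g (T1 t p) - smult ((t0 t)\<^sup>2) p"
    by (simp add: algebra_simps)
  thus ?thesis by (simp add: Y_def T1_T1 smult_add_left smult_diff_left algebra_simps)
qed

text \<open>\<open>V\<close> and \<open>W\<close> take the roles of \<open>T1\<close> and
  \<open>T0\<close>: W - V = - 1/2 - Y acts on \<open>p\<close> by \<open>z\<close>, and the sign
  change of \<open>z\<close> turns the eigenvalue \<open>g\<close> of \<open>Y\<close> into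
  \<open>- 1 - g\<close>.\<close>

lemma Y_V_eigen:
  assumes "Y t p = smult g p"
  defines "z \<equiv> - 1 / 2 - g"
  shows "Y t (V t p) = smult (- 1 - g) (V t p) + smult (z\<^sup>2 + (u1 t)\<^sup>2 - (u0 t)\<^sup>2) p"
proof -
  have g: "g = - 1 / 2 - z" by (simp add: z_def)
  have Wp: "W t p = smult z p + V t p"
    using assms(1) unfolding Y_eq g by (simp add: smult_diff_left smult_minus_left algebra_simps)
  have "smult ((u0 t)\<^sup>2) p = W t (W t p)" by (simp add: W_W)
  also have "\<dots> = smult (z\<^sup>2) p + smult z (V t p) + W t (V t p)"
    by (subst Wp) (simp add: W_add W_smult Wp smult_add_right power2_eq_square)
  finally have W: "W t (V t p) = smult ((u0 t)\<^sup>2) p - smult (z\<^sup>2) p - smult z (V t p)"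
    by (simp add: algebra_simps)
  have "Y t (V t p) = smult (-1) (W t (V t p)) + V t (V t p) - smult (1/2) (V t p)"
    unfolding Y_eq by simp
  also have "\<dots> = smult (z - 1/2) (V t p) + smult (z\<^sup>2 + (u1 t)\<^sup>2 - (u0 t)\<^sup>2) p"
    by (simp add: W V_V smult_add_left smult_diff_left smult_diff_right algebra_simps)
  finally show ?thesis by (simp add: z_def)
qed

lemma coeff_pcompose_neg: "coeff (pcompose f [:0, -1:]) n = (-1) ^ n * coeff (f :: complex poly) n"
  using coeff_pcompose_linear[of f "-1" n] by simp

text \<open>Subtracting x^m from its reflection gives 0 for even \<open>m\<close> and -2 x^m for odd
  \<open>m\<close>. Hence \<open>V\<close> raises even degrees and \<open>- T1\<close> raises odd
  ones, both preserving the leading coefficient, which dictates the alternation in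
  \<open>eseq\<close>.\<close>

lemma T1_coeff_Suc:
  assumes "degree f \<le> m"
  shows "coeff (T1 t f) (Suc m) = (if even m then 0 else - coeff f m)"
    and "degree (T1 t f) \<le> Suc m"
proof -
  define k where "k = pcompose f [:0, -1:] - f"
  have "[:0, 2:] dvd k" unfolding k_def by (rule linear_factor_dvd) (simp_all add: poly_pcompose)
  then obtain q where q: "k = [:0, 2:] * q" by (elim dvdE)
  have "T1 t f = smult (t1 t) f + ([:0,2:] * ([:par_a t, 1:] * [:par_b t, 1:] * q)) div [:0, 2:]"
    unfolding T1_def k_def[symmetric] q by (simp only: mult_ac)
  also have "([:0,2:] * ([:par_a t, 1:] * [:par_b t, 1:] * q)) div [:0, 2:] = [:par_a t, 1:] * [:par_b t, 1:] * q"
    by (rule nonzero_mult_div_cancel_left) simp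
  finally have T: "T1 t f = smult (t1 t) f + [:par_a t * par_b t, par_a t + par_b t, 1:] * q"
    by (simp add: algebra_simps)
  have kq: "coeff k (Suc i) = 2 * coeff q i" for i by (simp add: q coeff_pCons)
  have qi: "coeff q i = (if even i then - coeff f (Suc i) else 0)" for i
    using kq[of i] by (cases "even i") (simp_all add: k_def coeff_pcompose_neg)
  have f0: "coeff f i = 0" if "i > m" for i using assms that by (intro coeff_eq_0) simp
  have c: "coeff (T1 t f) (Suc i) = t1 t * coeff f (Suc i) + par_a t * par_b t * coeff q (Suc i)
      + (par_a t + par_b t) * coeff q i + (if i = 0 then 0 else coeff q (i - 1))" for i
    by (cases i) (simp_all add: T algebra_simps)
  show "coeff (T1 t f) (Suc m) = (if even m then 0 else - coeff f m)"
    by (cases m) (auto simp: c qi f0)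
  show "degree (T1 t f) \<le> Suc m"
  proof (rule degree_le, intro allI impI)
    fix i assume "Suc m < i"
    then obtain j where j: "i = Suc j" "j > m" "j - 1 \<ge> m" "j \<noteq> 0" by (cases i) auto
    show "coeff (T1 t f) i = 0" using j by (auto simp: c qi f0)
  qed
qed

section \<open>Eigenvalues and the recursion for the eigenpolynomials\<close>

lemma gam_Suc: "gam t (Suc m) = (if even m then - 1 - gam t m else - gam t m)"
  by (auto simp: gam_def elim!: evenE oddE)

lemma generic_sum_neq:
  assumes "generic t" "n \<ge> 1"
  shows "t0 t + t1 t \<noteq> - (of_nat n / 2)"
  using assms by (auto simp: generic_def)

text \<open>An even and an odd index could collide only if \<open>2 * (t0 t + t1 t)\<close> were a
  negative integer; it would not be 0 because an odd index carries a shift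
  \<open>l \<ge> 1\<close>.\<close>

lemma gam_inj:
  assumes "generic t" "gam t m = gam t n"
  shows "m = n"
proof -
  have *: False if "t0 t + t1 t + of_nat k = - (t0 t + t1 t + of_nat l)" "l \<ge> 1" for k l
  proof -
    have "t0 t + t1 t = - (of_nat (k + l) / 2)" using that(1) by (simp add: field_simps) algebra
    thus False using generic_sum_neq[OF assms(1), of "k + l"] that(2) by simp
  qed
  show ?thesis
  proof (cases "even m"; cases "even n")
    assume "even m" "even n" thus ?thesis using assms(2) by (auto simp: gam_def elim!: evenE)
  next
    assume "odd m" "odd n" thus ?thesis using assms(2) by (auto simp: gam_def elim!: oddE)
  next
    assume a: "even m" "odd n" hence "(n + 1) div 2 \<ge> 1" by (auto elim!: oddE)
    moreover have "t0 t + t1 t + of_nat (m div 2) = - (t0 t + t1 t + of_nat ((n + 1) div 2))"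
      using assms(2) a by (simp only: gam_def if_True if_False)
    ultimately show ?thesis using * by metis
  next
    assume a: "odd m" "even n" hence "(m + 1) div 2 \<ge> 1" by (auto elim!: oddE)
    moreover have "t0 t + t1 t + of_nat (n div 2) = - (t0 t + t1 t + of_nat ((m + 1) div 2))"
      using assms(2)[symmetric] a by (simp only: gam_def if_True if_False)
    ultimately show ?thesis using * by metis
  qed
qed

text \<open>The multiple of the old eigenpolynomial that removes the unwanted term in
  \<open>Y_V_eigen\<close> or \<open>Y_T1_eigen\<close>: the scalar found there divided by
  \<open>2 * z\<close> or \<open>2 * g\<close>, which up to sign is the gap between the old and the
  new eigenvalue.\<close>

definition raise_coeff :: "params \<Rightarrow> nat \<Rightarrow> complex" where
  "raise_coeff t m = (if even m
     then (let z = - 1 / 2 - gam t m in (z\<^sup>2 + (u1 t)\<^sup>2 - (u0 t)\<^sup>2) / (2 * z))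
     else (let g = gam t m in (g\<^sup>2 + (t1 t)\<^sup>2 - (t0 t)\<^sup>2) / (2 * g)))"

fun eseq :: "params \<Rightarrow> nat \<Rightarrow> complex poly" where
  "eseq t 0 = 1"
| "eseq t (Suc m) = (if even m
     then V t (eseq t m) + smult (raise_coeff t m) (eseq t m)
     else smult (raise_coeff t m) (eseq t m) - T1 t (eseq t m))"

text \<open>The raising operator, \<open>V\<close> for even \<open>m\<close> and \<open>- T1\<close>
  for odd \<open>m\<close>, squares to the square of this scalar and multiplies the value at
  \<open>- x0 t\<close> by its negative.\<close>

definition refl_scalar :: "params \<Rightarrow> nat \<Rightarrow> complex" where
  "refl_scalar t m = (if even m then u1 t else t1 t)"

lemma gam_odd_nz:
  assumes "generic t" "odd m" shows "gam t m \<noteq> 0"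
proof
  assume "gam t m = 0"
  moreover obtain k where "m = 2 * k + 1" using assms(2) by (elim oddE)
  ultimately have "- (t0 t + t1 t + of_nat (Suc k)) = 0" by (simp add: gam_def)
  hence "t0 t + t1 t + of_nat (Suc k) = 0" by (simp only: neg_equal_0_iff_equal)
  hence "t0 t + t1 t = - of_nat (Suc k)" by (simp only: add_eq_0_iff2)
  moreover have "(of_nat (2 * j) / 2 :: complex) = of_nat j" for j by simp
  ultimately have "t0 t + t1 t = - (of_nat (2 * Suc k) / 2)" by metis
  thus False using generic_sum_neq[OF assms(1), of "2 * Suc k"] by simp
qed

lemma gam_even_nz:
  assumes "generic t" "even m" shows "- 1 / 2 - gam t m \<noteq> 0"
proof
  assume *: "- 1 / 2 - gam t m = 0"
  obtain k where k: "gam t m = t0 t + t1 t + of_nat k" using assms(2) by (auto simp: gam_def)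
  have "t0 t + t1 t = - (of_nat (2 * k + 1) / 2)" using * unfolding k by (simp add: field_simps)
  thus False using generic_sum_neq[OF assms(1), of "2 * k + 1"] by simp
qed

lemma eseq_eigen:
  assumes "generic t"
  shows "Y t (eseq t m) = smult (gam t m) (eseq t m)"
proof (induction m)
  case 0
  have "T0 t 1 = [:t0 t:]" "T1 t 1 = [:t1 t:]" by (simp_all add: T0_def T1_def pcompose_1)
  thus ?case by (simp add: Y_def gam_def)
next
  case (Suc m)
  show ?case
  proof (cases "even m")
    case True
    define z where "z = - 1 / 2 - gam t m"
    define q where "q = eseq t m"
    have z: "z \<noteq> 0" using gam_even_nz[OF assms True] by (simp add: z_def)
    have r: "z\<^sup>2 + (u1 t)\<^sup>2 - (u0 t)\<^sup>2 = raise_coeff t m * (2 * z)"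
      using z True unfolding raise_coeff_def Let_def z_def[symmetric] by simp
    have g: "gam t m = - 1 / 2 - z" by (simp add: z_def)
    have "Y t (eseq t (Suc m)) = smult (- 1 - gam t m) (V t q) + smult (raise_coeff t m * (2 * z)) q
        + smult (raise_coeff t m) (smult (gam t m) q)"
      using Y_V_eigen[OF Suc] True unfolding z_def[symmetric] r by (simp add: Y_add Y_smult Suc q_def)
    also have "\<dots> = smult (- 1 - gam t m) (V t q + smult (raise_coeff t m) q)"
      by (rule poly_eqI_generic) (simp add: g algebra_simps)
    finally show ?thesis using True by (simp add: gam_Suc q_def)
  next
    case False
    define g where "g = gam t m"
    define q where "q = eseq t m"
    have z: "g \<noteq> 0" using gam_odd_nz[OF assms False] by (simp add: g_def)
    have r: "g\<^sup>2 + (t1 t)\<^sup>2 - (t0 t)\<^sup>2 = raise_coeff t m * (2 * g)"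
      using z False unfolding raise_coeff_def Let_def g_def[symmetric] by simp
    have "Y t (eseq t (Suc m)) = smult (raise_coeff t m) (smult g q)
        - (smult (- g) (T1 t q) + smult (raise_coeff t m * (2 * g)) q)"
      using Y_T1_eigen[OF Suc] False unfolding g_def[symmetric] r by (simp add: Y_diff Y_smult Suc q_def g_def)
    also have "\<dots> = smult (- g) (smult (raise_coeff t m) q - T1 t q)"
      by (rule poly_eqI_generic) (simp add: algebra_simps)
    finally show ?thesis using False by (simp add: gam_Suc q_def g_def)
  qed
qed

lemma eseq_degree: "degree (eseq t m) = m \<and> lead_coeff (eseq t m) = 1"
proof (induction m)
  case (Suc m)
  hence d: "degree (eseq t m) \<le> m" and l: "coeff (eseq t m) m = 1" by auto
  have c: "coeff (eseq t (Suc m)) (Suc m) = 1"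
  proof (cases "even m")
    case True thus ?thesis using T1_coeff_Suc(1)[OF d, of t] l d by (simp add: V_def coeff_eq_0)
  next
    case False thus ?thesis using T1_coeff_Suc(1)[OF d, of t] l d by (simp add: coeff_eq_0)
  qed
  have "degree ([:0, 1:] * eseq t m) \<le> Suc m" using d by simp
  moreover have "degree (smult r (eseq t m)) \<le> Suc m" for r using d degree_smult_le[of r] le_trans by force
  ultimately have "degree (eseq t (Suc m)) \<le> Suc m"
    using T1_coeff_Suc(2)[OF d, of t] by (auto simp: V_def intro!: degree_add_le degree_diff_le)
  moreover have "degree (eseq t (Suc m)) \<ge> Suc m" using c by (intro le_degree) simp
  ultimately have "degree (eseq t (Suc m)) = Suc m" by (rule antisym)
  thus ?case using c by (simp del: eseq.simps)
qed simp

lemma degree_eseq: "degree (eseq t m) = m"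
  and coeff_eseq: "coeff (eseq t m) m = 1"
  using eseq_degree[of t m] by auto

lemma monic_basis:
  fixes P :: "nat \<Rightarrow> 'a::field poly"
  assumes "\<And>m. degree (P m) = m" "\<And>m. lead_coeff (P m) = 1"
  shows "degree p < n \<Longrightarrow> \<exists>c. p = (\<Sum>m<n. smult (c m) (P m))"
proof (induction n arbitrary: p)
  case (Suc n)
  show ?case
  proof (cases "n = 0")
    case True
    with Suc.prems have "degree p = 0" by simp
    then obtain a where "p = [:a:]" by (rule degree_eq_zeroE)
    moreover obtain b where b: "P 0 = [:b:]" using assms(1)[of 0] by (rule degree_eq_zeroE)
    moreover have "b = 1" using assms(2)[of 0] b by simp
    ultimately show ?thesis using True by (intro exI[of _ "\<lambda>_. a"]) simp
  next
    case False
    define q where "q = p - smult (coeff p n) (P n)"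
    have "degree q \<le> n" unfolding q_def
      by (intro degree_diff_le order.trans[OF degree_smult_le]) (use Suc.prems assms(1)[of n] in simp_all)
    moreover have "coeff q n = 0" using assms(2)[of n] unfolding assms(1) by (simp add: q_def)
    moreover have "q = 0" if "degree q = n" using that \<open>coeff q n = 0\<close> leading_coeff_0_iff[of q] by simp
    ultimately have "degree q < n" using False by (cases "degree q = n") auto
    then obtain c where "q = (\<Sum>m<n. smult (c m) (P m))" using Suc.IH by blast
    hence "p = (\<Sum>m<n. smult (c m) (P m)) + smult (coeff p n) (P n)" by (simp add: q_def algebra_simps)
    thus ?thesis by (intro exI[of _ "c(n := coeff p n)"]) simp
  qed
qed simp

lemma Y_0: "Y t 0 = 0"
  using Y_smult[of t 0 0] by simp

lemma Y_sum: "Y t (\<Sum>m\<in>A. f m) = (\<Sum>m\<in>A. Y t (f m))"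
  by (induction A rule: infinite_finite_induct) (simp_all add: Y_add Y_0)

text \<open>\<open>Y\<close> is triangular in the degree with pairwise distinct diagonal entries:
  the difference of two monic solutions would be an eigenpolynomial of degree \<open>k < m\<close>,
  and comparing coefficients at \<open>k\<close> forces \<open>gam t k = gam t m\<close>.\<close>

lemma eigenpoly_eq_eseq:
  assumes "generic t"
  shows "eigenpoly t m = eseq t m"
  unfolding eigenpoly_def
proof (rule the_equality)
  show "lead_coeff (eseq t m) = 1 \<and> degree (eseq t m) = m \<and> Y t (eseq t m) = smult (gam t m) (eseq t m)"
    using eseq_eigen[OF assms, of m] by (simp add: degree_eseq coeff_eseq)
next
  fix p assume p: "lead_coeff p = 1 \<and> degree p = m \<and> Y t p = smult (gam t m) p"
  define q where "q = p - eseq t m"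
  have Yq: "Y t q = smult (gam t m) q" using p by (simp add: q_def Y_diff eseq_eigen[OF assms] smult_diff_right)
  have "q = 0"
  proof (rule ccontr)
    assume nz: "q \<noteq> 0"
    define k where "k = degree q"
    have dp: "degree p = m" "coeff p m = 1" using p by auto
    have de: "degree (eseq t m) = m" "coeff (eseq t m) m = 1" using eseq_degree[of t m] by auto
    have "degree q \<le> m" unfolding q_def by (intro degree_diff_le) (simp_all add: dp de)
    moreover have "coeff q m = 0" by (simp add: q_def dp de)
    moreover have qk: "coeff q k \<noteq> 0" using nz by (simp add: k_def)
    ultimately have km: "k < m" unfolding k_def by (cases "degree q = m") auto
    have "\<exists>c. q = (\<Sum>j<Suc k. smult (c j) (eseq t j))"
      by (rule monic_basis) (simp_all add: k_def degree_eseq coeff_eseq)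
    then obtain c where c: "q = (\<Sum>j<Suc k. smult (c j) (eseq t j))" by blast
    have small: "coeff (\<Sum>j<k. smult (d j) (eseq t j)) k = 0" for d
      unfolding coeff_sum by (intro sum.neutral ballI) (simp add: coeff_eq_0 degree_eseq)
    have ek: "coeff (eseq t k) k = 1" using eseq_degree[of t k] by auto
    have a: "coeff q k = c k" unfolding c by (simp add: small ek)
    have b: "coeff (Y t q) k = c k * gam t k"
      unfolding c Y_sum by (simp add: Y_smult eseq_eigen[OF assms] small ek)
    have "c k * gam t k = gam t m * c k" using b unfolding Yq coeff_smult a by (rule sym)
    hence "gam t k = gam t m" using qk unfolding a by (simp add: mult.commute[of "c k"])
    thus False using gam_inj[OF assms] km by blast
  qed
  thus "p = eseq t m" by (simp add: q_def)
qed

text \<open>Over the common denominator the numerator is a difference of two squares and splits into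
  linear factors. In the dual parameters these are the factors produced by shifting the Gamma
  functions of the weight.\<close>

lemma refl_scalar_factors:
  assumes "generic t"
  shows "even m \<Longrightarrow> (refl_scalar t m - raise_coeff t m) * (2 * (- 1 / 2 - gam t m)) =
      - ((gam t m + dual_c t) * (gam t m + dual_d t))"
    and "even m \<Longrightarrow> (refl_scalar t m + raise_coeff t m) * (2 * (- 1 / 2 - gam t m)) =
      (gam t m + 1 - dual_c t) * (gam t m + 1 - dual_d t)"
    and "odd m \<Longrightarrow> (refl_scalar t m - raise_coeff t m) * (2 * gam t m) =
      - ((dual_a t - gam t m) * (dual_b t - gam t m))"
    and "odd m \<Longrightarrow> (refl_scalar t m + raise_coeff t m) * (2 * gam t m) =
      (dual_a t + gam t m) * (dual_b t + gam t m)"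
proof -
  have *: "(u - (z\<^sup>2 + u\<^sup>2 - v\<^sup>2) / (2 * z)) * (2 * z) = - ((z - u - v) * (z - u + v))"
    "(u + (z\<^sup>2 + u\<^sup>2 - v\<^sup>2) / (2 * z)) * (2 * z) = (z + u - v) * (z + u + v)"
    if "z \<noteq> 0" for z u v :: complex
    using that by (simp_all add: field_simps power2_eq_square)
  note d = dual_a_def dual_b_def dual_c_def dual_d_def
  {
    assume e: "even m"
    define z where "z = - 1 / 2 - gam t m"
    have z: "z \<noteq> 0" using gam_even_nz[OF assms e] unfolding z_def .
    have g: "gam t m = - 1 / 2 - z" by (simp add: z_def)
    have r: "raise_coeff t m = (z\<^sup>2 + (u1 t)\<^sup>2 - (u0 t)\<^sup>2) / (2 * z)" "refl_scalar t m = u1 t"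
      using e unfolding raise_coeff_def Let_def z_def[symmetric] refl_scalar_def by simp_all
    show "(refl_scalar t m - raise_coeff t m) * (2 * (- 1 / 2 - gam t m)) = - ((gam t m + dual_c t) * (gam t m + dual_d t))"
      unfolding z_def[symmetric] r *(1)[OF z] unfolding g d by (simp add: algebra_simps)
    show "(refl_scalar t m + raise_coeff t m) * (2 * (- 1 / 2 - gam t m)) = (gam t m + 1 - dual_c t) * (gam t m + 1 - dual_d t)"
      unfolding z_def[symmetric] r *(2)[OF z] unfolding g d by (simp add: field_simps)
  next
    assume e: "odd m"
    define z where "z = gam t m"
    have z: "z \<noteq> 0" using gam_odd_nz[OF assms e] unfolding z_def .
    have r: "raise_coeff t m = (z\<^sup>2 + (t1 t)\<^sup>2 - (t0 t)\<^sup>2) / (2 * z)" "refl_scalar t m = t1 t"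
      using e unfolding raise_coeff_def Let_def z_def[symmetric] refl_scalar_def by simp_all
    show "(refl_scalar t m - raise_coeff t m) * (2 * gam t m) = - ((dual_a t - gam t m) * (dual_b t - gam t m))"
      unfolding z_def[symmetric] r *(1)[OF z] unfolding d by (simp add: algebra_simps)
    show "(refl_scalar t m + raise_coeff t m) * (2 * gam t m) = (dual_a t + gam t m) * (dual_b t + gam t m)"
      unfolding z_def[symmetric] r *(2)[OF z] unfolding d by (simp add: algebra_simps)
  }
qed

text \<open>Each of these numbers is a sum of two of the original parameters or 1 minus such a sum;
  for instance \<open>dual_c t - dual_a t = 1 - (par_b t + par_d t)\<close>.\<close>

lemma generic_nonint:
  assumes "generic t"
  shows "dual_c t + dual_a t \<notin> \<int>" "dual_d t + dual_a t \<notin> \<int>" "dual_c t - dual_a t \<notin> \<int>"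
    "dual_d t - dual_a t \<notin> \<int>" "dual_a t + dual_b t \<notin> \<int>" "dual_b t - dual_a t \<notin> \<int>"
proof -
  have *: "x \<notin> \<int>" if "y \<notin> \<int>" "x = of_int k - y \<or> x = y + of_int k" for x y :: complex and k
  proof
    assume "x \<in> \<int>"
    hence "of_int k - x \<in> \<int>" "x - of_int k \<in> \<int>" by simp_all
    with that show False by auto
  qed
  note g = assms[unfolded generic_def] and d = dual_a_def dual_b_def dual_c_def dual_d_def
    par_a_def par_b_def par_c_def par_d_def
  show "dual_c t + dual_a t \<notin> \<int>" by (rule *[of "par_a t + par_c t" _ 0]) (use g in \<open>auto simp: d algebra_simps\<close>)
  show "dual_d t + dual_a t \<notin> \<int>" by (rule *[of "par_a t + par_d t" _ 0]) (use g in \<open>auto simp: d algebra_simps\<close>)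
  show "dual_c t - dual_a t \<notin> \<int>" by (rule *[of "par_b t + par_d t" _ 1]) (use g in \<open>auto simp: d algebra_simps\<close>)
  show "dual_d t - dual_a t \<notin> \<int>" by (rule *[of "par_b t + par_c t" _ 1]) (use g in \<open>auto simp: d algebra_simps\<close>)
  show "dual_a t + dual_b t \<notin> \<int>" by (rule *[of "par_a t + par_b t" _ 0]) (use g in \<open>auto simp: d algebra_simps\<close>)
  show "dual_b t - dual_a t \<notin> \<int>" by (rule *[of "par_c t + par_d t" _ 1]) (use g in \<open>auto simp: d algebra_simps\<close>)
qed

section \<open>Recurrences for the dual weight\<close>

lemma Gamma_plus1_nonint: "(z :: complex) \<notin> \<int> \<Longrightarrow> Gamma (z + 1) = z * Gamma z"
  by (intro Gamma_plus1) (use nonpos_Ints_subset_Ints in blast)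

lemma nonint_shift:
  "(z :: complex) \<notin> \<int> \<Longrightarrow> z + of_nat n \<notin> \<int>" "(z :: complex) \<notin> \<int> \<Longrightarrow> z - of_nat n \<notin> \<int>"
proof -
  have "z \<in> \<int>" if "z + of_nat n \<in> \<int>" using Ints_diff[OF that Ints_of_nat[of n]] by simp
  thus "(z :: complex) \<notin> \<int> \<Longrightarrow> z + of_nat n \<notin> \<int>" by blast
  have "z \<in> \<int>" if "z - of_nat n \<in> \<int>" using Ints_add[OF that Ints_of_nat[of n]] by simp
  thus "(z :: complex) \<notin> \<int> \<Longrightarrow> z - of_nat n \<notin> \<int>" by blast
qed

lemma dual_a_sum_neq:
  assumes "generic t" "n \<ge> 1"
  shows "2 * dual_a t + of_nat n \<noteq> 0"
proof
  assume "2 * dual_a t + of_nat n = 0"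
  hence "t0 t + t1 t = - (of_nat n / 2)" by (simp add: dual_a_def add_eq_0_iff field_simps)
  thus False using generic_sum_neq[OF assms] by simp
qed

lemma weight_pos:
  fixes t :: params and n :: nat
  assumes "n \<ge> 1"
  defines "h \<equiv> dual_a t + of_nat n"
  shows "weight t h = (-1) ^ (n - 1) *
          Gamma (dual_a t + h) * Gamma (dual_b t + h) * Gamma (dual_b t + 1 - h) *
          Gamma (dual_c t + h) * Gamma (dual_c t - h) *
          Gamma (dual_d t + h) * Gamma (dual_d t - h) *
          rGamma (h - dual_a t) * rGamma (2 * h) * rGamma (1 - 2 * h)"
proof -
  have "(THE k::nat. k \<ge> 1 \<and> h = dual_a t + of_nat k) = n"
    using assms(1) by (intro the_equality) (auto simp: h_def)
  thus ?thesis using assms unfolding weight_def by (auto simp: Let_def)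
qed

lemma weight_neg:
  fixes n :: nat
  assumes "generic t"
  defines "h \<equiv> dual_a t + of_nat n"
  shows "weight t (- h) = (-1) ^ n *
          Gamma (dual_a t + 1 + h) * Gamma (dual_b t - h) * Gamma (dual_b t + 1 + h) *
          Gamma (dual_c t - h) * Gamma (dual_c t + h) *
          Gamma (dual_d t - h) * Gamma (dual_d t + h) *
          rGamma (1 + h - dual_a t) * rGamma (- 2 * h) * rGamma (1 + 2 * h)"
proof -
  have no: "\<not> (\<exists>k::nat. k \<ge> 1 \<and> - h = dual_a t + of_nat k)"
  proof
    assume "\<exists>k::nat. k \<ge> 1 \<and> - h = dual_a t + of_nat k"
    then obtain k :: nat where k: "k \<ge> 1" "- h = dual_a t + of_nat k" by blast
    have "2 * dual_a t + of_nat (n + k) = 0" using k(2) by (simp add: h_def algebra_simps)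
    thus False using dual_a_sum_neq[OF assms(1), of "n + k"] k by simp
  qed
  have the: "(THE k::nat. - h = - (dual_a t + of_nat k)) = n"
    by (intro the_equality) (auto simp: h_def)
  have ex: "\<exists>k::nat. - h = - (dual_a t + of_nat k)" by (auto simp: h_def)
  show ?thesis unfolding weight_def Let_def if_not_P[OF no] if_P[OF ex] the by simp
qed

text \<open>\<open>h\<close> and \<open>- h\<close> fall into different cases of
  \<open>weight\<close>. The factors with \<open>dual_c\<close> and \<open>dual_d\<close> agree in
  both, and the remaining ones differ by one application of the functional equation of
  Gamma.\<close>

lemma weight_step_odd:
  fixes n :: nat
  assumes "generic t" "n \<ge> 1"
  defines "h \<equiv> dual_a t + of_nat n"
  shows "weight t h * (- ((h + dual_a t) * (h + dual_b t))) =
         weight t (- h) * ((h - dual_a t) * (h - dual_b t))"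
proof -
  note nonint = generic_nonint[OF assms(1)]
  \<comment> \<open>Genericity allows \<open>2 * dual_a t\<close> to be an integer, so this factor
    rests on the exclusion of negative half-integers and on \<open>n \<ge> 1\<close>, not on
    non-integrality.\<close>
  have "dual_a t + h \<notin> \<int>\<^sub>\<le>\<^sub>0"
  proof
    assume "dual_a t + h \<in> \<int>\<^sub>\<le>\<^sub>0"
    then obtain k where "dual_a t + h = - of_nat k" by (elim nonpos_Ints_cases')
    hence "2 * dual_a t + of_nat (n + k) = 0" by (simp add: h_def algebra_simps)
    thus False using dual_a_sum_neq[OF assms(1), of "n + k"] assms(2) by simp
  qed
  hence 1: "Gamma (dual_a t + 1 + h) = (dual_a t + h) * Gamma (dual_a t + h)"
    using Gamma_plus1[of "dual_a t + h"] by (simp add: add_ac)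
  have "dual_b t + h \<notin> \<int>" using nonint_shift(1)[OF nonint(5), of n] by (simp add: h_def algebra_simps)
  from Gamma_plus1_nonint[OF this] have 2: "Gamma (dual_b t + 1 + h) = (dual_b t + h) * Gamma (dual_b t + h)"
    by (simp add: add_ac)
  have "dual_b t - h \<notin> \<int>" using nonint_shift(2)[OF nonint(6), of n] by (simp add: h_def algebra_simps)
  from Gamma_plus1_nonint[OF this] have 3: "Gamma (dual_b t + 1 - h) = (dual_b t - h) * Gamma (dual_b t - h)"
    by (simp add: algebra_simps)
  have 4: "rGamma (h - dual_a t) = (h - dual_a t) * rGamma (1 + h - dual_a t)"
    using rGamma_plus1[of "h - dual_a t"] by (simp add: algebra_simps)
  have 5: "rGamma (2 * h) = 2 * h * rGamma (1 + 2 * h)"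
    using rGamma_plus1[of "2 * h"] by (simp add: algebra_simps)
  have 6: "rGamma (- 2 * h) = - 2 * h * rGamma (1 - 2 * h)"
    using rGamma_plus1[of "- 2 * h"] by (simp add: algebra_simps)
  obtain k where k: "n = Suc k" using assms(2) by (cases n) auto
  have 7: "(-1 :: complex) ^ n = - ((-1) ^ (n - 1))" by (simp add: k)
  show ?thesis
    unfolding weight_pos[OF assms(2), of t, folded h_def] weight_neg[OF assms(1), of n, folded h_def] 1 2 3 4 5 6 7
    by (simp only: minus_mult_left minus_mult_right) algebra
qed

text \<open>From \<open>- h\<close> to \<open>h + 1\<close> the factors with \<open>dual_a\<close>
  and \<open>dual_b\<close> agree, so those with \<open>dual_c\<close> and \<open>dual_d\<close>
  give the linear factors. The minus sign comes from the reciprocal Gamma factors, which shift by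
  \<open>1 + 2 * h\<close> and \<open>- 1 - 2 * h\<close>.\<close>

lemma weight_step_even:
  fixes n :: nat
  assumes "generic t"
  defines "h \<equiv> dual_a t + of_nat n"
  shows "weight t (- h) * (- ((h + dual_c t) * (h + dual_d t))) =
         weight t (h + 1) * ((h + 1 - dual_c t) * (h + 1 - dual_d t))"
proof -
  note nonint = generic_nonint[OF assms(1)]
  have c: "dual_c t + h \<notin> \<int>" using nonint_shift(1)[OF nonint(1), of n] by (simp add: h_def algebra_simps)
  have d: "dual_d t + h \<notin> \<int>" using nonint_shift(1)[OF nonint(2), of n] by (simp add: h_def algebra_simps)
  have c': "dual_c t - h - 1 \<notin> \<int>" using nonint_shift(2)[OF nonint(3), of "Suc n"] by (simp add: h_def algebra_simps)
  have d': "dual_d t - h - 1 \<notin> \<int>" using nonint_shift(2)[OF nonint(4), of "Suc n"] by (simp add: h_def algebra_simps)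
  have 1: "Gamma (dual_c t + (h + 1)) = (dual_c t + h) * Gamma (dual_c t + h)"
    using Gamma_plus1_nonint[OF c] by (simp add: add_ac)
  have 2: "Gamma (dual_d t + (h + 1)) = (dual_d t + h) * Gamma (dual_d t + h)"
    using Gamma_plus1_nonint[OF d] by (simp add: add_ac)
  have 3: "Gamma (dual_c t - h) = (dual_c t - h - 1) * Gamma (dual_c t - (h + 1))"
    using Gamma_plus1_nonint[OF c'] by (simp add: algebra_simps)
  have 4: "Gamma (dual_d t - h) = (dual_d t - h - 1) * Gamma (dual_d t - (h + 1))"
    using Gamma_plus1_nonint[OF d'] by (simp add: algebra_simps)
  have 5: "rGamma (1 + 2 * h) = (1 + 2 * h) * rGamma (2 * (h + 1))"
    using rGamma_plus1[of "1 + 2 * h"] by (simp add: algebra_simps)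
  have 6: "rGamma (1 - 2 * (h + 1)) = (- 1 - 2 * h) * rGamma (- 2 * h)"
    using rGamma_plus1[of "- 1 - 2 * h"] by (simp add: algebra_simps)
  have 7: "dual_b t + 1 - (h + 1) = dual_b t - h" "dual_a t + (h + 1) = dual_a t + 1 + h"
    "dual_b t + (h + 1) = dual_b t + 1 + h" "h + 1 - dual_a t = 1 + h - dual_a t" "Suc n - 1 = n"
    by simp_all
  have h1: "dual_a t + of_nat (Suc n) = h + 1" by (simp add: h_def)
  have w: "weight t (h + 1) = (-1) ^ n *
          Gamma (dual_a t + 1 + h) * Gamma (dual_b t + 1 + h) * Gamma (dual_b t - h) *
          Gamma (dual_c t + (h + 1)) * Gamma (dual_c t - (h + 1)) *
          Gamma (dual_d t + (h + 1)) * Gamma (dual_d t - (h + 1)) *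
          rGamma (1 + h - dual_a t) * rGamma (2 * (h + 1)) * rGamma (1 - 2 * (h + 1))"
    using weight_pos[of "Suc n" t] unfolding h1 7 by simp
  show ?thesis
    unfolding w weight_neg[OF assms(1), of n, folded h_def] 1 2 3 4 5 6
    by algebra
qed

text \<open>Up to sign this is the factor by which the value at \<open>- x0 t\<close> changes in one
  raising step, so the normalization of \<open>E\<close> never divides by 0.\<close>

lemma refl_scalar_neq:
  assumes "generic t"
  shows "refl_scalar t m - raise_coeff t m \<noteq> 0"
proof (cases "even m")
  case True
  then obtain k where k: "gam t m = dual_a t + of_nat k" by (auto simp: gam_def dual_a_def)
  have "gam t m + dual_c t \<notin> \<int>" "gam t m + dual_d t \<notin> \<int>"
    using nonint_shift(1)[OF generic_nonint(1)[OF assms], of k] nonint_shift(1)[OF generic_nonint(2)[OF assms], of k]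
    by (simp_all add: k algebra_simps)
  hence "gam t m + dual_c t \<noteq> 0" "gam t m + dual_d t \<noteq> 0" by (metis Ints_0)+
  hence "(refl_scalar t m - raise_coeff t m) * (2 * (- 1 / 2 - gam t m)) \<noteq> 0"
    unfolding refl_scalar_factors(1)[OF assms True] by simp
  thus ?thesis by auto
next
  case False
  then obtain j where j: "m = 2 * j + 1" by (elim oddE)
  define k where "k = Suc j"
  have k: "gam t m = - (dual_a t + of_nat k)" "k \<ge> 1"
    unfolding gam_def dual_a_def k_def j by (simp_all add: add_ac)
  have "dual_b t - gam t m \<notin> \<int>"
    using nonint_shift(1)[OF generic_nonint(5)[OF assms], of k] by (simp add: k algebra_simps)
  hence "dual_b t - gam t m \<noteq> 0" by (metis Ints_0)
  moreover have "dual_a t - gam t m \<noteq> 0" using dual_a_sum_neq[OF assms k(2)] by (simp add: k)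
  ultimately have "(refl_scalar t m - raise_coeff t m) * (2 * gam t m) \<noteq> 0"
    unfolding refl_scalar_factors(3)[OF assms False] by simp
  thus ?thesis by auto
qed

lemma weight_step:
  assumes "generic t"
  shows "weight t (- gam t m) * (refl_scalar t m - raise_coeff t m) =
         weight t (- gam t (Suc m)) * (refl_scalar t m + raise_coeff t m)"
proof (cases "even m")
  case True
  then obtain k where k: "gam t m = dual_a t + of_nat k" by (auto simp: gam_def dual_a_def)
  have "weight t (- gam t m) * (refl_scalar t m - raise_coeff t m) * (2 * (- 1 / 2 - gam t m)) =
        weight t (- gam t (Suc m)) * (refl_scalar t m + raise_coeff t m) * (2 * (- 1 / 2 - gam t m))"
    using weight_step_even[OF assms, of k, folded k] True
    unfolding mult.assoc refl_scalar_factors(1,2)[OF assms True] gam_Suc by (simp add: add_ac)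
  moreover have "2 * (- 1 / 2 - gam t m) \<noteq> 0"
    by (rule no_zero_divisors[OF _ gam_even_nz[OF assms True]]) simp
  ultimately show ?thesis using mult_right_cancel by blast
next
  case False
  then obtain j where j: "m = 2 * j + 1" by (elim oddE)
  define k where "k = Suc j"
  have k: "gam t m = - (dual_a t + of_nat k)" "k \<ge> 1"
    unfolding gam_def dual_a_def k_def j by (simp_all add: add_ac)
  have k': "dual_a t + of_nat k = - gam t m" by (simp add: k)
  have "weight t (- gam t m) * (refl_scalar t m - raise_coeff t m) * (2 * gam t m) =
        weight t (- gam t (Suc m)) * (refl_scalar t m + raise_coeff t m) * (2 * gam t m)"
    using weight_step_odd[OF assms k(2), unfolded k'] False
    unfolding mult.assoc refl_scalar_factors(3,4)[OF assms False] gam_Suc by (simp add: algebra_simps)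
  thus ?thesis using gam_odd_nz[OF assms False] by simp
qed

section \<open>Orthogonality and norms\<close>

text \<open>The algebraic half of the proof lives here and sees the integral only through linearity
  and the two adjunctions; the contour enters when the form is shown to be an instance.\<close>

locale symmetric_functional =
  fixes t :: params and L :: "complex poly \<Rightarrow> complex"
  assumes gen: "generic t"
    and L_add: "L (f + g) = L f + L g"
    and L_smult: "L (smult c f) = c * L f"
    and T1_adj: "L (T1 t f * g) = L (f * T1 t g)"
    and T0_adj: "L (T0 t f * g) = L (f * T0 t g)"
begin

lemma L_0 [simp]: "L 0 = 0"
  using L_smult[of 0 0] by simp

lemma L_sum: "L (\<Sum>m\<in>A. f m) = (\<Sum>m\<in>A. L (f m))"
  by (induction A rule: infinite_finite_induct) (simp_all add: L_add)

lemma Y_adj: "L (Y t f * g) = L (f * Y t g)"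
  by (simp add: Y_def L_add T1_adj T0_adj distrib_left distrib_right)

lemma V_adj: "L (V t f * g) = L (f * V t g)"
proof -
  have "[:0, 1:] * f * g = f * ([:0, 1:] * g)" by (simp only: mult_ac)
  thus ?thesis by (simp only: V_def L_add T1_adj distrib_left distrib_right)
qed

lemma orthogonal:
  assumes "m \<noteq> n" shows "L (eseq t m * eseq t n) = 0"
proof -
  have "gam t m * L (eseq t m * eseq t n) = gam t n * L (eseq t m * eseq t n)"
    using Y_adj[of "eseq t m" "eseq t n"] by (simp add: eseq_eigen[OF gen] L_smult)
  thus ?thesis using gam_inj[OF gen, of m n] assms by auto
qed

text \<open>Orthogonality of the new polynomial to \<open>p\<close> fixes the mixed term as
  \<open>- r * L (p * p)\<close>, so the three terms of the expanded square add up to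
  \<open>c\<^sup>2 - 2 * r\<^sup>2 + r\<^sup>2\<close>.\<close>

lemma norm_raise:
  assumes adj: "\<And>f g. L (S f * g) = L (f * S g)" and sq: "S (S p) = smult (c\<^sup>2) p"
    and orth: "L ((S p + smult r p) * p) = 0"
  shows "L ((S p + smult r p) * (S p + smult r p)) = (c\<^sup>2 - r\<^sup>2) * L (p * p)"
proof -
  have 1: "L (S p * p) = - r * L (p * p)"
    using orth by (simp add: distrib_right L_add L_smult add_eq_0_iff2)
  have 2: "L (S p * S p) = c\<^sup>2 * L (p * p)"
    by (simp add: adj[of p "S p"] sq L_smult)
  have "(S p + smult r p) * (S p + smult r p) = S p * S p + smult (2 * r) (S p * p) + smult (r\<^sup>2) (p * p)"
    by (rule poly_eqI_generic) (simp add: power2_eq_square algebra_simps)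
  hence "L ((S p + smult r p) * (S p + smult r p)) = L (S p * S p) + 2 * r * L (S p * p) + r\<^sup>2 * L (p * p)"
    by (simp only: L_add L_smult)
  thus ?thesis unfolding 1 2 by (simp add: power2_eq_square algebra_simps)
qed

lemma norm_Suc:
  "L (eseq t (Suc m) * eseq t (Suc m)) = ((refl_scalar t m)\<^sup>2 - (raise_coeff t m)\<^sup>2) * L (eseq t m * eseq t m)"
proof (cases "even m")
  case True
  have e: "eseq t (Suc m) = V t (eseq t m) + smult (raise_coeff t m) (eseq t m)" using True by simp
  have "L (eseq t (Suc m) * eseq t m) = 0" by (rule orthogonal) simp
  hence "L (eseq t (Suc m) * eseq t (Suc m)) =
      ((u1 t)\<^sup>2 - (raise_coeff t m)\<^sup>2) * L (eseq t m * eseq t m)"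
    unfolding e by (rule norm_raise[of "V t" "eseq t m" "u1 t" "raise_coeff t m", OF V_adj V_V])
  thus ?thesis using True by (simp add: refl_scalar_def)
next
  case False
  define S where "S = (\<lambda>f. smult (-1) (T1 t f))"
  have e: "eseq t (Suc m) = S (eseq t m) + smult (raise_coeff t m) (eseq t m)" using False by (simp add: S_def)
  have "L (S f * g) = L (f * S g)" for f g
    using T1_adj[of f g] by (simp only: S_def mult_smult_left mult_smult_right L_smult)
  moreover have "S (S (eseq t m)) = smult ((t1 t)\<^sup>2) (eseq t m)"
    by (simp only: S_def T1_smult T1_T1) simp
  moreover have "L (eseq t (Suc m) * eseq t m) = 0" by (rule orthogonal) simp
  ultimately have "L (eseq t (Suc m) * eseq t (Suc m)) =
      ((t1 t)\<^sup>2 - (raise_coeff t m)\<^sup>2) * L (eseq t m * eseq t m)"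
    unfolding e by (rule norm_raise[of S "eseq t m" "t1 t" "raise_coeff t m"])
  thus ?thesis using False by (simp add: refl_scalar_def)
qed

end

text \<open>The coefficient of the reflection in \<open>T1\<close> vanishes at
  \<open>- x0 t = - par_a t\<close>. There \<open>T1\<close> acts by \<open>t1 t\<close> and
  \<open>V\<close> by \<open>t1 t - x0 t = - u1 t\<close>.\<close>

lemma eval_eseq_Suc:
  assumes "generic t"
  shows "poly (eseq t (Suc m)) (- x0 t) = (raise_coeff t m - refl_scalar t m) * poly (eseq t m) (- x0 t)"
proof -
  have "par_a t \<noteq> 0" using assms by (auto simp: generic_def)
  moreover have x: "x0 t = par_a t" by (simp add: x0_def par_a_def)
  ultimately have "poly (T1 t f) (- x0 t) = t1 t * poly f (- x0 t)" for f
    by (subst poly_T1) simp_all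
  thus ?thesis by (simp add: V_def refl_scalar_def x0_def algebra_simps)
qed

lemma eval_eseq_nz:
  assumes "generic t"
  shows "poly (eseq t m) (- x0 t) \<noteq> 0"
proof (induction m)
  case (Suc m)
  thus ?case unfolding eval_eseq_Suc[OF assms] using refl_scalar_neq[OF assms, of m] by simp
qed simp

lemma E_gam:
  assumes "generic t"
  shows "E t (gam t m) = smult (1 / poly (eseq t m) (- x0 t)) (eseq t m)"
proof -
  have "(THE n. gam t n = gam t m) = m" using gam_inj[OF assms] by (intro the_equality) auto
  thus ?thesis by (simp add: E_def Let_def eigenpoly_eq_eseq[OF assms])
qed

context symmetric_functional begin

lemma E_orthogonal: "m \<noteq> n \<Longrightarrow> L (E t (gam t m) * E t (gam t n)) = 0"
  by (simp add: E_gam[OF gen] L_smult orthogonal)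

text \<open>One step multiplies the norm by \<open>c\<^sup>2 - r\<^sup>2\<close> and the squared
  value by \<open>(r - c)\<^sup>2\<close>; the quotient \<open>(c + r) / (c - r)\<close> is absorbed
  by \<open>weight_step\<close>. The product form also covers points where the weight
  vanishes.\<close>

lemma weight_norm:
  "weight t (- gam t m) * L (E t (gam t m) * E t (gam t m)) = L 1 * weight t (- gam t 0)"
proof (induction m)
  case 0
  show ?case by (simp add: E_gam[OF gen] pCons_one)
next
  case (Suc m)
  define c r e N where "c = refl_scalar t m" "r = raise_coeff t m" "e = poly (eseq t m) (- x0 t)"
    "N = L (eseq t m * eseq t m)"
  have cr: "r - c \<noteq> 0" and e: "e \<noteq> 0" using refl_scalar_neq[OF gen, of m] eval_eseq_nz[OF gen, of m] by (auto simp: c_r_e_N_def)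
  have "L (E t (gam t (Suc m)) * E t (gam t (Suc m))) =
      (1 / ((r - c) * e)) * ((1 / ((r - c) * e)) * ((c\<^sup>2 - r\<^sup>2) * N))"
    unfolding E_gam[OF gen] mult_smult_left mult_smult_right L_smult eval_eseq_Suc[OF gen] norm_Suc c_r_e_N_def ..
  also have "\<dots> = (c + r) * (1 / (c - r) * (N / e\<^sup>2))"
    using cr e by (simp add: divide_simps) (simp add: power2_eq_square algebra_simps)
  also have "N / e\<^sup>2 = L (E t (gam t m) * E t (gam t m))"
    by (simp add: E_gam[OF gen] L_smult c_r_e_N_def power2_eq_square)
  finally have "weight t (- gam t (Suc m)) * L (E t (gam t (Suc m)) * E t (gam t (Suc m))) =
      weight t (- gam t (Suc m)) * (c + r) * (1 / (c - r) * L (E t (gam t m) * E t (gam t m)))"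
    by simp
  also have "weight t (- gam t (Suc m)) * (c + r) = weight t (- gam t m) * (c - r)"
    using weight_step[OF gen, of m] by (simp add: c_r_e_N_def)
  also have "weight t (- gam t m) * (c - r) * (1 / (c - r) * L (E t (gam t m) * E t (gam t m))) =
      weight t (- gam t m) * L (E t (gam t m) * E t (gam t m))"
    using cr by simp
  finally show ?case using Suc by simp
qed

end

section \<open>The two transforms in the eigenbasis\<close>

lemma transG_eq:
  assumes "generic t" "finite A" "\<And>m. m \<notin> A \<Longrightarrow> f (- gam t m) = 0"
  shows "transG t f = (\<Sum>m\<in>A. smult (f (- gam t m) * weight t (- gam t m)) (E t (gam t m)))"
proof -
  have inj: "inj_on (\<lambda>m. - gam t m) A" using gam_inj[OF assms(1)] by (auto simp: inj_on_def)
  have "transG t f = (\<Sum>g\<in>(\<lambda>m. - gam t m) ` A. smult (f g * weight t g) (E t (- g)))"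
    unfolding transG_def
    by (rule sum.mono_neutral_left) (use assms in \<open>auto simp: spec_def\<close>)
  thus ?thesis by (simp add: sum.reindex[OF inj] o_def)
qed

lemma E_basis:
  assumes "generic t"
  shows "\<exists>c n. p = (\<Sum>m<n. smult (c m) (E t (gam t m)))"
proof -
  have "\<exists>c. p = (\<Sum>m<Suc (degree p). smult (c m) (eseq t m))"
    by (rule monic_basis) (simp_all add: degree_eseq coeff_eseq)
  then obtain c where c: "p = (\<Sum>m<Suc (degree p). smult (c m) (eseq t m))" by blast
  have "p = (\<Sum>m<Suc (degree p). smult (c m * poly (eseq t m) (- x0 t)) (E t (gam t m)))"
    by (subst c, rule sum.cong) (simp_all add: E_gam[OF assms] eval_eseq_nz[OF assms])
  thus ?thesis by (intro exI)
qed

lemma smult_sum_right: "smult c (\<Sum>m\<in>A. f m) = (\<Sum>m\<in>A. smult c (f m))"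
  by (induction A rule: infinite_finite_induct) (simp_all add: smult_add_right)

lemma form_eq: "form t C f g = form t C (f * g) 1"
  by (simp add: form_def)

text \<open>In the basis \<open>E t (gam t m)\<close> both transforms are diagonal:
  \<open>transF\<close> gives \<open>N m\<close> times the indicator of \<open>- gam t m\<close>,
  and \<open>transG\<close> returns that indicator to the basis with the weight as factor. Both
  compositions multiply by \<open>N m * weight t (- gam t m)\<close>, which does not depend on
  \<open>m\<close>.\<close>

theorem transforms_inverse:
  assumes "symmetric_functional t (\<lambda>f. form t C f 1)"
    and nz: "weight t (- gam t 0) \<noteq> 0 \<Longrightarrow> form t C 1 1 \<noteq> 0"
  shows "(\<forall>p. transF t C p \<in> fin_fun t) \<and>
         (\<forall>p. transG t (transF t C p) = smult (norm_const t C) p) \<and>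
         (\<forall>f \<in> fin_fun t. transF t C (transG t f) = (\<lambda>g. norm_const t C * f g)) \<and>
         (\<forall>g \<in> uminus ` spec t. weight t (- g) \<noteq> 0 \<longrightarrow>
            form t C (E t g) (E t g) / form t C 1 1 = weight t (- gam t 0) / weight t (- g))"
proof -
  interpret symmetric_functional t "\<lambda>f. form t C f 1" by fact
  define N where "N = (\<lambda>m. form t C (E t (gam t m)) (E t (gam t m)))"
  have N_eq: "N m = form t C (E t (gam t m) * E t (gam t m)) 1" for m
    unfolding N_def by (rule form_eq)
  have N: "N m * weight t (- gam t m) = norm_const t C" for m
    using weight_norm[of m] unfolding N_eq norm_const_def by (simp only: mult.commute)
  have coef: "form t C (\<Sum>m\<in>A. smult (c m) (E t (gam t m))) (E t (gam t n)) = (if n \<in> A then c n * N n else 0)"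
    if "finite A" for A c n
  proof -
    have "form t C (\<Sum>m\<in>A. smult (c m) (E t (gam t m))) (E t (gam t n)) =
        form t C (\<Sum>m\<in>A. smult (c m) (E t (gam t m) * E t (gam t n))) 1"
      unfolding form_eq[of t C _ "E t (gam t n)"] by (simp only: sum_distrib_right mult_smult_left)
    also have "\<dots> = (\<Sum>m\<in>A. c m * form t C (E t (gam t m) * E t (gam t n)) 1)"
      by (simp only: L_sum L_smult)
    also have "\<dots> = (\<Sum>m\<in>A. if n = m then c m * N m else 0)"
      by (intro sum.cong refl) (auto simp: E_orthogonal N_eq)
    finally show ?thesis using that by simp
  qed
  have F: "transF t C p (- gam t m) = form t C p (E t (gam t m))" for p m
    by (auto simp: transF_def spec_def)
  have fin: "transF t C p \<in> fin_fun t \<and> transG t (transF t C p) = smult (norm_const t C) p" for p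
  proof -
    obtain c n where p: "p = (\<Sum>m<n. smult (c m) (E t (gam t m)))" using E_basis[OF gen] by blast
    have Fp: "transF t C p (- gam t m) = (if m < n then c m * N m else 0)" for m
      unfolding F p by (simp add: coef)
    have "{g. transF t C p g \<noteq> 0} \<subseteq> (\<lambda>m. - gam t m) ` {..<n}"
    proof
      fix g assume g: "g \<in> {g. transF t C p g \<noteq> 0}"
      hence "g \<in> spec t" by (auto simp: transF_def split: if_splits)
      then obtain m where "g = - gam t m" by (auto simp: spec_def)
      with g Fp[of m] show "g \<in> (\<lambda>m. - gam t m) ` {..<n}" by (auto split: if_splits)
    qed
    hence "finite {g. transF t C p g \<noteq> 0}" by (rule finite_subset) simp
    moreover have "transG t (transF t C p) = smult (norm_const t C) p"
    proof -
      have "transG t (transF t C p) = (\<Sum>m<n. smult (c m * (N m * weight t (- gam t m))) (E t (gam t m)))"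
        by (subst transG_eq[OF gen, of "{..<n}"]) (simp_all add: Fp mult_ac)
      also have "\<dots> = smult (norm_const t C) (\<Sum>m<n. smult (c m) (E t (gam t m)))"
        by (simp add: N smult_sum_right mult_ac)
      finally show ?thesis by (simp add: p)
    qed
    ultimately show ?thesis by (auto simp: fin_fun_def transF_def)
  qed
  have FG: "transF t C (transG t f) = (\<lambda>g. norm_const t C * f g)" if f: "f \<in> fin_fun t" for f
  proof
    fix g
    show "transF t C (transG t f) g = norm_const t C * f g"
    proof (cases "g \<in> spec t")
      case False
      thus ?thesis using f by (auto simp: transF_def fin_fun_def)
    next
      case True
      then obtain n where n: "g = - gam t n" by (auto simp: spec_def)
      define A where "A = {m. f (- gam t m) \<noteq> 0}"
      have "finite ((\<lambda>m. - gam t m) -` {g. f g \<noteq> 0})"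
        using f gam_inj[OF gen] by (intro finite_vimageI) (auto simp: fin_fun_def inj_def)
      hence A: "finite A" by (simp add: A_def vimage_def)
      have G: "transG t f = (\<Sum>m\<in>A. smult (f (- gam t m) * weight t (- gam t m)) (E t (gam t m)))"
        by (rule transG_eq[OF gen A]) (simp add: A_def)
      have "transF t C (transG t f) g = (if n \<in> A then f g * (N n * weight t (- gam t n)) else 0)"
        unfolding n F G coef[OF A] by simp
      thus ?thesis by (auto simp: N A_def n)
    qed
  qed
  have "form t C (E t g) (E t g) / form t C 1 1 = weight t (- gam t 0) / weight t (- g)"
    if "g \<in> uminus ` spec t" "weight t (- g) \<noteq> 0" for g
  proof -
    from that(1) obtain m where g: "g = gam t m" by (auto simp: spec_def)
    show ?thesis
    proof (cases "weight t (- gam t 0) = 0")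
      case True
      \<comment> \<open>Here \<open>norm_const t C\<close> is 0, which forces the norm at
        \<open>m\<close> to vanish, so both quotients are 0.\<close>
      hence "N m = 0" using N[of m] that(2) by (simp add: norm_const_def g)
      thus ?thesis using True by (simp add: g N_def)
    next
      case False
      hence "N m / form t C 1 1 = weight t (- gam t 0) / weight t (- gam t m)"
        using N[of m] nz[OF False] that(2) unfolding g norm_const_def
        by (subst frac_eq_eq) (simp_all add: mult.commute)
      thus ?thesis unfolding g N_def .
    qed
  qed
  thus ?thesis using fin FG by blast
qed

section \<open>Deformation of contours\<close>

text \<open>The abscissa \<beta> is left free because x -> 1 - x carries a contour along the
  imaginary axis to one along the line of real part 1.\<close>

definition tail_curve :: "real \<Rightarrow> (real \<Rightarrow> complex) \<Rightarrow> bool" where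
  "tail_curve \<beta> C \<longleftrightarrow> (\<exists>R. C piecewise_C1_differentiable_on {-R..R} \<and>
     (\<forall>s. \<bar>s\<bar> \<ge> R \<longrightarrow> C s = of_real \<beta> + \<i> * of_real s))"

definition line_integral :: "(complex \<Rightarrow> complex) \<Rightarrow> (real \<Rightarrow> complex) \<Rightarrow> complex" where
  "line_integral F C = integral UNIV (\<lambda>s. F (C s) * vector_derivative C (at s))"

lemma straight_piecewise_C1: "(\<lambda>s. of_real \<beta> + \<i> * of_real s :: complex) piecewise_C1_differentiable_on S"
proof (rule C1_differentiable_imp_piecewise)
  have "((\<lambda>s. of_real \<beta> + \<i> * of_real s :: complex) has_vector_derivative \<i>) (at x)" for x
    by (auto intro!: derivative_eq_intros)
  thus "(\<lambda>s. of_real \<beta> + \<i> * of_real s :: complex) C1_differentiable_on S"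
    unfolding C1_differentiable_on_def by (intro exI[of _ "\<lambda>_. \<i>"]) auto
qed

lemma tail_curveE:
  assumes "tail_curve \<beta> C"
  obtains R where "R > 0" "\<And>S. S \<ge> R \<Longrightarrow> C piecewise_C1_differentiable_on {-S..S}"
    "\<And>s. \<bar>s\<bar> \<ge> R \<Longrightarrow> C s = of_real \<beta> + \<i> * of_real s" "continuous_on UNIV C"
proof -
  obtain R where R: "C piecewise_C1_differentiable_on {-R..R}"
     "\<And>s. \<bar>s\<bar> \<ge> R \<Longrightarrow> C s = of_real \<beta> + \<i> * of_real s" using assms by (auto simp: tail_curve_def)
  define l where "l = (\<lambda>s. of_real \<beta> + \<i> * of_real s :: complex)"
  have pc: "C piecewise_C1_differentiable_on {-S..S}" if "S > \<bar>R\<bar>" for S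
  proof (cases "R \<ge> 0")
    case False
    \<comment> \<open>For negative \<open>R\<close> the interval is empty, but then the tail formula
      holds on the whole line.\<close>
    hence "C = l" by (auto simp: l_def R(2))
    thus ?thesis unfolding l_def by (simp add: straight_piecewise_C1)
  next
    case True
    have 1: "(\<lambda>x. if x \<le> -R then l x else C x) piecewise_C1_differentiable_on {-S..R}"
      using that True R by (intro piecewise_C1_differentiable_cases) (auto simp: l_def straight_piecewise_C1)
    have "(\<lambda>x. if x \<le> R then (if x \<le> -R then l x else C x) else l x) piecewise_C1_differentiable_on {-S..S}"
      using that True R by (intro piecewise_C1_differentiable_cases 1) (auto simp: l_def straight_piecewise_C1)
    also have "(\<lambda>x. if x \<le> R then (if x \<le> -R then l x else C x) else l x) = C"
      using R(2) True by (auto simp: l_def)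
    finally show ?thesis .
  qed
  show ?thesis
  proof (rule that[of "\<bar>R\<bar> + 1"])
    show "continuous_on UNIV C"
    proof (rule continuous_at_imp_continuous_on, intro ballI)
      fix x
      define S where "S = \<bar>R\<bar> + \<bar>x\<bar> + 1"
      have "continuous_on {-S..S} C"
        using pc[of S] by (auto simp: S_def piecewise_C1_differentiable_on_def)
      hence "continuous_on {-S<..<S} C" by (rule continuous_on_subset) auto
      moreover have "x \<in> {-S<..<S}" by (auto simp: S_def)
      ultimately show "isCont C x" using continuous_on_eq_continuous_at[OF open_greaterThanLessThan] by blast
    qed
  qed (use pc R(2) in auto)
qed

text \<open>Closedness makes the components of the complement open, and therefore path
  connected.\<close>

lemma tail_curve_closed: "tail_curve \<beta> C \<Longrightarrow> closed (range C)"
proof (elim tail_curveE)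
  fix R :: real
  assume R: "R > 0" "\<And>s. \<bar>s\<bar> \<ge> R \<Longrightarrow> C s = of_real \<beta> + \<i> * of_real s" "continuous_on UNIV C"
  have "range C = C ` {-R..R} \<union> ({z. Re z = \<beta>} \<inter> ({z. Im z \<ge> R} \<union> {z. Im z \<le> -R}))" (is "_ = ?A")
  proof
    show "range C \<subseteq> ?A"
    proof
      fix z assume "z \<in> range C"
      then obtain s where s: "z = C s" by auto
      show "z \<in> ?A"
      proof (cases "\<bar>s\<bar> \<ge> R")
        case True
        thus ?thesis using R(2)[of s] unfolding s by auto
      next
        case False
        hence "C s \<in> C ` {-R..R}" by (intro imageI) auto
        thus ?thesis unfolding s by blast
      qed
    qed
    show "?A \<subseteq> range C"
    proof
      fix z assume "z \<in> ?A"
      thus "z \<in> range C"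
      proof
        assume "z \<in> {z. Re z = \<beta>} \<inter> ({z. Im z \<ge> R} \<union> {z. Im z \<le> -R})"
        hence "z = C (Im z)" using R(1) by (subst R(2)) (auto simp: complex_eq_iff)
        thus ?thesis by (rule range_eqI)
      qed auto
    qed
  qed
  moreover have "closed (C ` {-R..R})"
    using R(3) by (intro compact_imp_closed compact_continuous_image) (auto intro: continuous_on_subset)
  ultimately show ?thesis
    by (auto intro!: closed_Un closed_Int closed_halfspace_Im_ge closed_halfspace_Im_le closed_Collect_eq continuous_intros)
qed

lemma tail_curve_bounded_Re:
  assumes "tail_curve \<beta> C" obtains M where "M \<ge> \<bar>\<beta>\<bar>" "\<And>s. \<bar>Re (C s)\<bar> \<le> M"
proof -
  obtain R where R: "R > 0" "\<And>s. \<bar>s\<bar> \<ge> R \<Longrightarrow> C s = of_real \<beta> + \<i> * of_real s" "continuous_on UNIV C"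
    using tail_curveE[OF assms] by metis
  have "compact (C ` {-R..R})" using R(3) by (intro compact_continuous_image) (auto intro: continuous_on_subset)
  then obtain B where B: "\<And>z. z \<in> C ` {-R..R} \<Longrightarrow> norm z \<le> B" by (meson bounded_iff compact_imp_bounded)
  show ?thesis
  proof (rule that[of "max B \<bar>\<beta>\<bar>"])
    fix s show "\<bar>Re (C s)\<bar> \<le> max B \<bar>\<beta>\<bar>"
    proof (cases "\<bar>s\<bar> \<ge> R")
      case True thus ?thesis by (simp add: R(2))
    next
      case False
      hence "norm (C s) \<le> B" by (intro B imageI) auto
      thus ?thesis using abs_Re_le_cmod[of "C s"] by linarith
    qed
  qed simp
qed

section \<open>Integrals over the line as limits of truncations\<close>

lemma integrable_exp_abs:
  assumes "c > (0::real)" shows "(\<lambda>s. exp (- c * \<bar>s\<bar>)) integrable_on UNIV"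
proof -
  have i: "(\<lambda>s. exp (- c * s)) integrable_on {0..}"
    using integrable_on_exp_minus_to_infinity[OF assms, of 0] by simp
  hence "(\<lambda>s. exp (- c * s)) absolutely_integrable_on {0..}"
    by (intro nonnegative_absolutely_integrable_1) auto
  hence "(\<lambda>s. exp (- c * (- s))) absolutely_integrable_on {..0}"
    using has_absolute_integral_reflect_real[of "{..0}" "{0..}" "\<lambda>s. exp (- c * s)"] by auto
  hence "(\<lambda>s. exp (- c * (- s))) integrable_on {..0}" by (rule set_lebesgue_integral_eq_integral)
  hence 1: "(\<lambda>s. exp (- c * \<bar>s\<bar>)) integrable_on {..0}" by (rule integrable_eq) auto
  have 2: "(\<lambda>s. exp (- c * \<bar>s\<bar>)) integrable_on {0..}" by (rule integrable_eq[OF i]) auto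
  have "(\<lambda>s. exp (- c * \<bar>s\<bar>)) integrable_on ({..0} \<union> {0..})"
    by (rule integrable_Un[OF _ 1 2]) (rule negligible_subset[of "{0}"], auto)
  also have "{..0::real} \<union> {0..} = UNIV" by auto
  finally show ?thesis .
qed

text \<open>The bound is available only for \<open>\<bar>s\<bar> \<ge> R\<close>, so
  \<open>f\<close> is split into a compactly supported part and a rest \<open>g\<close> whose
  truncations have a common integrable majorant.\<close>

lemma integral_UNIV_limit:
  fixes f :: "real \<Rightarrow> complex"
  assumes int: "\<And>S. S \<ge> R \<Longrightarrow> f integrable_on {-S..S}" and R: "R \<ge> 0" and c: "c > 0"
    and bd: "\<And>s. \<bar>s\<bar> \<ge> R \<Longrightarrow> norm (f s) \<le> K * exp (- c * \<bar>s\<bar>)"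
  shows "f integrable_on UNIV" "(\<lambda>k. integral {-real k..real k} f) \<longlonglongrightarrow> integral UNIV f"
proof -
  define f1 where "f1 = (\<lambda>s. if s \<in> {-R..R} then f s else 0)"
  define g where "g = (\<lambda>s. if s \<in> {-R..R} then 0 else f s)"
  have f1: "(f1 has_integral integral {-R..R} f) UNIV"
    unfolding f1_def has_integral_restrict_UNIV using int[of R] by (simp add: integrable_integral)
  have fg: "f = (\<lambda>s. f1 s + g s)" by (auto simp: f1_def g_def)
  define gk where "gk = (\<lambda>k s. if s \<in> {-real k..real k} then g s else 0)"
  have gi: "g integrable_on {-S..S}" "integral {-S..S} f = integral {-R..R} f + integral {-S..S} g" if "S \<ge> R" for S
  proof -
    have "f1 integrable_on {-S..S}" using f1 by (auto intro: integrable_on_subinterval)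
    from integrable_diff[OF int[OF that] this] show gi: "g integrable_on {-S..S}"
      by (rule integrable_eq) (auto simp: f1_def g_def)
    have "integral {-S..S} f = integral {-S..S} f1 + integral {-S..S} g"
      by (subst fg, rule integral_add) fact+
    also have "integral {-S..S} f1 = integral ({-R..R} \<inter> {-S..S}) f"
      unfolding f1_def by (rule integral_restrict_Int)
    also have "{-R..R} \<inter> {-S..S} = {-R..R}" using that by auto
    finally show "integral {-S..S} f = integral {-R..R} f + integral {-S..S} g" .
  qed
  have gki: "gk k integrable_on UNIV" for k
    unfolding gk_def integrable_restrict_UNIV
  proof (cases "real k \<ge> R")
    case True thus "g integrable_on {-real k..real k}" by (rule gi)
  next
    case False
    show "g integrable_on {-real k..real k}"
      by (rule integrable_on_subinterval[OF gi(1)[of R]]) (use False in auto)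
  qed
  have "0 \<le> K * exp (- c * \<bar>R\<bar>)" using R by (intro order.trans[OF norm_ge_zero bd]) simp
  hence K: "K \<ge> 0" by (simp add: zero_le_mult_iff)
  have h: "(\<lambda>s. K * exp (- c * \<bar>s\<bar>)) integrable_on UNIV"
    using integrable_exp_abs[OF c] by (rule integrable_on_mult_right)
  have le: "norm (gk k s) \<le> K * exp (- c * \<bar>s\<bar>)" for k s
    using bd[of s] K by (auto simp: gk_def g_def)
  have conv: "(\<lambda>k. gk k s) \<longlonglongrightarrow> g s" for s
  proof (rule tendsto_eventually)
    show "\<forall>\<^sub>F k in sequentially. gk k s = g s"
      using eventually_ge_at_top[of "nat \<lceil>\<bar>s\<bar>\<rceil>"]
    proof eventually_elim
      case (elim k)
      hence "\<bar>s\<bar> \<le> real k" by linarith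
      thus ?case by (auto simp: gk_def abs_le_iff)
    qed
  qed
  have gU: "g integrable_on UNIV" by (rule dominated_convergence(1)[where f = gk and S = UNIV, OF gki h le conv])
  have lim: "(\<lambda>k. integral UNIV (gk k)) \<longlonglongrightarrow> integral UNIV g"
    by (rule dominated_convergence(2)[where f = gk and S = UNIV, OF gki h le conv])
  have f1U: "f1 integrable_on UNIV" using f1 by (rule has_integral_integrable)
  from integrable_add[OF f1U gU] show "f integrable_on UNIV" by (subst fg)
  have "integral UNIV f = integral {-R..R} f + integral UNIV g"
    using integral_add[OF f1U gU] by (subst fg) (simp only: integral_unique[OF f1])
  moreover have "(\<lambda>k. integral {-R..R} f + integral UNIV (gk k)) \<longlonglongrightarrow> integral {-R..R} f + integral UNIV g"
    by (intro tendsto_intros lim)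
  moreover have "\<forall>\<^sub>F k in sequentially. integral {-R..R} f + integral UNIV (gk k) = integral {-real k..real k} f"
    using eventually_ge_at_top[of "nat \<lceil>R\<rceil>"]
  proof eventually_elim
    case (elim k)
    hence "real k \<ge> R" by linarith
    thus ?case unfolding gk_def integral_restrict_UNIV by (rule gi(2)[symmetric])
  qed
  ultimately show "(\<lambda>k. integral {-real k..real k} f) \<longlonglongrightarrow> integral UNIV f"
    by (simp add: tendsto_cong)
qed

text \<open>The affine reparametrization onto the unit interval, the domain of paths, contour
  integrals and winding numbers.\<close>

definition trunc :: "(real \<Rightarrow> complex) \<Rightarrow> real \<Rightarrow> real \<Rightarrow> complex" where
  "trunc C S = C \<circ> (\<lambda>x. (2 * S) *\<^sub>R x + (- S))"

lemma trunc_props: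
  assumes "C piecewise_C1_differentiable_on {-S..S}" "S > 0"
  shows "valid_path (trunc C S)" "path_image (trunc C S) = C ` {-S..S}"
    "pathstart (trunc C S) = C (-S)" "pathfinish (trunc C S) = C S"
proof -
  have im: "(\<lambda>x. 2 * S * x + (- S)) ` {0..1} = {-S..S}"
    using image_affinity_atLeastAtMost[of "2 * S" "-S" 0 1] assms(2) by simp
  show "valid_path (trunc C S)"
    unfolding valid_path_def trunc_def
    by (rule piecewise_C1_differentiable_affine) (use im assms in simp)
  show "path_image (trunc C S) = C ` {-S..S}"
    unfolding path_image_def trunc_def by (simp only: image_comp[symmetric] real_scaleR_def im)
qed (simp_all add: trunc_def pathstart_def pathfinish_def)

text \<open>Off the preimages of finitely many corners the chain rule produces the factor
  \<open>2 * S\<close>, which the affine substitution removes again.\<close>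

lemma trunc_integral:
  assumes C: "C piecewise_C1_differentiable_on {-S..S}" "S > 0" and F: "F contour_integrable_on trunc C S"
  shows "((\<lambda>s. F (C s) * vector_derivative C (at s)) has_integral contour_integral (trunc C S) F) {-S..S}"
proof -
  define h where "h = (\<lambda>s. F (C s) * vector_derivative C (at s))"
  obtain T where T: "finite T" "C C1_differentiable_on {-S..S} - T"
    using C(1) by (auto simp: piecewise_C1_differentiable_on_def)
  have "((\<lambda>x. F (trunc C S x) * vector_derivative (trunc C S) (at x)) has_integral contour_integral (trunc C S) F) {0..1}"
    using F has_contour_integral_integral has_contour_integral by blast
  hence "((\<lambda>x. (2 * S) * h ((2 * S) *\<^sub>R x + (-S))) has_integral contour_integral (trunc C S) F) {0..1}"
  proof (rule has_integral_spike_finite[rotated 2])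
    show "finite ((\<lambda>y. (y + S) / (2 * S)) ` T)" using T by simp
    fix x assume x: "x \<in> {0..1} - (\<lambda>y. (y + S) / (2 * S)) ` T"
    define y where "y = (2 * S) *\<^sub>R x + (-S)"
    have "x = (y + S) / (2 * S)" using C(2) by (simp add: y_def field_simps)
    hence "y \<notin> T" using x by auto
    moreover have "y \<in> {-S..S}" using x C(2) by (auto simp: y_def mult_le_cancel_left1)
    ultimately have d: "(C has_vector_derivative vector_derivative C (at y)) (at y)"
      using T(2) by (auto simp: C1_differentiable_on_eq vector_derivative_works)
    have "((\<lambda>x. (2 * S) *\<^sub>R x + (-S)) has_vector_derivative (2 * S)) (at x)"
      by (auto intro!: derivative_eq_intros)
    from vector_diff_chain_at[OF this] d
    have "(trunc C S has_vector_derivative (2 * S) *\<^sub>R vector_derivative C (at y)) (at x)"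
      unfolding trunc_def y_def by blast
    hence "vector_derivative (trunc C S) (at x) = (2 * S) *\<^sub>R vector_derivative C (at y)"
      by (rule vector_derivative_at)
    thus "(2 * S) * h ((2 * S) *\<^sub>R x + (-S)) = F (trunc C S x) * vector_derivative (trunc C S) (at x)"
      by (simp add: h_def y_def trunc_def scaleR_conv_of_real)
  qed
  hence "((\<lambda>x. (1 / (2 * S)) *\<^sub>R ((2 * S) * h ((2 * S) *\<^sub>R x + (-S)))) has_integral
      (1 / (2 * S)) *\<^sub>R contour_integral (trunc C S) F) {0..1}" by (rule has_integral_cmul)
  also have "(\<lambda>x. (1 / (2 * S)) *\<^sub>R ((2 * S) * h ((2 * S) *\<^sub>R x + (-S)))) = (\<lambda>x. h ((2 * S) *\<^sub>R x + (-S)))"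
    using C(2) by (auto simp: scaleR_conv_of_real)
  finally have A: "((\<lambda>x. h ((2 * S) *\<^sub>R x + (-S))) has_integral (1 / (2 * S)) *\<^sub>R contour_integral (trunc C S) F) {0..1}" .
  have e: "contour_integral (trunc C S) F /\<^sub>R (2 * S) ^ DIM(real) = (1 / (2 * S)) *\<^sub>R contour_integral (trunc C S) F"
    by (simp add: inverse_eq_divide)
  have b: "(- S - (- S)) /\<^sub>R (2 * S) = 0" "(S - (-S)) /\<^sub>R (2 * S) = 1"
    using C(2) by (simp_all add: field_simps)
  have "((\<lambda>x. h ((2 * S) *\<^sub>R x + (-S))) has_integral contour_integral (trunc C S) F /\<^sub>R (2 * S) ^ DIM(real))
      (cbox ((- S - (- S)) /\<^sub>R (2 * S)) ((S - (-S)) /\<^sub>R (2 * S)))"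
    unfolding e b using A by simp
  hence "(h has_integral contour_integral (trunc C S) F) (cbox (-S) S)"
    by (subst (asm) has_integral_affinity_iff) (use C(2) in simp_all)
  thus ?thesis by (simp add: h_def)
qed

section \<open>Sides of a curve and winding numbers\<close>

definition side :: "real \<Rightarrow> (real \<Rightarrow> complex) \<Rightarrow> complex \<Rightarrow> bool" where
  "side \<sigma> C p \<longleftrightarrow> (\<exists>B. \<forall>r\<ge>B. connected_component (- range C) p (of_real (\<sigma> * r)))"

lemma side_right: "right_of_curve C p \<longleftrightarrow> side 1 C p"
  by (simp add: right_of_curve_def side_def eventually_at_top_linorder)

lemma side_left: "left_of_curve C p \<longleftrightarrow> side (-1) C p"
  unfolding left_of_curve_def side_def eventually_at_bot_linorder
proof
  assume "\<exists>N. \<forall>n\<le>N. connected_component (- range C) p (of_real n)"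
  then obtain N where N: "\<forall>n\<le>N. connected_component (- range C) p (of_real n)" ..
  show "\<exists>B. \<forall>r\<ge>B. connected_component (- range C) p (of_real (-1 * r))"
  proof (intro exI[of _ "- N"] allI impI)
    fix r assume "r \<ge> - N"
    thus "connected_component (- range C) p (of_real (-1 * r))"
      using N[rule_format, of "-r"] by simp
  qed
next
  assume "\<exists>B. \<forall>r\<ge>B. connected_component (- range C) p (of_real (-1 * r))"
  then obtain B where B: "\<forall>r\<ge>B. connected_component (- range C) p (of_real (-1 * r))" ..
  show "\<exists>N. \<forall>n\<le>N. connected_component (- range C) p (of_real n)"
  proof (intro exI[of _ "- B"] allI impI)
    fix n assume "n \<le> - B"
    thus "connected_component (- range C) p (of_real n)" using B[rule_format, of "-n"] by simp
  qed
qed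

lemma side_not_range: "side \<sigma> C p \<Longrightarrow> p \<notin> range C"
  unfolding side_def using connected_component_in(1) by fastforce

text \<open>The path \<eta> closes the truncated curve. It keeps away from a disc, meant to contain
  an escape path of \<open>p\<close>, and does not pass the abscissa \<open>M0\<close> on the side
  of \<open>p\<close>. Admitting every such \<eta> lets two curves be closed along different
  routes.\<close>

definition unwound :: "real \<Rightarrow> real \<Rightarrow> (real \<Rightarrow> complex) \<Rightarrow> complex \<Rightarrow> real \<Rightarrow> bool" where
  "unwound \<sigma> M0 C p \<rho> \<longleftrightarrow> (\<forall>S \<eta>. C piecewise_C1_differentiable_on {-S..S} \<longrightarrow> S > 0 \<longrightarrow> path \<eta> \<longrightarrow>
     pathstart \<eta> = C S \<longrightarrow> pathfinish \<eta> = C (-S) \<longrightarrow>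
     path_image \<eta> \<subseteq> {z. \<rho> < norm z \<and> \<sigma> * Re z \<le> M0} \<longrightarrow>
     p \<notin> path_image \<eta> \<and> winding_number (trunc C S) p + winding_number \<eta> p = 0)"

text \<open>
  A path from p to the far real axis that avoids the curve is bounded, so closing up a long
  truncation of the curve far away on the other side does not wind around p.
\<close>

lemma winding_number_side:
  fixes \<sigma> :: real
  assumes \<sigma>: "\<sigma> = 1 \<or> \<sigma> = -1" and C: "tail_curve \<beta> C" and p: "side \<sigma> C p"
  shows "\<exists>\<rho>. unwound \<sigma> M0 C p \<rho>"
proof -
  have \<sigma>\<sigma>: "\<sigma> * \<sigma> = 1" "\<bar>\<sigma>\<bar> = 1" using \<sigma> by auto
  obtain M where M: "\<And>s. \<bar>Re (C s)\<bar> \<le> M" using tail_curve_bounded_Re[OF C] by metis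
  obtain B where B: "\<And>r. r \<ge> B \<Longrightarrow> connected_component (- range C) p (of_real (\<sigma> * r))"
    using p by (auto simp: side_def)
  \<comment> \<open>The real point \<open>q\<close> is to be reachable from \<open>p\<close> and to
    lie beyond both the curve and the closing path.\<close>
  define r where "r = max B (max M M0) + 1"
  define q :: complex where "q = of_real (\<sigma> * r)"
  have "connected_component (- range C) p q" unfolding q_def by (intro B) (simp add: r_def)
  hence q: "q \<in> connected_component_set (- range C) p" by simp
  have op: "open (- range C)" using tail_curve_closed[OF C] by auto
  hence "open (connected_component_set (- range C) p)" by (rule open_connected_component)
  hence "path_connected (connected_component_set (- range C) p)"
    using connected_open_path_connected connected_connected_component by blast
  moreover have "p \<in> connected_component_set (- range C) p"
    using q connected_component_in(1) by fastforce
  ultimately obtain g where g: "path g" "path_image g \<subseteq> connected_component_set (- range C) p"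
      "pathstart g = p" "pathfinish g = q"
    using q unfolding path_connected_def by blast
  have gC: "path_image g \<subseteq> - range C" using g(2) connected_component_subset by blast
  obtain \<rho> where \<rho>: "\<And>z. z \<in> path_image g \<Longrightarrow> norm z \<le> \<rho>"
    using compact_imp_bounded[OF compact_path_image[OF g(1)]] bounded_iff by blast
  have pg: "p \<in> path_image g" "q \<in> path_image g"
    using g pathstart_in_path_image pathfinish_in_path_image by blast+
  show ?thesis unfolding unwound_def
  proof (intro exI[of _ \<rho>] allI impI)
    fix S \<eta>
    assume S: "C piecewise_C1_differentiable_on {-S..S}" "S > 0"
      and \<eta>: "path \<eta>" "pathstart \<eta> = C S" "pathfinish \<eta> = C (-S)"
        "path_image \<eta> \<subseteq> {z. \<rho> < norm z \<and> \<sigma> * Re z \<le> M0}"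
    note t = trunc_props[OF S]
    define \<gamma> where "\<gamma> = trunc C S +++ \<eta>"
    have pt: "path (trunc C S)" using t(1) by (rule valid_path_imp_path)
    have \<gamma>: "path \<gamma>" "pathstart \<gamma> = C (-S)" "pathfinish \<gamma> = C (-S)"
      unfolding \<gamma>_def using pt \<eta> t by simp_all
    have im: "path_image \<gamma> = C ` {-S..S} \<union> path_image \<eta>"
      unfolding \<gamma>_def using t \<eta> by (subst path_image_join) simp_all
    have p\<eta>: "z \<notin> path_image \<eta>" if "z \<in> path_image g" for z
      using \<eta>(4) \<rho>[OF that] by force
    have disj: "path_image g \<inter> path_image \<gamma> = {}"
      unfolding im using p\<eta> gC by blast
    have "winding_number \<gamma> constant_on path_image g"
      using \<gamma> g(1) disj by (intro winding_number_constant connected_path_image) auto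
    hence "winding_number \<gamma> p = winding_number \<gamma> q"
      using pg by (auto simp: constant_on_def)
    \<comment> \<open>The whole loop lies in a half-plane that does not contain
      \<open>q\<close>.\<close>
    also have "winding_number \<gamma> q = 0"
    proof (rule winding_number_zero_outside)
      have "{z. \<sigma> * Re z < r} = {z. inner (of_real \<sigma>) z < r}" by (simp add: inner_complex_def)
      also have "convex \<dots>" by (rule convex_halfspace_lt)
      finally show "convex {z. \<sigma> * Re z < r}" .
      show "q \<notin> {z. \<sigma> * Re z < r}" using \<sigma>\<sigma> by (simp add: q_def mult.assoc[symmetric])
      show "path_image \<gamma> \<subseteq> {z. \<sigma> * Re z < r}"
      proof
        fix z assume "z \<in> path_image \<gamma>"
        thus "z \<in> {z. \<sigma> * Re z < r}" unfolding im
        proof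
          assume "z \<in> C ` {-S..S}"
          hence "\<bar>Re z\<bar> \<le> M" using M by auto
          hence "\<sigma> * Re z \<le> M" using \<sigma> by auto
          thus ?thesis by (simp add: r_def)
        next
          assume "z \<in> path_image \<eta>"
          hence "\<sigma> * Re z \<le> M0" using \<eta>(4) by auto
          thus ?thesis by (simp add: r_def)
        qed
      qed
    qed (use \<gamma> in simp_all)
    finally have 0: "winding_number \<gamma> p = 0" .
    have "p \<notin> C ` {-S..S}" using pg(1) gC by blast
    hence "winding_number \<gamma> p = winding_number (trunc C S) p + winding_number \<eta> p"
      unfolding \<gamma>_def using pt \<eta> t p\<eta>[OF pg(1)] by (intro winding_number_join) simp_all
    thus "p \<notin> path_image \<eta> \<and> winding_number (trunc C S) p + winding_number \<eta> p = 0"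
      using 0 p\<eta>[OF pg(1)] by simp
  qed
qed

text \<open>The constants may depend on the width of the strip. Negative \<open>r\<close> describes
  growth, so that rates of factors simply add.\<close>

definition decay_rate :: "real \<Rightarrow> (complex \<Rightarrow> complex) \<Rightarrow> bool" where
  "decay_rate r F \<longleftrightarrow> (\<forall>M. \<exists>K T. \<forall>x. \<bar>Re x\<bar> \<le> M \<longrightarrow> \<bar>Im x\<bar> \<ge> T \<longrightarrow> norm (F x) \<le> K * exp (- r * \<bar>Im x\<bar>))"

lemma decay_rateE:
  assumes "decay_rate r F"
  obtains K T where "K \<ge> 0" "\<And>x. \<bar>Re x\<bar> \<le> M \<Longrightarrow> \<bar>Im x\<bar> \<ge> T \<Longrightarrow> norm (F x) \<le> K * exp (- r * \<bar>Im x\<bar>)"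
proof -
  obtain K T where K: "\<And>x. \<bar>Re x\<bar> \<le> M \<Longrightarrow> \<bar>Im x\<bar> \<ge> T \<Longrightarrow> norm (F x) \<le> K * exp (- r * \<bar>Im x\<bar>)"
    using assms[unfolded decay_rate_def, rule_format, of M] by blast
  show ?thesis
  proof (rule that[of "max K 0" T])
    fix x assume "\<bar>Re x\<bar> \<le> M" "\<bar>Im x\<bar> \<ge> T"
    hence "norm (F x) \<le> K * exp (- r * \<bar>Im x\<bar>)" by (rule K)
    also have "\<dots> \<le> max K 0 * exp (- r * \<bar>Im x\<bar>)" by (intro mult_right_mono) auto
    finally show "norm (F x) \<le> max K 0 * exp (- r * \<bar>Im x\<bar>)" .
  qed auto
qed

definition strip_decay :: "(complex \<Rightarrow> complex) \<Rightarrow> bool" where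
  "strip_decay F \<longleftrightarrow> (\<exists>r>0. decay_rate r F)"

lemma strip_decayE:
  assumes "strip_decay F"
  obtains K c T where "0 < c" "K \<ge> 0"
    "\<And>x. \<bar>Re x\<bar> \<le> M \<Longrightarrow> \<bar>Im x\<bar> \<ge> T \<Longrightarrow> norm (F x) \<le> K * exp (- c * \<bar>Im x\<bar>)"
  using assms unfolding strip_decay_def by (metis decay_rateE)

lemma line_integral_limit:
  assumes C: "tail_curve \<beta> C" and P: "closed P" "range C \<inter> P = {}" and F: "F holomorphic_on - P"
    and d: "strip_decay F"
  shows "(\<lambda>s. F (C s) * vector_derivative C (at s)) integrable_on UNIV"
    and "(\<lambda>k. contour_integral (trunc C (real k)) F) \<longlonglongrightarrow> line_integral F C"
proof -
  obtain R where R: "R > 0" "\<And>S. S \<ge> R \<Longrightarrow> C piecewise_C1_differentiable_on {-S..S}"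
    "\<And>s. \<bar>s\<bar> \<ge> R \<Longrightarrow> C s = of_real \<beta> + \<i> * of_real s" using tail_curveE[OF C] by metis
  obtain K c T where K: "0 < c" "K \<ge> 0"
    "\<And>x. \<bar>Re x\<bar> \<le> \<bar>\<beta>\<bar> \<Longrightarrow> \<bar>Im x\<bar> \<ge> T \<Longrightarrow> norm (F x) \<le> K * exp (- c * \<bar>Im x\<bar>)"
    using strip_decayE[OF d, of "\<bar>\<beta>\<bar>"] by metis
  define f where "f = (\<lambda>s. F (C s) * vector_derivative C (at s))"
  have ci: "F contour_integrable_on trunc C S" if "S \<ge> R" for S
    using trunc_props[OF R(2)[OF that]] R(1) that P
    by (intro contour_integrable_holomorphic_simple[OF F]) auto
  have hi: "(f has_integral contour_integral (trunc C S) F) {-S..S}" if "S \<ge> R" for S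
    unfolding f_def using that R(1) by (intro trunc_integral R ci) auto
  \<comment> \<open>On the tails the curve moves with velocity \<open>\<i>\<close>, so the integrand
    has the size of \<open>F\<close> itself.\<close>
  have bd: "norm (f s) \<le> K * exp (- c * \<bar>s\<bar>)" if s: "\<bar>s\<bar> \<ge> max (R + 1) T" for s
  proof -
    have "(C has_vector_derivative \<i>) (at s)"
    proof (rule has_vector_derivative_transform_within_open)
      show "((\<lambda>s. of_real \<beta> + \<i> * of_real s :: complex) has_vector_derivative \<i>) (at s)"
        by (auto intro!: derivative_eq_intros)
      show "open {y. \<bar>y\<bar> > R}" by (intro open_Collect_less continuous_intros)
      show "s \<in> {y. \<bar>y\<bar> > R}" using s by auto
    qed (use R(3) in auto)
    hence "norm (f s) = norm (F (C s))" by (simp add: f_def vector_derivative_at norm_mult)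
    also have "\<dots> \<le> K * exp (- c * \<bar>Im (C s)\<bar>)" using s by (intro K(3)) (auto simp: R(3))
    also have "Im (C s) = s" using s by (simp add: R(3))
    finally show ?thesis .
  qed
  have R0: "0 \<le> max (R + 1) T" using R(1) by simp
  have fi: "f integrable_on {-S..S}" if "S \<ge> max (R + 1) T" for S
    using hi[of S] that by auto
  note lim = integral_UNIV_limit[OF fi R0 K(1) bd]
  show "(\<lambda>s. F (C s) * vector_derivative C (at s)) integrable_on UNIV"
    using lim(1) by (simp add: f_def)
  have "\<forall>\<^sub>F k in sequentially. integral {-real k..real k} f = contour_integral (trunc C (real k)) F"
    using eventually_ge_at_top[of "nat \<lceil>R\<rceil>"]
  proof eventually_elim
    case (elim k)
    hence "real k \<ge> R" by linarith
    thus ?case using hi by (simp add: integral_unique)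
  qed
  with lim(2) show "(\<lambda>k. contour_integral (trunc C (real k)) F) \<longlonglongrightarrow> line_integral F C"
    unfolding line_integral_def f_def[symmetric] by (simp add: tendsto_cong)
qed

text \<open>At the parameter \<open>u\<close> the imaginary part has size \<open>(1 - u) * S\<close>
  and the real part at least \<open>u * S - M0\<close>. Their sum is at least \<open>S - M0\<close>
  everywhere, which exceeds \<open>2 * \<bar>\<rho>\<bar>\<close>.\<close>

lemma closing_segment_far:
  fixes \<sigma> b S \<rho> :: real
  assumes \<sigma>: "\<sigma> = 1 \<or> \<sigma> = -1" and "\<bar>b\<bar> \<le> M0" "S > 2 * \<bar>\<rho>\<bar> + M0" "\<epsilon> = 1 \<or> \<epsilon> = -1"
    and z: "z \<in> closed_segment (of_real b + \<i> * of_real (\<epsilon> * S)) (of_real (- \<sigma> * S))"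
  shows "\<rho> < norm z \<and> \<sigma> * Re z \<le> M0"
proof -
  obtain u where u: "0 \<le> u" "u \<le> 1"
    "z = (1 - u) *\<^sub>R (of_real b + \<i> * of_real (\<epsilon> * S)) + u *\<^sub>R of_real (- \<sigma> * S)"
    using z by (auto simp: in_segment)
  have S: "S > 0" using assms by linarith
  have im: "Im z = \<epsilon> * ((1 - u) * S)" by (simp add: u(3))
  hence im': "\<bar>Im z\<bar> = (1 - u) * S" using assms(4) u S by (auto simp: abs_mult)
  have "\<sigma> * Re z = \<sigma> * ((1 - u) * b) - (\<sigma> * \<sigma>) * (u * S)"
    by (simp add: u(3) algebra_simps)
  also have "\<sigma> * \<sigma> = 1" using \<sigma> by auto
  finally have re: "\<sigma> * Re z = \<sigma> * ((1 - u) * b) - u * S" by simp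
  have "\<bar>\<sigma> * ((1 - u) * b)\<bar> = (1 - u) * \<bar>b\<bar>" using \<sigma> u by (auto simp: abs_mult)
  also have "\<dots> \<le> 1 * M0" using u assms(2) by (intro mult_mono) auto
  finally have b: "\<bar>\<sigma> * ((1 - u) * b)\<bar> \<le> M0" by simp
  have uS: "u * S \<ge> 0" using u S by simp
  have "\<bar>\<sigma> * Re z\<bar> = \<bar>Re z\<bar>" using \<sigma> by auto
  hence "\<bar>Re z\<bar> \<ge> u * S - M0" using re b by linarith
  moreover have "u * S + (1 - u) * S = S" by (simp add: algebra_simps)
  ultimately have "\<bar>Re z\<bar> + \<bar>Im z\<bar> \<ge> S - M0" using im' by linarith
  hence "2 * norm z > 2 * \<bar>\<rho>\<bar>" using assms(3) abs_Re_le_cmod[of z] abs_Im_le_cmod[of z] by linarith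
  moreover have "\<sigma> * Re z \<le> M0" using re b uS by linarith
  ultimately show ?thesis by linarith
qed

lemma horizontal_segment:
  assumes "z \<in> closed_segment (of_real a + \<i> * of_real h) (of_real b + \<i> * of_real h)"
  shows "Im z = h" "\<bar>Re z\<bar> \<le> max \<bar>a\<bar> \<bar>b\<bar>"
proof -
  obtain u where u: "0 \<le> u" "u \<le> 1"
    "z = (1 - u) *\<^sub>R (of_real a + \<i> * of_real h) + u *\<^sub>R (of_real b + \<i> * of_real h)"
    using assms by (auto simp: in_segment)
  show "Im z = h" by (simp add: u(3) algebra_simps)
  have "Re z = (1 - u) * a + u * b" by (simp add: u(3))
  also have "\<bar>\<dots>\<bar> \<le> (1 - u) * \<bar>a\<bar> + u * \<bar>b\<bar>"
    using u abs_triangle_ineq[of "(1 - u) * a" "u * b"] by (simp add: abs_mult)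
  also have "\<dots> \<le> (1 - u) * max \<bar>a\<bar> \<bar>b\<bar> + u * max \<bar>a\<bar> \<bar>b\<bar>"
    using u by (intro add_mono mult_left_mono) auto
  also have "\<dots> = max \<bar>a\<bar> \<bar>b\<bar>" by (simp add: algebra_simps)
  finally show "\<bar>Re z\<bar> \<le> max \<bar>a\<bar> \<bar>b\<bar>" .
qed

text \<open>Joined by two horizontal segments, the truncations form a loop in a vertical strip. Once
  the height is large the loop winds around no point of \<open>P\<close>, so the difference of the
  truncated integrals equals the contribution of the segments, which decays.\<close>

theorem line_integral_cong_contour:
  assumes C1: "tail_curve \<beta>1 C1" and C2: "tail_curve \<beta>2 C2"
    and sides: "\<And>p. p \<in> P \<Longrightarrow> (side 1 C1 p \<and> side 1 C2 p) \<or> (side (-1) C1 p \<and> side (-1) C2 p)"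
    and P: "closed P" "\<And>M. finite {p\<in>P. \<bar>Re p\<bar> \<le> M}"
    and F: "F holomorphic_on - P" and d: "strip_decay F"
  shows "line_integral F C1 = line_integral F C2"
proof -
  have disj: "range C1 \<inter> P = {}" "range C2 \<inter> P = {}" using sides side_not_range by blast+
  obtain R1 where R1: "R1 > 0" "\<And>S. S \<ge> R1 \<Longrightarrow> C1 piecewise_C1_differentiable_on {-S..S}"
    "\<And>s. \<bar>s\<bar> \<ge> R1 \<Longrightarrow> C1 s = of_real \<beta>1 + \<i> * of_real s" using tail_curveE[OF C1] by metis
  obtain R2 where R2: "R2 > 0" "\<And>S. S \<ge> R2 \<Longrightarrow> C2 piecewise_C1_differentiable_on {-S..S}"
    "\<And>s. \<bar>s\<bar> \<ge> R2 \<Longrightarrow> C2 s = of_real \<beta>2 + \<i> * of_real s" using tail_curveE[OF C2] by metis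
  obtain M1 where M1: "M1 \<ge> \<bar>\<beta>1\<bar>" "\<And>s. \<bar>Re (C1 s)\<bar> \<le> M1" using tail_curve_bounded_Re[OF C1] by metis
  obtain M2 where M2: "M2 \<ge> \<bar>\<beta>2\<bar>" "\<And>s. \<bar>Re (C2 s)\<bar> \<le> M2" using tail_curve_bounded_Re[OF C2] by metis
  define M where "M = max M1 M2"
  define M0 where "M0 = max \<bar>\<beta>1\<bar> \<bar>\<beta>2\<bar>"
  have M0: "\<bar>\<beta>1\<bar> \<le> M0" "\<bar>\<beta>2\<bar> \<le> M0" "M0 \<le> M" "M0 \<ge> 0" using M1(1) M2(1) by (auto simp: M0_def M_def)
  obtain K c T where K: "0 < c" "K \<ge> 0"
    "\<And>x. \<bar>Re x\<bar> \<le> M \<Longrightarrow> \<bar>Im x\<bar> \<ge> T \<Longrightarrow> norm (F x) \<le> K * exp (- c * \<bar>Im x\<bar>)"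
    using strip_decayE[OF d, of M] by metis
  define Q where "Q = {p\<in>P. \<bar>Re p\<bar> \<le> M}"
  have finQ: "finite Q" unfolding Q_def by (rule P)
  obtain H where H: "\<And>p. p \<in> Q \<Longrightarrow> \<bar>Im p\<bar> \<le> H"
    using finite_imp_bounded[OF finQ] bounded_iff abs_Im_le_cmod order_trans by metis
  define t where "t = (\<lambda>S b. of_real b + \<i> * of_real S :: complex)"
  define top where "top = (\<lambda>S. linepath (t S \<beta>1) (t S \<beta>2))"
  define bot where "bot = (\<lambda>S. linepath (t (-S) \<beta>2) (t (-S) \<beta>1))"
  define loop where "loop = (\<lambda>S. trunc C1 S +++ top S +++ reversepath (trunc C2 S) +++ bot S)"
  have wind: "\<exists>S0. \<forall>S\<ge>S0. winding_number (loop S) p = 0" if p: "p \<in> Q" for p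
  proof -
    have "p \<in> P" using p by (auto simp: Q_def)
    then obtain \<sigma> where \<sigma>: "\<sigma> = 1 \<or> \<sigma> = -1" "side \<sigma> C1 p" "side \<sigma> C2 p" using sides by blast
    from winding_number_side[OF \<sigma>(1) C1 \<sigma>(2), of M0] obtain \<rho>1 where "unwound \<sigma> M0 C1 p \<rho>1" by (rule exE)
    note \<rho>1 = this[unfolded unwound_def, rule_format]
    from winding_number_side[OF \<sigma>(1) C2 \<sigma>(3), of M0] obtain \<rho>2 where "unwound \<sigma> M0 C2 p \<rho>2" by (rule exE)
    note \<rho>2 = this[unfolded unwound_def, rule_format]
    define \<rho> where "\<rho> = max \<bar>\<rho>1\<bar> \<bar>\<rho>2\<bar>"
    show ?thesis
    proof (intro exI[of _ "2 * \<bar>\<rho>\<bar> + M0 + R1 + R2 + 1"] allI impI)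
      fix S assume S: "S \<ge> 2 * \<bar>\<rho>\<bar> + M0 + R1 + R2 + 1"
      have S': "S > 0" "S \<ge> R1" "S \<ge> R2" "S > 2 * \<bar>\<rho>\<bar> + M0" "S > \<rho>" "\<rho> \<ge> 0"
        using S R1(1) R2(1) M0(4) by (auto simp: \<rho>_def)
      note t1 = trunc_props[OF R1(2)[OF S'(2)] S'(1)] and t2 = trunc_props[OF R2(2)[OF S'(3)] S'(1)]
      have ends: "C1 S = t S \<beta>1" "C1 (-S) = t (-S) \<beta>1" "C2 S = t S \<beta>2" "C2 (-S) = t (-S) \<beta>2"
        using S' by (simp_all add: R1(3) R2(3) t_def)
      \<comment> \<open>A route from the upper to the lower end of \<open>C2\<close> through a far
        real point on the side away from \<open>p\<close>.\<close>
      define a where "a = linepath (t S \<beta>2) (of_real (- \<sigma> * S)) +++ linepath (of_real (- \<sigma> * S)) (t (-S) \<beta>2)"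
      have a: "path a" "pathstart a = t S \<beta>2" "pathfinish a = t (-S) \<beta>2" by (simp_all add: a_def)
      have far_a: "path_image a \<subseteq> {z. \<rho> < norm z \<and> \<sigma> * Re z \<le> M0}"
      proof
        fix z assume "z \<in> path_image a"
        hence "z \<in> closed_segment (of_real \<beta>2 + \<i> * of_real (1 * S)) (of_real (- \<sigma> * S)) \<or>
            z \<in> closed_segment (of_real \<beta>2 + \<i> * of_real (-1 * S)) (of_real (- \<sigma> * S))"
          unfolding a_def by (subst (asm) path_image_join) (simp_all add: t_def closed_segment_commute)
        thus "z \<in> {z. \<rho> < norm z \<and> \<sigma> * Re z \<le> M0}"
          using closing_segment_far[OF \<sigma>(1) M0(2) S'(4)] by blast
      qed
      have far_h: "z \<in> {z. \<rho> < norm z \<and> \<sigma> * Re z \<le> M0}" if "\<bar>Im z\<bar> = S" "\<bar>Re z\<bar> \<le> M0" for z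
        using that \<sigma>(1) S' abs_Im_le_cmod[of z] by auto
      have far_t: "path_image (top S) \<subseteq> {z. \<rho> < norm z \<and> \<sigma> * Re z \<le> M0}"
        "path_image (bot S) \<subseteq> {z. \<rho> < norm z \<and> \<sigma> * Re z \<le> M0}"
        using horizontal_segment[of _ \<beta>1 S \<beta>2] horizontal_segment[of _ \<beta>2 "-S" \<beta>1] S'(1) far_h
        unfolding top_def bot_def t_def M0_def by (auto simp: max.commute)
      \<comment> \<open>Closing \<open>C1\<close> through the same route \<open>a\<close> makes the
        unknown winding number of \<open>a\<close> cancel in that of the loop.\<close>
      define \<eta> where "\<eta> = top S +++ a +++ bot S"
      have \<eta>: "path \<eta>" "pathstart \<eta> = C1 S" "pathfinish \<eta> = C1 (-S)"
        using a by (simp_all add: \<eta>_def top_def bot_def ends)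
      have im\<eta>: "path_image \<eta> = path_image (top S) \<union> path_image a \<union> path_image (bot S)"
        unfolding \<eta>_def using a by (subst path_image_join, simp_all add: top_def bot_def) (subst path_image_join, simp_all add: Un_assoc)
      have far1: "path_image \<eta> \<subseteq> {z. \<rho>1 < norm z \<and> \<sigma> * Re z \<le> M0}"
        using far_a far_t unfolding im\<eta> \<rho>_def by force
      have far2: "path_image a \<subseteq> {z. \<rho>2 < norm z \<and> \<sigma> * Re z \<le> M0}"
        using far_a unfolding \<rho>_def by force
      have w1: "p \<notin> path_image \<eta>" "winding_number (trunc C1 S) p + winding_number \<eta> p = 0"
        using \<rho>1[OF R1(2)[OF S'(2)] S'(1) \<eta> far1] by blast+
      have w2: "p \<notin> path_image a" "winding_number (trunc C2 S) p + winding_number a p = 0"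
        using \<rho>2[OF R2(2)[OF S'(3)] S'(1) a(1) _ _ far2] a ends by auto
      have pn: "p \<notin> path_image (top S)" "p \<notin> path_image (bot S)" using w1(1) unfolding im\<eta> by auto
      have pC: "p \<notin> path_image (trunc C1 S)" "p \<notin> path_image (trunc C2 S)"
        unfolding t1 t2 using \<open>p \<in> P\<close> disj by auto
      have pt: "path (top S)" "path (bot S)" by (simp_all add: top_def bot_def)
      have ptr: "path (trunc C1 S)" "path (trunc C2 S)" using t1 t2 by (simp_all add: valid_path_imp_path)
      have e\<eta>: "winding_number \<eta> p = winding_number (top S) p + (winding_number a p + winding_number (bot S) p)"
      proof -
        have "winding_number \<eta> p = winding_number (top S) p + winding_number (a +++ bot S) p"
          unfolding \<eta>_def using a pt pn w2(1)
          by (intro winding_number_join) (simp_all add: top_def bot_def not_in_path_image_join)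
        also have "winding_number (a +++ bot S) p = winding_number a p + winding_number (bot S) p"
          using a pt pn w2(1) by (intro winding_number_join) (simp_all add: bot_def)
        finally show ?thesis .
      qed
      have pr: "path (reversepath (trunc C2 S))" "p \<notin> path_image (reversepath (trunc C2 S))"
        using ptr pC by simp_all
      have "winding_number (loop S) p = winding_number (trunc C1 S) p +
          winding_number (top S +++ reversepath (trunc C2 S) +++ bot S) p"
        unfolding loop_def using ptr pt pC pn t1 t2 pr
        by (intro winding_number_join) (simp_all add: top_def bot_def ends not_in_path_image_join)
      also have "winding_number (top S +++ reversepath (trunc C2 S) +++ bot S) p =
          winding_number (top S) p + winding_number (reversepath (trunc C2 S) +++ bot S) p"
        using ptr pt pC pn t1 t2 pr
        by (intro winding_number_join) (simp_all add: top_def bot_def ends not_in_path_image_join)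
      also have "winding_number (reversepath (trunc C2 S) +++ bot S) p =
          winding_number (reversepath (trunc C2 S)) p + winding_number (bot S) p"
        using ptr pt pC pn t1 t2 pr
        by (intro winding_number_join) (simp_all add: top_def bot_def ends)
      also have "winding_number (reversepath (trunc C2 S)) p = - winding_number (trunc C2 S) p"
        using ptr pC by (intro winding_number_reversepath)
      finally show "winding_number (loop S) p = 0" using w1(2) w2(2) e\<eta> by algebra
    qed
  qed
  have "\<forall>p\<in>Q. \<forall>\<^sub>F S in at_top. winding_number (loop S) p = 0"
    using wind unfolding eventually_at_top_linorder by blast
  \<comment> \<open>The height required depends on the pole, but only finitely many poles lie in the
    strip.\<close>
  hence windQ: "\<forall>\<^sub>F S in at_top. \<forall>p\<in>Q. winding_number (loop S) p = 0"
    by (rule eventually_ball_finite[OF finQ])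
  define I where "I = (\<lambda>S. contour_integral (trunc C1 S) F - contour_integral (trunc C2 S) F)"
  have bound: "\<forall>\<^sub>F S in at_top. norm (I S) \<le> 2 * (K * exp (- c * S)) * \<bar>\<beta>2 - \<beta>1\<bar>"
    using windQ eventually_ge_at_top[of "R1 + R2 + \<bar>T\<bar> + \<bar>H\<bar> + 1"]
  proof eventually_elim
    case (elim S)
    have S: "S > 0" "S \<ge> R1" "S \<ge> R2" "S \<ge> T" "S > H" using elim(2) R1(1) R2(1) by linarith+
    note t1 = trunc_props[OF R1(2)[OF S(2)] S(1)] and t2 = trunc_props[OF R2(2)[OF S(3)] S(1)]
    have ends: "C1 S = t S \<beta>1" "C1 (-S) = t (-S) \<beta>1" "C2 S = t S \<beta>2" "C2 (-S) = t (-S) \<beta>2"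
      using S by (simp_all add: R1(3) R2(3) t_def)
    have seg: "\<bar>Im z\<bar> = S \<and> \<bar>Re z\<bar> \<le> M" if "z \<in> path_image (top S) \<union> path_image (bot S)" for z
      using that horizontal_segment[of z \<beta>1 S \<beta>2] horizontal_segment[of z \<beta>2 "-S" \<beta>1] S(1) M0(3)
      unfolding top_def bot_def t_def M0_def by auto
    have segP: "path_image (top S) \<subseteq> - P" "path_image (bot S) \<subseteq> - P"
      using seg H S(5) unfolding Q_def by fastforce+
    have trP: "path_image (trunc C1 S) \<subseteq> - P" "path_image (trunc C2 S) \<subseteq> - P"
      unfolding t1 t2 using disj by auto
    have oP: "open (- P)" using P(1) by auto
    have v: "valid_path (top S)" "valid_path (bot S)" by (simp_all add: top_def bot_def)
    have vr: "valid_path (reversepath (trunc C2 S))" using t2 by simp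
    have prS: "path_image (reversepath (trunc C2 S)) \<subseteq> - P" using trP by simp
    have vl: "valid_path (reversepath (trunc C2 S) +++ bot S)"
      "valid_path (top S +++ reversepath (trunc C2 S) +++ bot S)" "valid_path (loop S)"
      using v vr t1 t2 by (simp_all add: loop_def top_def bot_def ends valid_path_join)
    have iml: "path_image (reversepath (trunc C2 S) +++ bot S) \<subseteq> - P"
      "path_image (top S +++ reversepath (trunc C2 S) +++ bot S) \<subseteq> - P" "path_image (loop S) \<subseteq> - P"
      unfolding loop_def using segP trP by (intro subset_path_image_join; simp)+
    have "(F has_contour_integral 0) (loop S)"
    proof (rule Cauchy_theorem_global[OF oP F vl(3) _ iml(3)])
      show "pathfinish (loop S) = pathstart (loop S)"
        by (simp add: loop_def t1 bot_def ends)
      fix w assume "w \<notin> - P"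
      show "winding_number (loop S) w = 0"
      proof (cases "w \<in> Q")
        case True
        thus ?thesis using elim(1) by blast
      next
        case False
        \<comment> \<open>The loop stays in the convex strip, so it cannot wind around a pole
          outside of it.\<close>
        show ?thesis
        proof (rule winding_number_zero_outside)
          show "path (loop S)" using vl(3) by (rule valid_path_imp_path)
          have "{z. \<bar>Re z\<bar> \<le> M} = {z. Re z \<le> M} \<inter> {z. Re z \<ge> -M}" by auto
          thus "convex {z. \<bar>Re z\<bar> \<le> M}"
            by (simp add: convex_Int convex_halfspace_Re_le convex_halfspace_Re_ge)
          show "pathfinish (loop S) = pathstart (loop S)"
            by (simp add: loop_def t1 bot_def ends)
          show "w \<notin> {z. \<bar>Re z\<bar> \<le> M}" using False \<open>w \<notin> - P\<close> by (auto simp: Q_def)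
          have "path_image (trunc C1 S) \<subseteq> {z. \<bar>Re z\<bar> \<le> M}" "path_image (trunc C2 S) \<subseteq> {z. \<bar>Re z\<bar> \<le> M}"
            unfolding t1 t2 M_def using M1(2) M2(2) by (auto simp: le_max_iff_disj)
          thus "path_image (loop S) \<subseteq> {z. \<bar>Re z\<bar> \<le> M}"
            unfolding loop_def using seg by (intro subset_path_image_join) auto
        qed
      qed
    qed
    hence "0 = contour_integral (loop S) F" by (simp add: contour_integral_unique)
    also have "\<dots> = contour_integral (trunc C1 S) F + (contour_integral (top S) F +
        (contour_integral (reversepath (trunc C2 S)) F + contour_integral (bot S) F))"
      unfolding loop_def
      by (subst contour_integral_join, (intro contour_integrable_holomorphic_simple[OF F oP] v vr vl t1 segP trP prS iml)+)+ simp
    also have "contour_integral (reversepath (trunc C2 S)) F = - contour_integral (trunc C2 S) F"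
      using t2 by (intro contour_integral_reversepath)
    finally have "I S = - (contour_integral (top S) F + contour_integral (bot S) F)"
      unfolding I_def by (simp add: algebra_simps add_eq_0_iff)
    hence "norm (I S) \<le> norm (contour_integral (top S) F) + norm (contour_integral (bot S) F)"
      by (simp only: norm_minus_cancel norm_triangle_ineq)
    also have "norm (contour_integral (top S) F) \<le> (K * exp (- c * S)) * norm (t S \<beta>2 - t S \<beta>1)"
      unfolding top_def
    proof (rule contour_integral_bound_linepath)
      show "F contour_integrable_on linepath (t S \<beta>1) (t S \<beta>2)"
        using contour_integrable_holomorphic_simple[OF F oP v(1) segP(1)] by (simp add: top_def)
      show "0 \<le> K * exp (- c * S)" using K(2) by simp
      fix x assume "x \<in> closed_segment (t S \<beta>1) (t S \<beta>2)"
      hence "\<bar>Im x\<bar> = S" "\<bar>Re x\<bar> \<le> M" using seg[of x] by (auto simp: top_def)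
      thus "norm (F x) \<le> K * exp (- c * S)" using K(3)[of x] S(4) by simp
    qed
    also have "norm (contour_integral (bot S) F) \<le> (K * exp (- c * S)) * norm (t (-S) \<beta>1 - t (-S) \<beta>2)"
      unfolding bot_def
    proof (rule contour_integral_bound_linepath)
      show "F contour_integrable_on linepath (t (-S) \<beta>2) (t (-S) \<beta>1)"
        using contour_integrable_holomorphic_simple[OF F oP v(2) segP(2)] by (simp add: bot_def)
      show "0 \<le> K * exp (- c * S)" using K(2) by simp
      fix x assume "x \<in> closed_segment (t (-S) \<beta>2) (t (-S) \<beta>1)"
      hence "\<bar>Im x\<bar> = S" "\<bar>Re x\<bar> \<le> M" using seg[of x] by (auto simp: bot_def)
      thus "norm (F x) \<le> K * exp (- c * S)" using K(3)[of x] S(4) by simp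
    qed
    also have "norm (t S \<beta>2 - t S \<beta>1) = \<bar>\<beta>2 - \<beta>1\<bar>"
      by (simp add: t_def flip: of_real_diff)
    also have "norm (t (-S) \<beta>1 - t (-S) \<beta>2) = \<bar>\<beta>2 - \<beta>1\<bar>"
      by (simp add: t_def abs_minus_commute flip: of_real_diff)
    finally show "norm (I S) \<le> 2 * (K * exp (- c * S)) * \<bar>\<beta>2 - \<beta>1\<bar>" by (simp add: mult_ac)
  qed
  have "((\<lambda>S. exp (- c * S)) \<longlongrightarrow> 0) at_top"
    using K(1) by real_asymp
  hence "((\<lambda>S. 2 * (K * exp (- c * S)) * \<bar>\<beta>2 - \<beta>1\<bar>) \<longlongrightarrow> 2 * (K * 0) * \<bar>\<beta>2 - \<beta>1\<bar>) at_top"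
    by (intro tendsto_intros)
  hence "((\<lambda>S. 2 * (K * exp (- c * S)) * \<bar>\<beta>2 - \<beta>1\<bar>) \<longlongrightarrow> 0) at_top" by simp
  with bound have "(I \<longlongrightarrow> 0) at_top" by (rule Lim_null_comparison)
  hence "(\<lambda>k. I (real k)) \<longlonglongrightarrow> 0"
    by (rule filterlim_compose[OF _ filterlim_real_sequentially])
  moreover have "(\<lambda>k. I (real k)) \<longlonglongrightarrow> line_integral F C1 - line_integral F C2"
    unfolding I_def by (intro tendsto_diff line_integral_limit(2)[OF C1 P(1) disj(1) F d]
      line_integral_limit(2)[OF C2 P(1) disj(2) F d])
  ultimately have "line_integral F C1 - line_integral F C2 = 0" using LIMSEQ_unique by blast
  thus ?thesis by simp
qed

section \<open>Decay of the Gamma function in vertical strips\<close>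

text \<open>All factors have modulus at least 1, so by the functional equation a shift of the
  argument to the right does not decrease the modulus of Gamma.\<close>

lemma norm_pochhammer_ge_one:
  fixes z :: complex
  assumes "\<bar>Im z\<bar> \<ge> 1" shows "norm (pochhammer z m) \<ge> 1"
proof -
  have "1 \<le> (\<Prod>k<m. norm (z + of_nat k))"
  proof (rule prod_ge_1)
    fix k show "1 \<le> norm (z + of_nat k)"
      using abs_Im_le_cmod[of "z + of_nat k"] assms by simp
  qed
  thus ?thesis by (simp only: pochhammer_prod atLeast0LessThan prod_norm)
qed

text \<open>Gauss's product formula reduces this to the monotonicity of (x + k) / |x + k + iy| in x.\<close>

lemma norm_Gamma_over_Gamma_mono:
  assumes "0 < x" "x \<le> (x' :: real)"
  shows "norm (Gamma (Complex x y)) / Gamma x \<le> norm (Gamma (Complex x' y)) / Gamma x'"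
proof -
  have lim: "(\<lambda>n. norm (Gamma_series (Complex x y) n) / Gamma_series x n) \<longlonglongrightarrow> norm (Gamma (Complex x y)) / Gamma x"
    if "x > 0" for x
    using Gamma_real_pos[OF that] by (intro tendsto_intros Gamma_series_LIMSEQ) auto
  have eq: "norm (Gamma_series (Complex x y) n) / Gamma_series x n = (\<Prod>k<n+1. (x + real k) / norm (Complex x y + of_nat k))"
    if "x > 0" for x n
  proof -
    have p: "pochhammer x (n+1) = (\<Prod>k<n+1. x + real k)"
      "norm (pochhammer (Complex x y) (n+1)) = (\<Prod>k<n+1. norm (Complex x y + of_nat k))"
      by (simp_all only: pochhammer_prod atLeast0LessThan prod_norm)
    have "norm (exp (Complex x y * of_real (ln (real n)))) = exp (x * ln (real n))" by simp
    hence "norm (Gamma_series (Complex x y) n) / Gamma_series x n =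
        pochhammer x (n+1) / norm (pochhammer (Complex x y) (n+1))"
      unfolding Gamma_series_def by (simp only: norm_divide norm_mult norm_fact of_real_of_nat_eq) simp
    thus ?thesis unfolding p by (simp only: prod_dividef)
  qed
  have le: "(x + real k) / norm (Complex x y + of_nat k) \<le> (x' + real k) / norm (Complex x' y + of_nat k)" for k
  proof -
    define a b where "a = x + real k" and "b = x' + real k"
    have ab: "0 < a" "a \<le> b" using assms by (auto simp: a_def b_def)
    have n: "norm (Complex x y + of_nat k) = sqrt (a\<^sup>2 + y\<^sup>2)" "norm (Complex x' y + of_nat k) = sqrt (b\<^sup>2 + y\<^sup>2)"
      by (simp_all add: cmod_def a_def b_def)
    have "a\<^sup>2 * (b\<^sup>2 + y\<^sup>2) \<le> b\<^sup>2 * (a\<^sup>2 + y\<^sup>2)"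
      using ab power_mono[of a b 2] by (simp add: algebra_simps mult_right_mono)
    hence "sqrt (a\<^sup>2 * (b\<^sup>2 + y\<^sup>2)) \<le> sqrt (b\<^sup>2 * (a\<^sup>2 + y\<^sup>2))" by simp
    hence "a * sqrt (b\<^sup>2 + y\<^sup>2) \<le> b * sqrt (a\<^sup>2 + y\<^sup>2)" using ab by (simp add: real_sqrt_mult)
    moreover have "sqrt (b\<^sup>2 + y\<^sup>2) > 0" "sqrt (a\<^sup>2 + y\<^sup>2) > 0"
      using ab by (simp_all add: add_pos_nonneg)
    ultimately show ?thesis unfolding n a_def[symmetric] b_def[symmetric] by (simp add: field_simps)
  qed
  have x': "x' > 0" using assms by simp
  show ?thesis
  proof (rule LIMSEQ_le[OF lim[OF assms(1)] lim[OF x']], intro exI allI impI)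
    fix n
    show "norm (Gamma_series (Complex x y) n) / Gamma_series x n \<le> norm (Gamma_series (Complex x' y) n) / Gamma_series x' n"
      unfolding eq[OF assms(1)] eq[OF x'] using assms by (intro prod_mono conjI le divide_nonneg_nonneg) auto
  qed
qed

text \<open>The squared modulus is
  \<open>(exp (2 * y) + exp (- 2 * y) - 2 * cos (2 * x)) / 4\<close> at x + iy. As
  \<open>exp (2 * v) \<ge> 4\<close>, subtracting 2 leaves at least a quarter of
  \<open>exp (2 * v)\<close>.\<close>

lemma norm_sin_lower:
  assumes "\<bar>Im z\<bar> \<ge> 1" shows "norm (sin z) \<ge> exp \<bar>Im z\<bar> / 4"
proof -
  define v where "v = \<bar>Im z\<bar>"
  have e: "exp v \<ge> 2" using assms exp_ge_add_one_self[of v] unfolding v_def by linarith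
  have "exp (2 * v) = (exp v)\<^sup>2" by (simp add: power2_eq_square flip: exp_add)
  moreover have "(exp v)\<^sup>2 \<ge> 2\<^sup>2" using e by (intro power_mono) auto
  ultimately have e2: "exp (2 * v) \<ge> 4" by simp
  have "exp (2 * v) \<le> exp (2 * Im z) + inverse (exp (2 * Im z))"
    by (cases "Im z \<ge> 0") (auto simp: v_def exp_minus[symmetric])
  moreover have "cos (2 * Re z) \<le> 1" by simp
  ultimately have "(norm (sin z))\<^sup>2 \<ge> (exp (2 * v) - 2) / 4"
    unfolding norm_sin_squared by (intro divide_right_mono) linarith+
  also have "(exp (2 * v) - 2) / 4 \<ge> (exp v / 4)\<^sup>2"
    using e2 by (simp add: power_divide power2_eq_square flip: exp_add)
  finally show ?thesis unfolding v_def[symmetric] by (rule power2_le_imp_le) simp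
qed

text \<open>On this line \<open>cnj z = 2 - z\<close>, so the reflection formula gives the exact
  value \<open>pi * y / sinh (pi * y)\<close>; the bound replaces the sine by its lower
  estimate.\<close>

lemma norm_Gamma_one_sq:
  assumes "\<bar>y\<bar> \<ge> 1" shows "(norm (Gamma (Complex 1 y)))\<^sup>2 \<le> 4 * pi * \<bar>y\<bar> * exp (- pi * \<bar>y\<bar>)"
proof -
  define z where "z = Complex 1 y"
  have ne: "1 - z \<notin> \<int>\<^sub>\<le>\<^sub>0"
  proof
    assume "1 - z \<in> \<int>\<^sub>\<le>\<^sub>0"
    then obtain n where "1 - z = - of_nat n" by (elim nonpos_Ints_cases')
    hence "Im (1 - z) = 0" by simp
    thus False using assms by (simp add: z_def)
  qed
  have c: "cnj z = (1 - z) + 1" by (simp add: z_def complex_eq_iff)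
  have "(norm (Gamma z))\<^sup>2 = norm (Gamma z * Gamma (cnj z))"
    by (simp add: norm_mult power2_eq_square flip: cnj_Gamma)
  also have "Gamma z * Gamma (cnj z) = (1 - z) * (Gamma z * Gamma (1 - z))"
    unfolding c by (subst Gamma_plus1[OF ne]) simp
  also have "Gamma z * Gamma (1 - z) = of_real pi / sin (of_real pi * z)" by (rule Gamma_reflection_complex)
  also have "norm ((1 - z) * (of_real pi / sin (of_real pi * z))) = \<bar>y\<bar> * (pi / norm (sin (of_real pi * z)))"
  proof -
    have "norm (1 - z) = \<bar>y\<bar>" by (simp add: z_def cmod_def)
    thus ?thesis by (simp only: norm_mult norm_divide norm_of_real) simp
  qed
  also have "\<dots> \<le> \<bar>y\<bar> * (pi / (exp (pi * \<bar>y\<bar>) / 4))"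
  proof (intro mult_left_mono divide_left_mono)
    have "1 * 1 \<le> pi * \<bar>y\<bar>" using assms pi_gt3 by (intro mult_mono) auto
    thus le: "exp (pi * \<bar>y\<bar>) / 4 \<le> norm (sin (of_real pi * z))"
      using norm_sin_lower[of "of_real pi * z"] by (simp add: z_def abs_mult)
    show "0 < norm (sin (of_real pi * z)) * (exp (pi * \<bar>y\<bar>) / 4)"
      using le by (intro mult_pos_pos) (auto intro: less_le_trans[rotated])
  qed auto
  finally show ?thesis by (simp add: z_def exp_minus field_simps)
qed

text \<open>A shift moves the strip to real parts at least 1, monotonicity moves it to the single
  line of real part \<open>N\<close>, and there Gamma is a Pochhammer product times Gamma on the
  line of real part 1. The gap between the rate 1 and the true rate pi / 2 absorbs the polynomial
  factor.\<close>

lemma Gamma_strip_bound: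
  "\<exists>K T. \<forall>z. \<bar>Re z\<bar> \<le> M \<longrightarrow> \<bar>Im z\<bar> \<ge> T \<longrightarrow> norm (Gamma z :: complex) \<le> K * exp (- \<bar>Im z\<bar>)"
proof -
  \<comment> \<open>With this \<open>m\<close> the number \<open>Re z + m\<close> is at least 1 on
    the strip, and it is at most \<open>N = 2 * m\<close>.\<close>
  define m where "m = Suc (nat \<lceil>M\<rceil>)"
  define N where "N = 2 * m"
  have m: "real m \<ge> M + 1" "m \<ge> 1" "N \<ge> 2" unfolding m_def N_def by (linarith, simp_all)
  have "compact (Gamma ` {1..real N} :: real set)"
    by (intro compact_continuous_image continuous_on_Gamma) (auto elim!: nonpos_Ints_cases')
  then obtain G where G: "\<And>x. x \<in> {1..real N} \<Longrightarrow> \<bar>Gamma x :: real\<bar> \<le> G"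
    using compact_imp_bounded bounded_iff by (metis image_eqI real_norm_def)
  \<comment> \<open>The squared estimate to come, divided by the squared target
    \<open>exp (- 2 * y)\<close>; it tends to 0 because \<open>pi > 2\<close>.\<close>
  have "((\<lambda>y. (real N + y) ^ (2 * N) * (4 * pi * y * exp (- pi * y)) * exp (2 * y)) \<longlongrightarrow> 0) at_top"
  proof -
    have "((\<lambda>y. (real N + y) powr (2 * real N) * (4 * pi * y * exp (- pi * y)) * exp (2 * y)) \<longlongrightarrow> 0) at_top"
      using pi_gt3 by real_asymp
    moreover have "\<forall>\<^sub>F y in at_top. (real N + y) powr (2 * real N) * (4 * pi * y * exp (- pi * y)) * exp (2 * y) =
        (real N + y) ^ (2 * N) * (4 * pi * y * exp (- pi * y)) * exp (2 * y)"
      using eventually_gt_at_top[of 0]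
    proof eventually_elim
      case (elim y)
      thus ?case using powr_realpow[of "real N + y" "2 * N"] m(3) by simp
    qed
    ultimately show ?thesis by (rule Lim_transform_eventually)
  qed
  hence "\<forall>\<^sub>F y in at_top. (real N + y) ^ (2 * N) * (4 * pi * y * exp (- pi * y)) * exp (2 * y) < 1"
    by (rule order_tendstoD) simp
  then obtain T where T: "\<And>y. y \<ge> T \<Longrightarrow> (real N + y) ^ (2 * N) * (4 * pi * y * exp (- pi * y)) * exp (2 * y) < 1"
    by (auto simp: eventually_at_top_linorder)
  show ?thesis
  proof (rule exI[of _ "G / Gamma (real N)"], rule exI[of _ "max T 1"], intro allI impI)
    fix z :: complex assume z: "\<bar>Re z\<bar> \<le> M" "\<bar>Im z\<bar> \<ge> max T 1"
    define y where "y = Im z"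
    define x where "x = Re z + real m"
    have y: "\<bar>y\<bar> \<ge> 1" "\<bar>y\<bar> \<ge> T" using z by (auto simp: y_def)
    have x: "1 \<le> x" "x \<le> real N" using z m by (auto simp: x_def N_def)
    have zN: "z + of_nat m = Complex x y" by (simp add: x_def y_def complex_eq_iff)
    have "z \<notin> \<int>\<^sub>\<le>\<^sub>0" using y by (auto simp: y_def elim!: nonpos_Ints_cases')
    hence "norm (pochhammer z m) * norm (Gamma z) = norm (Gamma (Complex x y))"
      using pochhammer_Gamma[of z m] by (simp add: zN norm_divide Gamma_eq_zero_iff)
    moreover have "1 * norm (Gamma z) \<le> norm (pochhammer z m) * norm (Gamma z)"
      using norm_pochhammer_ge_one[of z m] y by (intro mult_right_mono) (auto simp: y_def)
    ultimately have 1: "norm (Gamma z) \<le> norm (Gamma (Complex x y))" by simp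
    have Gx: "Gamma x > 0" using x by (intro Gamma_real_pos) simp
    have GN: "Gamma (real N) > 0" using m by (intro Gamma_real_pos) simp
    have "norm (Gamma (Complex x y)) / Gamma x \<le> norm (Gamma (Complex (real N) y)) / Gamma (real N)"
      using x by (intro norm_Gamma_over_Gamma_mono) auto
    hence "norm (Gamma (Complex x y)) \<le> Gamma x * (norm (Gamma (Complex (real N) y)) / Gamma (real N))"
      using Gx by (simp add: field_simps)
    also have "\<dots> \<le> G * (norm (Gamma (Complex (real N) y)) / Gamma (real N))"
      using G[of x] x GN by (intro mult_right_mono) auto
    finally have 2: "norm (Gamma (Complex x y)) \<le> G / Gamma (real N) * norm (Gamma (Complex (real N) y))" by simp
    have notin: "Complex 1 y \<notin> \<int>\<^sub>\<le>\<^sub>0"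
    proof
      assume "Complex 1 y \<in> \<int>\<^sub>\<le>\<^sub>0"
      then obtain n where "Complex 1 y = - of_nat n" by (elim nonpos_Ints_cases')
      hence "Im (Complex 1 y) = Im (- of_nat n)" by (rule arg_cong)
      thus False using y by simp
    qed
    have "Gamma (Complex (real N) y) = pochhammer (Complex 1 y) (N - 1) * Gamma (Complex 1 y)"
    proof -
      have "Complex 1 y + of_nat (N - 1) = Complex (real N) y" using m by (simp add: complex_eq_iff of_nat_diff)
      thus ?thesis using pochhammer_Gamma[of "Complex 1 y" "N - 1", OF notin] notin
        by (metis Gamma_eq_zero_iff nonzero_eq_divide_eq)
    qed
    hence "(norm (Gamma (Complex (real N) y)))\<^sup>2 = (norm (pochhammer (Complex 1 y) (N - 1)))\<^sup>2 * (norm (Gamma (Complex 1 y)))\<^sup>2"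
      by (simp add: norm_mult power_mult_distrib)
    also have "\<dots> \<le> (real N + \<bar>y\<bar>) ^ (2 * N) * (4 * pi * \<bar>y\<bar> * exp (- pi * \<bar>y\<bar>))"
    proof (intro mult_mono norm_Gamma_one_sq y)
      have "norm (pochhammer (Complex 1 y) (N - 1)) = (\<Prod>k<N-1. norm (Complex 1 y + of_nat k))"
        by (simp only: pochhammer_prod atLeast0LessThan prod_norm)
      also have "\<dots> \<le> (\<Prod>k<N-1. real N + \<bar>y\<bar>)"
      proof (intro prod_mono conjI)
        fix k assume k: "k \<in> {..<N-1}"
        have "norm (Complex 1 y + of_nat k) \<le> \<bar>Re (Complex 1 y + of_nat k)\<bar> + \<bar>Im (Complex 1 y + of_nat k)\<bar>"
          by (rule cmod_le)
        also have "\<dots> \<le> real N + \<bar>y\<bar>" using k by simp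
        finally show "norm (Complex 1 y + of_nat k) \<le> real N + \<bar>y\<bar>" .
      qed simp
      also have "\<dots> = (real N + \<bar>y\<bar>) ^ (N - 1)" by simp
      also have "\<dots> \<le> (real N + \<bar>y\<bar>) ^ N" using y by (intro power_increasing) auto
      finally have "(norm (pochhammer (Complex 1 y) (N - 1)))\<^sup>2 \<le> ((real N + \<bar>y\<bar>) ^ N)\<^sup>2"
        by (intro power_mono) auto
      thus "(norm (pochhammer (Complex 1 y) (N - 1)))\<^sup>2 \<le> (real N + \<bar>y\<bar>) ^ (2 * N)"
        by (simp add: power_mult[symmetric] mult.commute)
    qed auto
    also have "\<dots> \<le> exp (- 2 * \<bar>y\<bar>)" using T[OF y(2)] by (simp add: exp_minus field_simps)
    also have "\<dots> = (exp (- \<bar>y\<bar>))\<^sup>2" by (simp add: power2_eq_square flip: exp_add)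
    finally have "norm (Gamma (Complex (real N) y)) \<le> exp (- \<bar>y\<bar>)" by (rule power2_le_imp_le) simp
    hence "G / Gamma (real N) * norm (Gamma (Complex (real N) y)) \<le> G / Gamma (real N) * exp (- \<bar>y\<bar>)"
      using GN order.trans[OF abs_ge_zero G[of x]] x by (intro mult_left_mono divide_nonneg_nonneg) auto
    thus "norm (Gamma z) \<le> G / Gamma (real N) * exp (- \<bar>Im z\<bar>)" using 1 2 unfolding y_def by linarith
  qed
qed

section \<open>Reflected contours\<close>

lemma has_integral_reflect_UNIV:
  fixes f :: "real \<Rightarrow> complex"
  assumes "(f has_integral I) UNIV" shows "((\<lambda>x. f (- x)) has_integral I) UNIV"
proof -
  have A: "\<And>a b. f integrable_on {a..b}"
    "\<And>e. e > 0 \<Longrightarrow> \<exists>B>0. \<forall>a b. ball 0 B \<subseteq> {a..b} \<longrightarrow> norm (integral {a..b} f - I) < e"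
    using assms[unfolded has_integral_alt'[of f I UNIV]] by simp_all
  have r: "((\<lambda>x. f (- x)) has_integral integral {-b..-a} f) {a..b}" for a b
    using has_integral_reflect_lemma_real[OF integrable_integral[OF A(1)[of "-b" "-a"]]] by simp
  show ?thesis unfolding has_integral_alt'[of _ I UNIV]
  proof (intro conjI allI impI)
    fix a b :: real
    show "(\<lambda>x. if x \<in> UNIV then f (- x) else 0) integrable_on cbox a b"
      using r[of b a] by auto
  next
    fix e :: real assume "e > 0"
    then obtain B where B: "B > 0" "\<And>a b. ball 0 B \<subseteq> {a..b} \<Longrightarrow> norm (integral {a..b} f - I) < e"
      using A(2) by blast
    show "\<exists>B>0. \<forall>a b. ball 0 B \<subseteq> cbox a b \<longrightarrow>
        norm (integral (cbox a b) (\<lambda>x. if x \<in> UNIV then f (- x) else 0) - I) < e"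
    proof (intro exI[of _ B] conjI allI impI)
      fix a b :: real assume ab: "ball 0 B \<subseteq> cbox a b"
      have "ball 0 B \<subseteq> {-b..-a}"
      proof
        fix x :: real assume "x \<in> ball 0 B"
        hence "- x \<in> cbox a b" using ab by (intro subsetD[OF ab]) simp
        thus "x \<in> {-b..-a}" by auto
      qed
      from B(2)[OF this] show "norm (integral (cbox a b) (\<lambda>x. if x \<in> UNIV then f (- x) else 0) - I) < e"
        using integral_unique[OF r[of b a]] by simp
    qed (fact B(1))
  qed
qed

text \<open>The equation holds even where no derivative exists: both sides are choices from
  predicates that coincide.\<close>

lemma vector_derivative_reflect:
  "vector_derivative (\<lambda>s. \<kappa> - C (- s)) (at s) = vector_derivative C (at (- s :: real))"
proof -
  have 1: "((\<lambda>s. k - D (- s)) has_vector_derivative d) (at s)" if "(D has_vector_derivative d) (at (-s))"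
    for D :: "real \<Rightarrow> 'a" and k d s
  proof -
    have "(uminus has_vector_derivative (-1)) (at s)" by (auto intro!: derivative_eq_intros)
    from vector_diff_chain_at[OF this that] have "((\<lambda>s. D (- s)) has_vector_derivative - d) (at s)"
      by (simp add: o_def)
    thus ?thesis by (auto intro!: derivative_eq_intros)
  qed
  have "((\<lambda>s. \<kappa> - C (- s)) has_vector_derivative d) (at s) \<longleftrightarrow> (C has_vector_derivative d) (at (- s))" for d
    using 1[of "\<lambda>s. \<kappa> - C (- s)" d "-s" \<kappa>] 1[of C d s \<kappa>] by auto
  thus ?thesis by (simp add: vector_derivative_def)
qed

text \<open>Values and parameter are reflected together, so the image curve again runs upward and
  the integral keeps its sign.\<close>

lemma line_integral_reflect:
  assumes "(\<lambda>s. F (\<kappa> - C s) * vector_derivative C (at s)) integrable_on UNIV"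
  shows "line_integral F (\<lambda>s. \<kappa> - C (- s)) = line_integral (\<lambda>x. F (\<kappa> - x)) C"
  using has_integral_reflect_UNIV[OF integrable_integral[OF assms]]
  by (simp add: line_integral_def vector_derivative_reflect integral_unique)

lemma tail_curve_reflect:
  assumes "tail_curve \<beta> C" shows "tail_curve (\<kappa> - \<beta>) (\<lambda>s. of_real \<kappa> - C (- s))"
proof -
  obtain R where R: "R > 0" "\<And>S. S \<ge> R \<Longrightarrow> C piecewise_C1_differentiable_on {-S..S}"
    "\<And>s. \<bar>s\<bar> \<ge> R \<Longrightarrow> C s = of_real \<beta> + \<i> * of_real s" using tail_curveE[OF assms] by metis
  have "(\<lambda>x. (-1) * x + 0) ` {-R..R} = {-R..R}" by simp
  hence "(C \<circ> (\<lambda>x. (-1) *\<^sub>R x + 0)) piecewise_C1_differentiable_on {-R..R}"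
    using R(2)[of R] by (intro piecewise_C1_differentiable_affine) simp
  hence "(\<lambda>s. C (- s)) piecewise_C1_differentiable_on {-R..R}" by (simp add: o_def)
  moreover have "(\<lambda>s. of_real \<kappa> :: complex) piecewise_C1_differentiable_on {-R..R}"
    by (intro C1_differentiable_imp_piecewise) simp
  ultimately have "(\<lambda>s. of_real \<kappa> - C (- s)) piecewise_C1_differentiable_on {-R..R}"
    by (rule piecewise_C1_differentiable_diff[rotated])
  thus ?thesis unfolding tail_curve_def using R(3) by (intro exI[of _ R]) auto
qed

lemma side_reflect:
  assumes "side \<sigma> C (of_real \<kappa> - p)" "\<sigma> = 1 \<or> \<sigma> = -1"
  shows "side (- \<sigma>) (\<lambda>s. of_real \<kappa> - C (- s)) p"
proof -
  obtain B where B: "\<And>r. r \<ge> B \<Longrightarrow> connected_component (- range C) (of_real \<kappa> - p) (of_real (\<sigma> * r))"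
    using assms by (auto simp: side_def)
  \<comment> \<open>Since \<sigma> squares to 1, the reflection sends the real point
    \<open>\<sigma> * (r + \<sigma> * \<kappa>)\<close> to \<open>- \<sigma> * r\<close>, which
    explains the shifted threshold.\<close>
  show ?thesis unfolding side_def
  proof (intro exI[of _ "B - \<sigma> * \<kappa>"] allI impI)
    fix r assume "r \<ge> B - \<sigma> * \<kappa>"
    hence "connected_component (- range C) (of_real \<kappa> - p) (of_real (\<sigma> * (r + \<sigma> * \<kappa>)))"
      by (intro B) simp
    then obtain T where T: "connected T" "T \<subseteq> - range C" "of_real \<kappa> - p \<in> T" "of_real (\<sigma> * (r + \<sigma> * \<kappa>)) \<in> T"
      by (auto simp: connected_component_def)
    have "connected ((\<lambda>x. of_real \<kappa> - x) ` T)"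
      by (intro connected_continuous_image continuous_intros T)
    moreover have "(\<lambda>x. of_real \<kappa> - x) ` T \<subseteq> - range (\<lambda>s. of_real \<kappa> - C (- s))" using T(2) by auto
    moreover have "p \<in> (\<lambda>x. of_real \<kappa> - x) ` T" using T(3) by (intro image_eqI[of _ _ "of_real \<kappa> - p"]) auto
    moreover have "of_real (- \<sigma> * r) \<in> (\<lambda>x. of_real \<kappa> - x) ` T"
      using T(4) assms(2) by (intro image_eqI[OF _ T(4)]) auto
    ultimately show "connected_component (- range (\<lambda>s. of_real \<kappa> - C (- s))) p (of_real (- \<sigma> * r))"
      by (auto simp: connected_component_def)
  qed
qed

section \<open>Exponential decay rates in vertical strips\<close>

lemma decay_rate_mult:
  assumes "decay_rate r F" "decay_rate s G"
  shows "decay_rate (r + s) (\<lambda>x. F x * G x)"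
  unfolding decay_rate_def
proof
  fix M
  obtain K T where K: "K \<ge> 0" "\<And>x. \<bar>Re x\<bar> \<le> M \<Longrightarrow> \<bar>Im x\<bar> \<ge> T \<Longrightarrow> norm (F x) \<le> K * exp (- r * \<bar>Im x\<bar>)"
    using decay_rateE[OF assms(1), of M] by metis
  obtain L U where L: "L \<ge> 0" "\<And>x. \<bar>Re x\<bar> \<le> M \<Longrightarrow> \<bar>Im x\<bar> \<ge> U \<Longrightarrow> norm (G x) \<le> L * exp (- s * \<bar>Im x\<bar>)"
    using decay_rateE[OF assms(2), of M] by metis
  show "\<exists>K T. \<forall>x. \<bar>Re x\<bar> \<le> M \<longrightarrow> \<bar>Im x\<bar> \<ge> T \<longrightarrow> norm (F x * G x) \<le> K * exp (- (r + s) * \<bar>Im x\<bar>)"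
  proof (rule exI[of _ "K * L"], rule exI[of _ "max T U"], intro allI impI)
    fix x :: complex assume x: "\<bar>Re x\<bar> \<le> M" "\<bar>Im x\<bar> \<ge> max T U"
    have "norm (F x * G x) \<le> (K * exp (- r * \<bar>Im x\<bar>)) * (L * exp (- s * \<bar>Im x\<bar>))"
      unfolding norm_mult using x K L by (intro mult_mono K(2) L(2)) auto
    also have "\<dots> = (K * L) * exp (- (r + s) * \<bar>Im x\<bar>)"
      by (simp add: algebra_simps flip: exp_add)
    finally show "norm (F x * G x) \<le> (K * L) * exp (- (r + s) * \<bar>Im x\<bar>)" .
  qed
qed

lemma decay_rate_bound:
  assumes "decay_rate r F" "\<And>x. \<bar>Im x\<bar> \<ge> U \<Longrightarrow> norm (G x) \<le> norm (F x)"
  shows "decay_rate r G"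
  unfolding decay_rate_def
proof
  fix M
  obtain K T where K: "K \<ge> 0" "\<And>x. \<bar>Re x\<bar> \<le> M \<Longrightarrow> \<bar>Im x\<bar> \<ge> T \<Longrightarrow> norm (F x) \<le> K * exp (- r * \<bar>Im x\<bar>)"
    using decay_rateE[OF assms(1), of M] by metis
  show "\<exists>K T. \<forall>x. \<bar>Re x\<bar> \<le> M \<longrightarrow> \<bar>Im x\<bar> \<ge> T \<longrightarrow> norm (G x) \<le> K * exp (- r * \<bar>Im x\<bar>)"
  proof (rule exI[of _ K], rule exI[of _ "max T U"], intro allI impI)
    fix x :: complex assume x: "\<bar>Re x\<bar> \<le> M" "\<bar>Im x\<bar> \<ge> max T U"
    hence "norm (G x) \<le> norm (F x)" by (intro assms(2)) simp
    also have "\<dots> \<le> K * exp (- r * \<bar>Im x\<bar>)" using x by (intro K(2)) simp_all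
    finally show "norm (G x) \<le> K * exp (- r * \<bar>Im x\<bar>)" .
  qed
qed

text \<open>The summand \<open>e\<close> widens the strip by \<open>\<bar>Re e\<bar>\<close> and
  costs a constant factor \<open>exp \<bar>Im e\<bar>\<close>; the rate is unaffected.\<close>

lemma decay_rate_Gamma:
  "decay_rate 1 (\<lambda>x. Gamma (e + x))" "decay_rate 1 (\<lambda>x. Gamma (e - x))"
proof -
  have "decay_rate 1 (\<lambda>x. Gamma (e + of_real \<sigma> * x))" if \<sigma>: "\<sigma> = 1 \<or> \<sigma> = -1" for \<sigma> :: real
    unfolding decay_rate_def
  proof
    fix M
    obtain K T where K: "\<And>z. \<bar>Re z\<bar> \<le> M + \<bar>Re e\<bar> \<Longrightarrow> \<bar>Im z\<bar> \<ge> T \<Longrightarrow> norm (Gamma z :: complex) \<le> K * exp (- \<bar>Im z\<bar>)"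
      using Gamma_strip_bound[of "M + \<bar>Re e\<bar>"] by blast
    show "\<exists>K T. \<forall>x. \<bar>Re x\<bar> \<le> M \<longrightarrow> \<bar>Im x\<bar> \<ge> T \<longrightarrow> norm (Gamma (e + of_real \<sigma> * x)) \<le> K * exp (- 1 * \<bar>Im x\<bar>)"
    proof (rule exI[of _ "\<bar>K\<bar> * exp \<bar>Im e\<bar>"], rule exI[of _ "T + \<bar>Im e\<bar>"], intro allI impI)
      fix x :: complex assume x: "\<bar>Re x\<bar> \<le> M" "\<bar>Im x\<bar> \<ge> T + \<bar>Im e\<bar>"
      define z where "z = e + of_real \<sigma> * x"
      have z: "\<bar>Re z\<bar> \<le> M + \<bar>Re e\<bar>" "\<bar>Im z\<bar> \<ge> \<bar>Im x\<bar> - \<bar>Im e\<bar>" using \<sigma> x by (auto simp: z_def)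
      have "norm (Gamma z) \<le> K * exp (- \<bar>Im z\<bar>)" using z x by (intro K) auto
      also have "\<dots> \<le> \<bar>K\<bar> * exp (\<bar>Im e\<bar> - \<bar>Im x\<bar>)" using z by (intro mult_mono) auto
      also have "\<dots> = \<bar>K\<bar> * exp \<bar>Im e\<bar> * exp (- 1 * \<bar>Im x\<bar>)" by (simp add: exp_diff exp_minus field_simps)
      finally show "norm (Gamma (e + of_real \<sigma> * x)) \<le> \<bar>K\<bar> * exp \<bar>Im e\<bar> * exp (- 1 * \<bar>Im x\<bar>)" by (simp add: z_def)
    qed
  qed
  from this[of 1] this[of "-1"] show "decay_rate 1 (\<lambda>x. Gamma (e + x))" "decay_rate 1 (\<lambda>x. Gamma (e - x))"
    by simp_all
qed

text \<open>By the reflection formula the product is \<open>sin (2 * pi * x) / pi\<close>.\<close>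

lemma decay_rate_rGamma: "decay_rate (- 2 * pi) (\<lambda>x. rGamma (2 * x) * rGamma (1 - 2 * x))"
  unfolding decay_rate_def
proof (intro allI, rule exI[of _ 1], rule exI[of _ 0], intro allI impI)
  fix x :: complex
  have "norm (rGamma (2 * x) * rGamma (1 - 2 * x)) = norm (sin (of_real pi * (2 * x))) / pi"
    by (simp add: rGamma_reflection_complex norm_divide)
  also have "\<dots> \<le> exp \<bar>Im (of_real pi * (2 * x))\<bar> / 1"
    using cmod_sin_le_exp[of 1 "of_real pi * (2 * x)"] pi_gt3 by (intro frac_le) auto
  finally show "norm (rGamma (2 * x) * rGamma (1 - 2 * x)) \<le> 1 * exp (- (- 2 * pi) * \<bar>Im x\<bar>)"
    by (simp add: abs_mult mult_ac)
qed

lemma power_le_exp: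
  assumes "\<epsilon> > 0" "u \<ge> (0::real)" shows "u ^ n \<le> fact n / \<epsilon> ^ n * exp (\<epsilon> * u)"
proof -
  have "(\<epsilon> * u) ^ n /\<^sub>R fact n \<le> (\<Sum>n. (\<epsilon> * u) ^ n /\<^sub>R fact n)"
    using assms summable_exp_generic[of "\<epsilon> * u"]
    by (intro order.trans[OF _ sum_le_suminf[of _ "{n}"]]) auto
  hence "(\<epsilon> * u) ^ n / fact n \<le> exp (\<epsilon> * u)"
    by (simp add: exp_def divide_inverse mult.commute)
  thus ?thesis using assms by (simp add: field_simps power_mult_distrib)
qed

text \<open>A power is bounded by a single term of an exponential series, so a polynomial factor
  costs an arbitrarily small part of the rate.\<close>

lemma decay_rate_poly:
  assumes "\<epsilon> > 0" shows "decay_rate (- \<epsilon>) (poly p)"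
  unfolding decay_rate_def
proof
  fix M
  have "\<exists>K\<ge>0. \<forall>x. \<bar>Re x\<bar> \<le> M \<longrightarrow> norm (poly p x) \<le> K * exp (\<epsilon> * \<bar>Im x\<bar>)"
  proof -
    define N where "N = degree p"
    define S where "S = (\<Sum>i\<le>N. norm (coeff p i))"
    define K where "K = S * (fact N / \<epsilon> ^ N * exp (\<epsilon> * (1 + \<bar>M\<bar>)))"
    have S0: "S \<ge> 0" by (simp add: S_def sum_nonneg)
    show ?thesis
    proof (intro exI[of _ K] conjI allI impI)
      show "K \<ge> 0" using S0 assms by (simp add: K_def)
      fix x :: complex assume x: "\<bar>Re x\<bar> \<le> M"
      define u where "u = 1 + norm x"
      have u: "u \<ge> 1" "u \<ge> norm x" "u \<le> 1 + \<bar>M\<bar> + \<bar>Im x\<bar>" using x cmod_le[of x] by (auto simp: u_def)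
      have uN: "u ^ N \<le> fact N / \<epsilon> ^ N * exp (\<epsilon> * u)"
        using assms u(1) by (intro power_le_exp) auto
      have "norm (poly p x) \<le> (\<Sum>i\<le>N. norm (coeff p i * x ^ i))"
        unfolding poly_altdef N_def by (rule norm_sum)
      also have "\<dots> \<le> (\<Sum>i\<le>N. norm (coeff p i) * u ^ N)"
      proof (rule sum_mono)
        fix i assume i: "i \<in> {..N}"
        have "norm x ^ i \<le> u ^ i" using u by (intro power_mono) auto
        also have "\<dots> \<le> u ^ N" using u i by (intro power_increasing) auto
        finally show "norm (coeff p i * x ^ i) \<le> norm (coeff p i) * u ^ N"
          by (simp add: norm_mult norm_power mult_left_mono)
      qed
      also have "\<dots> = S * u ^ N" by (simp add: S_def sum_distrib_right)
      also have "\<dots> \<le> S * (fact N / \<epsilon> ^ N * exp (\<epsilon> * u))" using S0 uN by (intro mult_left_mono) auto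
      also have "\<dots> \<le> S * (fact N / \<epsilon> ^ N * exp (\<epsilon> * (1 + \<bar>M\<bar> + \<bar>Im x\<bar>)))"
        using S0 assms u by (intro mult_left_mono) auto
      also have "\<dots> = K * exp (\<epsilon> * \<bar>Im x\<bar>)"
        by (simp add: K_def ring_distribs exp_add)
      finally show "norm (poly p x) \<le> K * exp (\<epsilon> * \<bar>Im x\<bar>)" .
    qed
  qed
  thus "\<exists>K T. \<forall>x. \<bar>Re x\<bar> \<le> M \<longrightarrow> \<bar>Im x\<bar> \<ge> T \<longrightarrow> norm (poly p x) \<le> K * exp (- (- \<epsilon>) * \<bar>Im x\<bar>)"
    by (simp only: minus_minus) blast
qed

text \<open>Each of the eight Gamma factors contributes 1 and the sine costs \<open>2 * pi\<close>;
  the sum is positive since \<open>pi < 4\<close>.\<close>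

lemma decay_rate_Delta: "decay_rate (8 - 2 * pi) (Delta t)"
proof -
  have "decay_rate (1+1+1+1+1+1+1+1 + (- 2 * pi)) (\<lambda>x.
     (Gamma (par_a t + x) * Gamma (par_a t + 1 - x) *
     Gamma (par_b t + x) * Gamma (par_b t + 1 - x) *
     Gamma (par_c t + x) * Gamma (par_c t - x) *
     Gamma (par_d t + x) * Gamma (par_d t - x)) *
     (rGamma (2 * x) * rGamma (1 - 2 * x)))"
    by (intro decay_rate_mult decay_rate_Gamma decay_rate_rGamma)
  thus ?thesis by (simp add: Delta_def[abs_def] mult.assoc)
qed

text \<open>
  A * Delta and B * Delta, where A and B are the coefficients of the reflections in T1 and T0,
  written without the poles of A and B.
\<close>

definition DeltaA :: "params \<Rightarrow> complex \<Rightarrow> complex" where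
  "DeltaA t x =
     Gamma (par_a t + 1 + x) * Gamma (par_a t + 1 - x) *
     Gamma (par_b t + 1 + x) * Gamma (par_b t + 1 - x) *
     Gamma (par_c t + x) * Gamma (par_c t - x) *
     Gamma (par_d t + x) * Gamma (par_d t - x) *
     (rGamma (1 + 2 * x) * rGamma (1 - 2 * x))"

definition DeltaB :: "params \<Rightarrow> complex \<Rightarrow> complex" where
  "DeltaB t x =
     Gamma (par_a t + x) * Gamma (par_a t + 1 - x) *
     Gamma (par_b t + x) * Gamma (par_b t + 1 - x) *
     Gamma (par_c t + x) * Gamma (par_c t + 1 - x) *
     Gamma (par_d t + x) * Gamma (par_d t + 1 - x) *
     (rGamma (2 * x) * rGamma (2 - 2 * x))"

section \<open>Symmetries, poles and holomorphy of the weight functions\<close>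

lemma DeltaA_reflect: "DeltaA t (0 - x) = DeltaA t x"
  by (simp add: DeltaA_def mult_ac)

lemma DeltaB_reflect: "DeltaB t (1 - x) = DeltaB t x"
proof -
  have e: "2 * (1 - x) = 2 - 2 * x" "2 - 2 * (1 - x) = 2 * x" "\<And>e. e + 1 - (1 - x) = e + x"
    "\<And>e. e + (1 - x) = e + 1 - x" by (simp_all add: algebra_simps)
  show ?thesis unfolding DeltaB_def unfolding e(2) unfolding e(1,3,4) by (simp only: mult_ac)
qed

text \<open>The left and right series have separate index sets because for \<open>DeltaB\<close> the
  left series start at \<open>- e\<close> and the right ones at \<open>e + 1\<close>.\<close>

definition poles :: "complex set \<Rightarrow> complex set \<Rightarrow> complex set" where
  "poles L R = {- (e + of_nat n) | e n. e \<in> L} \<union> {e + of_nat n | e n. e \<in> R}"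

lemma not_poles_Gamma:
  assumes "x \<notin> poles L R"
  shows "e \<in> L \<Longrightarrow> e + x \<notin> \<int>\<^sub>\<le>\<^sub>0" "e \<in> R \<Longrightarrow> e - x \<notin> \<int>\<^sub>\<le>\<^sub>0"
proof -
  show "e + x \<notin> \<int>\<^sub>\<le>\<^sub>0" if "e \<in> L"
  proof
    assume "e + x \<in> \<int>\<^sub>\<le>\<^sub>0"
    then obtain n where "e + x = - of_nat n" by (elim nonpos_Ints_cases')
    hence "x = - (e + of_nat n)" by (simp add: algebra_simps eq_neg_iff_add_eq_0)
    thus False using assms that by (auto simp: poles_def)
  qed
  show "e - x \<notin> \<int>\<^sub>\<le>\<^sub>0" if "e \<in> R"
  proof
    assume "e - x \<in> \<int>\<^sub>\<le>\<^sub>0"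
    then obtain n where "e - x = - of_nat n" by (elim nonpos_Ints_cases')
    hence "x = e + of_nat n" by (simp add: algebra_simps)
    thus False using assms that by (auto simp: poles_def)
  qed
qed

lemma poles_finite_strip:
  assumes "finite L" "finite R" shows "finite {p \<in> poles L R. \<bar>Re p\<bar> \<le> M}"
proof (rule finite_subset)
  define N where "N = (\<lambda>e::complex. nat \<lceil>M + \<bar>Re e\<bar>\<rceil>)"
  show "finite ((\<Union>e\<in>L. (\<lambda>n. - (e + of_nat n)) ` {..N e}) \<union> (\<Union>e\<in>R. (\<lambda>n. e + of_nat n) ` {..N e}))"
    using assms by auto
  show "{p \<in> poles L R. \<bar>Re p\<bar> \<le> M} \<subseteq> (\<Union>e\<in>L. (\<lambda>n. - (e + of_nat n)) ` {..N e}) \<union> (\<Union>e\<in>R. (\<lambda>n. e + of_nat n) ` {..N e})"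
  proof
    fix p assume p: "p \<in> {p \<in> poles L R. \<bar>Re p\<bar> \<le> M}"
    then obtain e n where en: "(e \<in> L \<and> p = - (e + of_nat n)) \<or> (e \<in> R \<and> p = e + of_nat n)" by (auto simp: poles_def)
    hence "\<bar>Re e + real n\<bar> \<le> M" using p by auto
    hence "n \<le> N e" unfolding N_def by linarith
    thus "p \<in> (\<Union>e\<in>L. (\<lambda>n. - (e + of_nat n)) ` {..N e}) \<union> (\<Union>e\<in>R. (\<lambda>n. e + of_nat n) ` {..N e})" using en by blast
  qed
qed

lemma closed_if_finite_strip:
  assumes "\<And>M. finite {p \<in> P. \<bar>Re p\<bar> \<le> M}" shows "closed P"
  unfolding closed_limpt
proof (intro allI impI)
  fix x assume "x islimpt P"
  hence "infinite (P \<inter> ball x 1)" by (auto simp: islimpt_eq_infinite_ball)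
  moreover have "P \<inter> ball x 1 \<subseteq> {p \<in> P. \<bar>Re p\<bar> \<le> norm x + 1}"
  proof
    fix p assume "p \<in> P \<inter> ball x 1"
    moreover from this have "norm (x - p) < 1" by (simp add: dist_norm)
    ultimately show "p \<in> {p \<in> P. \<bar>Re p\<bar> \<le> norm x + 1}"
      using norm_triangle_ineq3[of x p] abs_Re_le_cmod[of p] by auto
  qed
  ultimately show "x \<in> P" using assms finite_subset by blast
qed

lemma poles_closed: "finite L \<Longrightarrow> finite R \<Longrightarrow> closed (poles L R)"
  by (rule closed_if_finite_strip) (rule poles_finite_strip)

lemma holomorphic_Gamma_plus: "(\<And>x. x \<in> S \<Longrightarrow> e + x \<notin> \<int>\<^sub>\<le>\<^sub>0) \<Longrightarrow> (\<lambda>x. Gamma (e + x)) holomorphic_on S"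
  by (intro holomorphic_Gamma' holomorphic_intros) auto

lemma holomorphic_Gamma_minus: "(\<And>x. x \<in> S \<Longrightarrow> e - x \<notin> \<int>\<^sub>\<le>\<^sub>0) \<Longrightarrow> (\<lambda>x. Gamma (e - x)) holomorphic_on S"
  by (intro holomorphic_Gamma' holomorphic_intros) auto

lemma holomorphic_DeltaB:
  assumes "L = {par_a t, par_b t, par_c t, par_d t}" "R = (\<lambda>e. e + 1) ` L"
  shows "DeltaB t holomorphic_on - poles L R"
  unfolding DeltaB_def[abs_def]
  by (intro holomorphic_on_mult holomorphic_Gamma_plus holomorphic_Gamma_minus holomorphic_rGamma' holomorphic_intros;
      erule ComplD[THEN not_poles_Gamma(1)] ComplD[THEN not_poles_Gamma(2)]; simp add: assms)

text \<open>A shifted parameter \<open>e + 1\<close> produces only poles already belonging to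
  \<open>e\<close>, so one pole set serves both functions.\<close>

lemma holomorphic_Delta:
  assumes "L = {par_a t, par_b t, par_c t, par_d t}"
  shows "Delta t holomorphic_on - poles L L" "DeltaA t holomorphic_on - poles L L"
proof -
  have 1: "e + 1 - x \<notin> \<int>\<^sub>\<le>\<^sub>0" "e + 1 + x \<notin> \<int>\<^sub>\<le>\<^sub>0" "e + x \<notin> \<int>\<^sub>\<le>\<^sub>0" "e - x \<notin> \<int>\<^sub>\<le>\<^sub>0"
    if "e \<in> L" "x \<in> - poles L L" for e x
  proof -
    show e: "e + x \<notin> \<int>\<^sub>\<le>\<^sub>0" "e - x \<notin> \<int>\<^sub>\<le>\<^sub>0" using that not_poles_Gamma[of x L L e] by auto
    have "y - 1 \<in> \<int>\<^sub>\<le>\<^sub>0" if "y \<in> \<int>\<^sub>\<le>\<^sub>0" for y :: complex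
      using that by (meson nonpos_Ints_diff_Nats Nats_1)
    from this[of "e + 1 - x"] this[of "e + 1 + x"] e
    show "e + 1 - x \<notin> \<int>\<^sub>\<le>\<^sub>0" "e + 1 + x \<notin> \<int>\<^sub>\<le>\<^sub>0" by (auto simp: algebra_simps)
  qed
  show "DeltaA t holomorphic_on - poles L L"
    unfolding DeltaA_def[abs_def]
    by (intro holomorphic_on_mult holomorphic_Gamma_plus holomorphic_Gamma_minus holomorphic_rGamma' holomorphic_intros 1;
      simp add: assms)
  show "Delta t holomorphic_on - poles L L"
    unfolding Delta_def[abs_def]
    by (intro holomorphic_on_mult holomorphic_Gamma_plus holomorphic_Gamma_minus holomorphic_rGamma' holomorphic_intros 1;
      simp add: assms)
qed

section \<open>Self-adjointness of T0 and T1\<close>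

lemma DeltaA_eq:
  assumes "par_a t + x \<notin> \<int>\<^sub>\<le>\<^sub>0" "par_b t + x \<notin> \<int>\<^sub>\<le>\<^sub>0"
  shows "2 * x * DeltaA t x = (par_a t + x) * (par_b t + x) * Delta t x"
proof -
  have 1: "Gamma (par_a t + 1 + x) = (par_a t + x) * Gamma (par_a t + x)"
    "Gamma (par_b t + 1 + x) = (par_b t + x) * Gamma (par_b t + x)"
    using assms Gamma_plus1[of "par_a t + x"] Gamma_plus1[of "par_b t + x"] by (simp_all add: add_ac)
  have 2: "rGamma (2 * x) = 2 * x * rGamma (1 + 2 * x)" using rGamma_plus1[of "2 * x"] by (simp add: add.commute)
  show ?thesis unfolding DeltaA_def Delta_def 1 2 by (simp only: mult_ac)
qed

lemma DeltaB_eq: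
  assumes "par_c t - x \<notin> \<int>\<^sub>\<le>\<^sub>0" "par_d t - x \<notin> \<int>\<^sub>\<le>\<^sub>0"
  shows "(1 - 2 * x) * DeltaB t x = (par_c t - x) * (par_d t - x) * Delta t x"
proof -
  have 1: "Gamma (par_c t + 1 - x) = (par_c t - x) * Gamma (par_c t - x)"
    "Gamma (par_d t + 1 - x) = (par_d t - x) * Gamma (par_d t - x)"
    using assms Gamma_plus1[of "par_c t - x"] Gamma_plus1[of "par_d t - x"] by (simp_all add: algebra_simps)
  have 2: "rGamma (1 - 2 * x) = (1 - 2 * x) * rGamma (2 - 2 * x)"
    using rGamma_plus1[of "1 - 2 * x"] by (simp add: algebra_simps)
  show ?thesis unfolding DeltaB_def Delta_def 1 2 by (simp only: mult_ac)
qed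

text \<open>With \<open>DeltaA\<close> in place of the quotient the formula has no denominator and
  extends to \<open>x = 0\<close>, where \<open>rGamma (2 * x)\<close> makes \<open>Delta\<close>
  vanish.\<close>

lemma T1_Delta:
  assumes "x \<notin> poles {par_a t, par_b t, par_c t, par_d t} R"
  shows "poly (T1 t f) x * Delta t x = t1 t * poly f x * Delta t x + (poly f (0 - x) - poly f x) * DeltaA t x"
proof (cases "x = 0")
  case True
  thus ?thesis by (simp add: Delta_def)
next
  case False
  have "2 * x * DeltaA t x = (par_a t + x) * (par_b t + x) * Delta t x"
    using not_poles_Gamma(1)[OF assms] by (intro DeltaA_eq) auto
  hence "DeltaA t x = (par_a t + x) * (par_b t + x) / (2 * x) * Delta t x"
    using False by (simp add: field_simps)
  thus ?thesis unfolding poly_T1[OF False] by (simp add: algebra_simps)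
qed

lemma T0_Delta:
  assumes "x \<notin> poles L {par_a t, par_b t, par_c t, par_d t}"
  shows "poly (T0 t f) x * Delta t x = t0 t * poly f x * Delta t x + (poly f (1 - x) - poly f x) * DeltaB t x"
proof (cases "x = 1 / 2")
  case True
  \<comment> \<open>The point 1/2 is fixed by the reflection, and \<open>Delta\<close> contains the
    factor \<open>rGamma 0\<close> there.\<close>
  have e: "1 - 2 * x = 0" "poly f (1 - x) = poly f x" unfolding True by simp_all
  show ?thesis unfolding Delta_def e by simp
next
  case False
  have nz: "1 - 2 * x \<noteq> 0" using False by (auto simp: field_simps)
  have eq: "(1 - 2 * x) * DeltaB t x = (par_c t - x) * (par_d t - x) * Delta t x"
    using not_poles_Gamma(2)[OF assms] by (intro DeltaB_eq) auto
  define q where "q = (par_c t - x) * (par_d t - x) / (1 - 2 * x)"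
  have "(1 - 2 * x) * DeltaB t x = (1 - 2 * x) * (q * Delta t x)"
    unfolding eq using nz by (simp add: q_def)
  hence B: "DeltaB t x = q * Delta t x" using nz by (simp only: mult_cancel_left) simp
  show ?thesis unfolding poly_T0[OF False] B q_def[symmetric] by algebra
qed

lemma notin_nonpos_Ints_Im: "Im z \<noteq> 0 \<Longrightarrow> z \<notin> \<int>\<^sub>\<le>\<^sub>0"
  by (auto elim!: nonpos_Ints_cases)

text \<open>Dividing by \<open>q\<close> costs nothing where its modulus is at least 1. The
  numerator \<open>p\<close> is charged \<open>2 - pi / 2\<close>, a quarter of the rate of
  \<open>Delta\<close>, so a positive rate remains.\<close>

lemma decay_rate_quotient:
  assumes "\<And>x. \<bar>Im x\<bar> \<ge> U \<Longrightarrow> 1 \<le> norm (q x) \<and> q x * G x = poly p x * Delta t x"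
  shows "decay_rate (8 - 2 * pi - (2 - pi / 2)) G"
proof (rule decay_rate_bound)
  have "decay_rate (- (2 - pi / 2) + (8 - 2 * pi)) (\<lambda>x. poly p x * Delta t x)"
    using pi_less_4 by (intro decay_rate_mult decay_rate_Delta decay_rate_poly) simp
  thus "decay_rate (8 - 2 * pi - (2 - pi / 2)) (\<lambda>x. poly p x * Delta t x)" by simp
  fix x :: complex assume x: "\<bar>Im x\<bar> \<ge> U"
  have "1 * norm (G x) \<le> norm (q x) * norm (G x)" using assms[OF x] by (intro mult_right_mono) auto
  thus "norm (G x) \<le> norm (poly p x * Delta t x)" using assms[OF x] by (simp add: norm_mult[symmetric])
qed

lemma decay_rate_DeltaA: "decay_rate (8 - 2 * pi - (2 - pi / 2)) (DeltaA t)"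
proof (rule decay_rate_quotient)
  fix x :: complex assume x: "\<bar>Im x\<bar> \<ge> \<bar>Im (par_a t)\<bar> + \<bar>Im (par_b t)\<bar> + 1"
  have "2 * x * DeltaA t x = (par_a t + x) * (par_b t + x) * Delta t x"
    using x by (intro DeltaA_eq notin_nonpos_Ints_Im) auto
  thus "1 \<le> norm (2 * x) \<and> 2 * x * DeltaA t x = poly ([:par_a t, 1:] * [:par_b t, 1:]) x * Delta t x"
    using x abs_Im_le_cmod[of x] unfolding poly_mult by simp
qed

lemma decay_rate_DeltaB: "decay_rate (8 - 2 * pi - (2 - pi / 2)) (DeltaB t)"
proof (rule decay_rate_quotient)
  fix x :: complex assume x: "\<bar>Im x\<bar> \<ge> \<bar>Im (par_c t)\<bar> + \<bar>Im (par_d t)\<bar> + 1"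
  have "(1 - 2 * x) * DeltaB t x = (par_c t - x) * (par_d t - x) * Delta t x"
    using x by (intro DeltaB_eq notin_nonpos_Ints_Im) auto
  thus "1 \<le> norm (1 - 2 * x) \<and> (1 - 2 * x) * DeltaB t x = poly ([:par_c t, -1:] * [:par_d t, -1:]) x * Delta t x"
    using x abs_Im_le_cmod[of "1 - 2 * x"] unfolding poly_mult by simp
qed

lemma strip_decay_poly_mult:
  assumes "decay_rate r F" "r > 0" shows "strip_decay (\<lambda>x. poly p x * F x)"
proof -
  have "decay_rate (- (r / 2) + r) (\<lambda>x. poly p x * F x)"
    using assms by (intro decay_rate_mult decay_rate_poly) auto
  thus ?thesis using assms(2) unfolding strip_decay_def by (intro exI[of _ "- (r / 2) + r"]) simp
qed

lemma rates_pos: "0 < 8 - 2 * pi" "0 < 8 - 2 * pi - (2 - pi / 2)"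
  using pi_less_4 by simp_all

lemma admissible_tail_curve: "admissible_contour t C \<Longrightarrow> tail_curve 0 C"
  by (auto simp: admissible_contour_def tail_curve_def)

lemma admissible_sides:
  assumes "admissible_contour t C" "e \<in> {par_a t, par_b t, par_c t, par_d t}"
  shows "side 1 C (e + of_nat n)" "side (-1) C (- (e + of_nat n))"
  using assms unfolding admissible_contour_def side_right side_left by blast+

text \<open>Substitution replaces \<open>C\<close> by its reflected copy. As every pole and its
  mirror image lie on opposite sides of \<open>C\<close>, the copy has the same poles on the same
  sides and can be deformed back.\<close>

lemma line_integral_reflection_invariant:
  assumes C: "tail_curve 0 C"
    and sides: "\<And>p. p \<in> P \<Longrightarrow> side 1 C p \<and> side (-1) C (of_real \<kappa> - p) \<or> side (-1) C p \<and> side 1 C (of_real \<kappa> - p)"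
    and P: "\<And>M. finite {p\<in>P. \<bar>Re p\<bar> \<le> M}"
    and F: "F holomorphic_on - P" "strip_decay F"
    and G: "\<And>x. G x = F (of_real \<kappa> - x)"
    and GF: "(\<lambda>s. G (C s) * vector_derivative C (at s)) integrable_on UNIV"
  shows "line_integral G C = line_integral F C"
proof -
  define C' where "C' = (\<lambda>s. of_real \<kappa> - C (- s))"
  have "line_integral F C = line_integral F C'"
  proof (rule line_integral_cong_contour[OF C _ _ closed_if_finite_strip[OF P] P F])
    show "tail_curve (\<kappa> - 0) C'" unfolding C'_def by (rule tail_curve_reflect[OF C])
    have "side (-1) C' p" if "side 1 C (of_real \<kappa> - p)" for p
      unfolding C'_def by (rule side_reflect[OF that]) simp
    moreover have "side 1 C' p" if "side (-1) C (of_real \<kappa> - p)" for p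
      using side_reflect[OF that] unfolding C'_def by simp
    ultimately show "side 1 C p \<and> side 1 C' p \<or> side (- 1) C p \<and> side (- 1) C' p" if "p \<in> P" for p
      using sides[OF that] by blast
  qed
  also have "\<dots> = line_integral (\<lambda>x. F (of_real \<kappa> - x)) C"
    unfolding C'_def by (rule line_integral_reflect) (use GF in \<open>simp add: G\<close>)
  finally show ?thesis using G by (simp add: line_integral_def)
qed

lemma form_line_integral:
  "form t C f g = 1 / (2 * of_real pi * \<i>) * line_integral (\<lambda>x. poly (f * g) x * Delta t x) C"
  by (simp add: form_def line_integral_def)

lemma line_integral_cong:
  "(\<And>s. F (C s) = G (C s)) \<Longrightarrow> line_integral F C = line_integral G C"
  by (simp add: line_integral_def)

lemma line_integral_add:
  assumes "(\<lambda>s. F (C s) * vector_derivative C (at s)) integrable_on UNIV"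
    "(\<lambda>s. G (C s) * vector_derivative C (at s)) integrable_on UNIV"
  shows "line_integral (\<lambda>x. F x + G x) C = line_integral F C + line_integral G C"
  using integral_add[OF assms] by (simp add: line_integral_def distrib_right)

lemma line_integral_diff:
  assumes "(\<lambda>s. F (C s) * vector_derivative C (at s)) integrable_on UNIV"
    "(\<lambda>s. G (C s) * vector_derivative C (at s)) integrable_on UNIV"
  shows "line_integral (\<lambda>x. F x - G x) C = line_integral F C - line_integral G C"
  using integral_diff[OF assms] by (simp add: line_integral_def left_diff_distrib)

lemma line_integral_mult: "line_integral (\<lambda>x. c * F x) C = c * line_integral F C"
  by (simp add: line_integral_def mult.assoc)

text \<open>The reflection exchanges the roles of the two polynomials in the only term of the
  adjunction that is not visibly symmetric, and its invariant weight makes that term symmetric as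
  well.\<close>

lemma symmetric_functional_form:
  assumes gen: "generic t" and adm: "admissible_contour t C"
  shows "symmetric_functional t (\<lambda>f. form t C f 1)"
proof -
  define A where "A = {par_a t, par_b t, par_c t, par_d t}"
  define A1 where "A1 = (\<lambda>e. e + 1) ` A"
  have fin: "finite A" "finite A1" by (auto simp: A_def A1_def)
  have C: "tail_curve 0 C" using adm by (rule admissible_tail_curve)
  have sd: "side 1 C (e + of_nat n)" "side (-1) C (- (e + of_nat n))" if "e \<in> A" for e n
    using admissible_sides[OF adm] that unfolding A_def by blast+
  have P: "side 1 C p \<and> side (-1) C (of_real 0 - p) \<or> side (-1) C p \<and> side 1 C (of_real 0 - p)" if "p \<in> poles A A" for p
  proof -
    from that consider e n where "e \<in> A" "p = - (e + of_nat n)" | e n where "e \<in> A" "p = e + of_nat n"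
      by (auto simp: poles_def)
    thus ?thesis
    proof cases
      case 1
      hence "of_real 0 - p = e + of_nat n" by simp
      thus ?thesis using sd[OF 1(1), of n] 1(2) by metis
    next
      case 2
      hence "of_real 0 - p = - (e + of_nat n)" by simp
      thus ?thesis using sd[OF 2(1), of n] 2(2) by metis
    qed
  qed
  \<comment> \<open>Under x -> 1 - x the poles \<open>- (e + n)\<close> and \<open>e + 1 + n\<close>
    are exchanged. A pole at \<open>e\<close> itself would go to \<open>1 - e\<close>, about whose
    side of the contour nothing is known.\<close>
  have P1: "side 1 C p \<and> side (-1) C (of_real 1 - p) \<or> side (-1) C p \<and> side 1 C (of_real 1 - p)" if "p \<in> poles A A1" for p
  proof -
    from that consider e n where "e \<in> A" "p = - (e + of_nat n)" | e n where "e \<in> A" "p = e + 1 + of_nat n"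
      by (auto simp: poles_def A1_def)
    thus ?thesis
    proof cases
      case 1
      hence "of_real 1 - p = e + of_nat (Suc n)" by simp
      thus ?thesis using sd[OF 1(1), of n] sd[OF 1(1), of "Suc n"] 1(2) by metis
    next
      case 2
      hence "of_real 1 - p = - (e + of_nat n)" "p = e + of_nat (Suc n)" by simp_all
      thus ?thesis using sd[OF 2(1), of n] sd[OF 2(1), of "Suc n"] by metis
    qed
  qed
  have CP: "range C \<inter> poles A A = {}" "range C \<inter> poles A A1 = {}" using P P1 side_not_range by blast+
  have hol: "(\<lambda>x. poly p x * Delta t x) holomorphic_on - poles A A" "(\<lambda>x. poly p x * DeltaA t x) holomorphic_on - poles A A"
     "(\<lambda>x. poly p x * DeltaB t x) holomorphic_on - poles A A1" for p
    using holomorphic_Delta[OF A_def] holomorphic_DeltaB[OF A_def A1_def] by (auto intro!: holomorphic_intros)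
  have dec: "strip_decay (\<lambda>x. poly p x * Delta t x)" "strip_decay (\<lambda>x. poly p x * DeltaA t x)"
     "strip_decay (\<lambda>x. poly p x * DeltaB t x)" for p
    using strip_decay_poly_mult decay_rate_Delta decay_rate_DeltaA decay_rate_DeltaB rates_pos by blast+
  have int: "(\<lambda>s. poly p (C s) * Delta t (C s) * vector_derivative C (at s)) integrable_on UNIV"
    "(\<lambda>s. poly p (C s) * DeltaA t (C s) * vector_derivative C (at s)) integrable_on UNIV"
    "(\<lambda>s. poly p (C s) * DeltaB t (C s) * vector_derivative C (at s)) integrable_on UNIV" for p
    using line_integral_limit(1)[OF C poles_closed[OF fin(1) fin(1)] CP(1) hol(1) dec(1)]
      line_integral_limit(1)[OF C poles_closed[OF fin(1) fin(1)] CP(1) hol(2) dec(2)]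
      line_integral_limit(1)[OF C poles_closed[OF fin(1) fin(2)] CP(2) hol(3) dec(3)] by blast+
  define I where "I = (\<lambda>D p. line_integral (\<lambda>x. poly p x * D t x) C)"
  have form: "form t C f 1 = 1 / (2 * of_real pi * \<i>) * I Delta f" for f
    by (simp add: form_line_integral I_def)
  have I_add: "I Delta (f + g) = I Delta f + I Delta g" for f g
    unfolding I_def by (subst line_integral_add[symmetric]) (auto intro: int simp: distrib_right)
  have I_smult: "I Delta (smult c f) = c * I Delta f" for c f
    unfolding I_def by (subst line_integral_mult[symmetric]) (simp add: mult_ac)
  have symA: "I DeltaA (pcompose f [:0, -1:] * g) = I DeltaA (f * pcompose g [:0, -1:])" for f g
    unfolding I_def
  proof (rule line_integral_reflection_invariant[OF C P poles_finite_strip[OF fin(1) fin(1)] hol(2) dec(2) _ int(2)])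
    show "poly (f \<circ>\<^sub>p [:0, -1:] * g) x * DeltaA t x =
        poly (f * g \<circ>\<^sub>p [:0, -1:]) (of_real 0 - x) * DeltaA t (of_real 0 - x)" for x
      using DeltaA_reflect[of t x] by (simp add: poly_pcompose)
  qed
  have symB: "I DeltaB (pcompose f [:1, -1:] * g) = I DeltaB (f * pcompose g [:1, -1:])" for f g
    unfolding I_def
  proof (rule line_integral_reflection_invariant[OF C P1 poles_finite_strip[OF fin(1) fin(2)] hol(3) dec(3) _ int(3)])
    show "poly (f \<circ>\<^sub>p [:1, -1:] * g) x * DeltaB t x =
        poly (f * g \<circ>\<^sub>p [:1, -1:]) (of_real 1 - x) * DeltaB t (of_real 1 - x)" for x
      using DeltaB_reflect[of t x] by (simp add: poly_pcompose)
  qed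
  \<comment> \<open>Both operators are a scalar plus a reflection difference; \<open>k\<close> is 0
    for \<open>T1\<close> and 1 for \<open>T0\<close>.\<close>
  have adj: "I Delta (T f * g) = c * I Delta (f * g) + (I D (pcompose f [:k, -1:] * g) - I D (f * g))"
    if T: "\<And>x. x \<notin> poles A A \<Longrightarrow> poly (T f) x * Delta t x = c * poly f x * Delta t x + (poly f (k - x) - poly f x) * D t x"
      and D: "\<And>p. (\<lambda>s. poly p (C s) * D t (C s) * vector_derivative C (at s)) integrable_on UNIV"
    for T D c k f g
  proof -
    have "I Delta (T f * g) = line_integral (\<lambda>x. c * (poly (f * g) x * Delta t x) +
        (poly (pcompose f [:k, -1:] * g) x * D t x - poly (f * g) x * D t x)) C"
      unfolding I_def
    proof (rule line_integral_cong)
      fix s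
      have "C s \<notin> poles A A" using CP(1) by blast
      from T[OF this] have "poly g (C s) * (poly (T f) (C s) * Delta t (C s)) = poly g (C s) *
        (c * poly f (C s) * Delta t (C s) + (poly f (k - C s) - poly f (C s)) * D t (C s))" by simp
      thus "poly (T f * g) (C s) * Delta t (C s) = c * (poly (f * g) (C s) * Delta t (C s)) +
        (poly (pcompose f [:k, -1:] * g) (C s) * D t (C s) - poly (f * g) (C s) * D t (C s))"
        by (simp add: poly_pcompose algebra_simps)
    qed
    also have "\<dots> = line_integral (\<lambda>x. c * (poly (f * g) x * Delta t x)) C +
        line_integral (\<lambda>x. poly (pcompose f [:k, -1:] * g) x * D t x - poly (f * g) x * D t x) C"
    proof (rule line_integral_add)
      show "(\<lambda>s. c * (poly (f * g) (C s) * Delta t (C s)) * vector_derivative C (at s)) integrable_on UNIV"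
        using integrable_on_mult_right[OF int(1)[of "f * g"], of c] by (simp add: mult.assoc)
      show "(\<lambda>s. (poly (pcompose f [:k, -1:] * g) (C s) * D t (C s) - poly (f * g) (C s) * D t (C s)) *
          vector_derivative C (at s)) integrable_on UNIV"
        using integrable_diff[OF D[of "pcompose f [:k, -1:] * g"] D[of "f * g"]] by (simp only: left_diff_distrib)
    qed
    finally show ?thesis unfolding I_def line_integral_mult by (subst (asm) line_integral_diff[OF D D])
  qed
  have adjA: "I Delta (T1 t f * g) = t1 t * I Delta (f * g) +
      (I DeltaA (pcompose f [:0, -1:] * g) - I DeltaA (f * g))" for f g
    using T1_Delta[of _ t A, folded A_def] by (intro adj int(2))
  have adjB: "I Delta (T0 t f * g) = t0 t * I Delta (f * g) +
      (I DeltaB (pcompose f [:1, -1:] * g) - I DeltaB (f * g))" for f g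
    using T0_Delta[of _ A t, folded A_def] by (intro adj int(3))
  show ?thesis
  proof
    show "generic t" by fact
    show "form t C (f + g) 1 = form t C f 1 + form t C g 1" for f g
      by (simp add: form I_add distrib_left)
    show "form t C (smult c f) 1 = c * form t C f 1" for c f
      by (simp add: form I_smult)
    show "form t C (T1 t f * g) 1 = form t C (f * T1 t g) 1" for f g
      using adjA[of f g] adjA[of g f] symA[of f g] by (simp add: form mult.commute)
    show "form t C (T0 t f * g) 1 = form t C (f * T0 t g) 1" for f g
      using adjB[of f g] adjB[of g f] symB[of f g] by (simp add: form mult.commute)
  qed
qed

section \<open>Nonvanishing of the total mass\<close>

lemma integrable_lborel_exp_abs:
  assumes "c > (0::real)" shows "integrable lborel (\<lambda>s. exp (- c * \<bar>s\<bar>))"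
proof -
  have "(\<lambda>s. exp (- c * \<bar>s\<bar>)) absolutely_integrable_on UNIV"
    using integrable_exp_abs[OF assms] by (rule nonnegative_absolutely_integrable_1) simp
  hence "integrable lebesgue (\<lambda>s. exp (- c * \<bar>s\<bar>))" by (simp add: set_integrable_def)
  thus ?thesis by (subst (asm) integrable_completion) auto
qed

lemma integrable_exp_dominated:
  fixes g :: "real \<Rightarrow> complex"
  assumes "c > 0" "g \<in> borel_measurable lborel" "\<And>s. norm (g s) \<le> K * exp (- c * \<bar>s\<bar>)"
  shows "integrable lborel g"
proof (rule Bochner_Integration.integrable_bound[OF _ assms(2)])
  show "integrable lborel (\<lambda>s. K * exp (- c * \<bar>s\<bar>))"
    using integrable_lborel_exp_abs[OF assms(1)] by (rule integrable_mult_right)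
  show "AE s in lborel. norm (g s) \<le> norm (K * exp (- c * \<bar>s\<bar>))"
    using assms(3) by (intro always_eventually allI) (auto intro: order.trans[OF _ abs_ge_self])
qed

text \<open>Writing 1/z as a superposition of exponentials transfers the vanishing of a Fourier
  transform to Cauchy integrals.\<close>

lemma laplace_one:
  assumes "Re z > 0"
  shows "(\<integral>\<tau>. indicator {0..} \<tau> *\<^sub>R exp (- (of_real \<tau> * z)) \<partial>lborel) = 1 / z"
proof -
  define f where "f = (\<lambda>\<tau>. indicator {0..} \<tau> *\<^sub>R exp (- (of_real \<tau> * z)))"
  have z: "z \<noteq> 0" using assms by auto
  have bd: "norm (f \<tau>) \<le> 1 * exp (- Re z * \<bar>\<tau>\<bar>)" for \<tau>
    by (auto simp: f_def indicator_def)
  have meas: "f \<in> borel_measurable lborel" unfolding f_def by measurable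
  have int: "integrable lborel f" by (rule integrable_exp_dominated[OF assms meas bd])
  have hi: "(f has_integral (1 - exp (- (of_real S * z))) / z) {-S..S}" if "S \<ge> 0" for S
  proof -
    have "((\<lambda>\<tau>. exp (- (of_real \<tau> * z))) has_integral
        (- exp (- (of_real S * z)) / z) - (- exp (- (of_real 0 * z)) / z)) {0..S}"
    proof (rule fundamental_theorem_of_calculus[OF that])
      fix x assume "x \<in> {0..S}"
      have "((\<lambda>w. - exp (- (w * z)) / z) has_field_derivative exp (- (of_real x * z))) (at (of_real x))"
        using z by (auto intro!: derivative_eq_intros)
      hence "((\<lambda>\<tau>. - exp (- (of_real \<tau> * z)) / z) has_vector_derivative exp (- (of_real x * z))) (at x)"
        by (rule has_vector_derivative_real_field)
      thus "((\<lambda>\<tau>. - exp (- (of_real \<tau> * z)) / z) has_vector_derivative exp (- (of_real x * z))) (at x within {0..S})"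
        by (rule has_vector_derivative_at_within)
    qed
    hence 1: "((\<lambda>\<tau>. exp (- (of_real \<tau> * z))) has_integral (1 - exp (- (of_real S * z))) / z) {0..S}"
      by (simp add: diff_divide_distrib)
    have "((\<lambda>\<tau>. if \<tau> \<in> {0..S} then exp (- (of_real \<tau> * z)) else 0) has_integral (1 - exp (- (of_real S * z))) / z) {-S..S}"
      by (subst has_integral_restrict) (use 1 that in auto)
    thus ?thesis by (rule has_integral_eq[rotated]) (auto simp: f_def)
  qed
  have lim: "(\<lambda>k. integral {-real k..real k} f) \<longlonglongrightarrow> integral UNIV f"
  proof (rule integral_UNIV_limit(2)[of 0 f "Re z" 1])
    show "f integrable_on {-S..S}" if "S \<ge> 0" for S using hi[OF that] by blast
  qed (use assms bd in auto)
  have "(\<lambda>k. integral {-real k..real k} f) = (\<lambda>k. (1 - exp (- (of_real (real k) * z))) / z)"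
    by (intro ext integral_unique hi) simp
  moreover have "(\<lambda>k. (1 - exp (- (of_real (real k) * z))) / z) \<longlonglongrightarrow> (1 - 0) / z"
  proof (intro tendsto_intros z)
    have "(\<lambda>k. exp (- (real k * Re z))) \<longlonglongrightarrow> 0" using assms by real_asymp
    hence "(\<lambda>k. norm (exp (- (of_real (real k) * z)))) \<longlonglongrightarrow> 0" by simp
    thus "(\<lambda>k. exp (- (of_real (real k) * z))) \<longlonglongrightarrow> 0" by (rule tendsto_norm_zero_cancel)
  qed
  ultimately have "integral UNIV f = 1 / z" using lim LIMSEQ_unique by fastforce
  thus ?thesis using integral_lborel[OF int] by (simp add: f_def)
qed

text \<open>The arctangent settles the half-line and reflection the other half; at 0 both indicators
  count, which a comparison tolerates.\<close>

lemma integrable_cauchy_kernel: "integrable lborel (\<lambda>u::real. 1 / (1 + u\<^sup>2))"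
proof -
  have nn: "(\<integral>\<^sup>+x. ennreal (1 / (1 + x\<^sup>2)) * indicator {0..} x \<partial>lborel) = pi / 2 - arctan 0"
  proof (rule nn_integral_FTC_atLeast)
    show "DERIV arctan x :> 1 / (1 + x\<^sup>2)" for x
      using DERIV_arctan[of x] by (simp add: inverse_eq_divide)
    show "(arctan \<longlongrightarrow> pi / 2) at_top" by (rule tendsto_arctan_at_top)
  qed auto
  have "integrable lborel (\<lambda>x::real. indicator {0..} x *\<^sub>R (1 / (1 + x\<^sup>2)))"
  proof (rule integrableI_nonneg)
    have "(\<integral>\<^sup>+x. ennreal (indicator {0..} x *\<^sub>R (1 / (1 + x\<^sup>2))) \<partial>lborel) =
        (\<integral>\<^sup>+x. ennreal (1 / (1 + x\<^sup>2)) * indicator {0..} x \<partial>lborel)"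
      by (intro nn_integral_cong) (auto simp: indicator_def)
    thus "(\<integral>\<^sup>+x. ennreal (indicator {0..} x *\<^sub>R (1 / (1 + x\<^sup>2))) \<partial>lborel) < \<infinity>" unfolding nn by simp
  qed auto
  note A = this lborel_integrable_real_affine[OF this, of "-1" 0]
  show ?thesis
  proof (rule Bochner_Integration.integrable_bound[OF Bochner_Integration.integrable_add[OF A]])
    show "AE u::real in lborel. norm (1 / (1 + u\<^sup>2)) \<le> norm (indicat_real {0..} u *\<^sub>R (1 / (1 + u\<^sup>2)) +
         indicat_real {0..} (0 + -1 * u) *\<^sub>R (1 / (1 + (0 + -1 * u)\<^sup>2)))"
      by (intro always_eventually allI) (auto simp: indicator_def)
  qed auto
qed

text \<open>Half of the decay pays for the power, the other half remains.\<close>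

lemma moment_bound:
  fixes h :: "real \<Rightarrow> complex"
  assumes c: "c > 0" and bd: "norm (h s) \<le> K * exp (- c * \<bar>s\<bar>)"
  shows "\<bar>s\<bar> ^ n * norm (h s) \<le> (fact n / (c / 2) ^ n * K) * exp (- (c / 2) * \<bar>s\<bar>)"
proof -
  have "\<bar>s\<bar> ^ n * norm (h s) \<le> (fact n / (c / 2) ^ n * exp (c / 2 * \<bar>s\<bar>)) * (K * exp (- c * \<bar>s\<bar>))"
    using c by (intro mult_mono bd power_le_exp) auto
  also have "\<dots> = (fact n / (c / 2) ^ n * K) * exp (- (c / 2) * \<bar>s\<bar>)"
    by (simp add: field_simps flip: exp_add)
  finally show ?thesis .
qed

text \<open>
  Expanding the exponential shows in finitely many bounded steps that the Fourier transform of h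
  vanishes on the whole real line, and then so do all Poisson integrals of h.
\<close>

lemma zero_of_moments:
  fixes h :: "real \<Rightarrow> complex"
  assumes cont: "continuous_on UNIV h" and c: "c > 0" and bd: "\<And>s. norm (h s) \<le> K * exp (- c * \<bar>s\<bar>)"
    and mom: "\<And>n. (\<integral>s. of_real s ^ n * h s \<partial>lborel) = 0"
  shows "h y = 0"
proof -
  have meas [measurable]: "h \<in> borel_measurable borel" using cont by (rule borel_measurable_continuous_onI)
  have K: "K \<ge> 0" using order.trans[OF norm_ge_zero bd[of 0]] by simp
  define g where "g = (\<lambda>\<tau> n s. of_real s ^ n * exp (\<i> * of_real (\<tau> * s)) * h s)"
  have g_meas [measurable]: "g \<tau> n \<in> borel_measurable borel" for \<tau> n unfolding g_def by measurable
  have g_bd: "norm (g \<tau> n s) \<le> (fact n / (c / 2) ^ n * K) * exp (- (c / 2) * \<bar>s\<bar>)" for \<tau> n s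
    using moment_bound[OF c bd, where s = s and n = n] by (simp add: g_def norm_mult norm_power)
  have c2: "c / 2 > 0" "c / 4 > 0" using c by simp_all
  have g_int: "integrable lborel (g \<tau> n)" for \<tau> n
    by (rule integrable_exp_dominated[OF c2(1) _ g_bd]) simp
  \<comment> \<open>The functions \<open>g\<close> decay at the rate \<open>c / 2\<close>; a step of
    length at most \<open>c / 4\<close> leaves the majorant the rate \<open>c / 4\<close>. All
    powers \<open>n\<close> are carried along because each term of the expansion raises
    \<open>n\<close>.\<close>
  have step: "(\<integral>s. g \<tau>' n s \<partial>lborel) = 0"
    if z: "\<And>n. (\<integral>s. g \<tau> n s \<partial>lborel) = 0" and d: "\<bar>\<tau>' - \<tau>\<bar> \<le> c / 4" for \<tau> \<tau>' n
  proof -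
    define \<delta> where "\<delta> = \<tau>' - \<tau>"
    define Q where "Q = (\<lambda>m s. (\<Sum>k<m. (\<i> * of_real \<delta>) ^ k / fact k * g \<tau> (n + k) s))"
    have Q_eq: "Q m s = (\<Sum>k<m. (\<i> * of_real (\<delta> * s)) ^ k / fact k) * g \<tau> n s" for m s
      unfolding Q_def sum_distrib_right
      by (rule sum.cong) (simp_all add: g_def power_add power_mult_distrib mult_ac)
    have "(\<integral>s. Q m s \<partial>lborel) = (\<Sum>k<m. (\<i> * of_real \<delta>) ^ k / fact k * (\<integral>s. g \<tau> (n + k) s \<partial>lborel))" for m
      unfolding Q_def by (subst Bochner_Integration.integral_sum) (auto intro!: g_int)
    hence Q0: "(\<integral>s. Q m s \<partial>lborel) = 0" for m by (simp add: z)
    have "(\<lambda>m. \<integral>s. Q m s \<partial>lborel) \<longlonglongrightarrow> (\<integral>s. g \<tau>' n s \<partial>lborel)"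
    proof (rule integral_dominated_convergence)
      show "integrable lborel (\<lambda>s. (fact n / (c / 2) ^ n * K) * exp (- (c / 4) * \<bar>s\<bar>))"
        by (intro integrable_mult_right integrable_lborel_exp_abs c2)
      show "AE s in lborel. (\<lambda>m. Q m s) \<longlonglongrightarrow> g \<tau>' n s"
      proof (intro always_eventually allI)
        fix s
        have "(\<lambda>k. (\<i> * of_real (\<delta> * s)) ^ k / fact k) sums exp (\<i> * of_real (\<delta> * s))"
          using exp_converges[of "\<i> * of_real (\<delta> * s)"] by (simp add: scaleR_conv_of_real divide_inverse mult.commute)
        hence "(\<lambda>m. Q m s) \<longlonglongrightarrow> exp (\<i> * of_real (\<delta> * s)) * g \<tau> n s"
          unfolding Q_eq sums_def by (intro tendsto_intros)
        also have "exp (\<i> * of_real (\<delta> * s)) * g \<tau> n s = g \<tau>' n s"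
          by (simp add: g_def \<delta>_def algebra_simps flip: exp_add)
        finally show "(\<lambda>m. Q m s) \<longlonglongrightarrow> g \<tau>' n s" .
      qed
      show "AE s in lborel. norm (Q m s) \<le> (fact n / (c / 2) ^ n * K) * exp (- (c / 4) * \<bar>s\<bar>)" for m
      proof (intro always_eventually allI)
        fix s
        have "norm (\<Sum>k<m. (\<i> * of_real (\<delta> * s)) ^ k / fact k) \<le> (\<Sum>k<m. \<bar>\<delta> * s\<bar> ^ k / fact k)"
          by (intro order.trans[OF norm_sum] sum_mono) (simp add: norm_divide norm_power norm_mult abs_mult)
        also have "\<dots> = (\<Sum>k<m. \<bar>\<delta> * s\<bar> ^ k /\<^sub>R fact k)" by (simp add: divide_inverse mult.commute)
        also have "\<dots> \<le> exp \<bar>\<delta> * s\<bar>"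
          unfolding exp_def using summable_exp_generic[of "\<bar>\<delta> * s\<bar>"] by (intro sum_le_suminf) auto
        also have "\<dots> \<le> exp (c / 4 * \<bar>s\<bar>)" unfolding exp_le_cancel_iff abs_mult using d by (intro mult_right_mono) (simp_all add: \<delta>_def)
        finally have "norm (Q m s) \<le> exp (c / 4 * \<bar>s\<bar>) * ((fact n / (c / 2) ^ n * K) * exp (- (c / 2) * \<bar>s\<bar>))"
          unfolding Q_eq norm_mult by (intro mult_mono g_bd) auto
        also have "\<dots> = (fact n / (c / 2) ^ n * K) * exp (- (c / 4) * \<bar>s\<bar>)"
          by (simp add: field_simps flip: exp_add)
        finally show "norm (Q m s) \<le> (fact n / (c / 2) ^ n * K) * exp (- (c / 4) * \<bar>s\<bar>)" .
      qed
      show "Q m \<in> borel_measurable lborel" for m unfolding Q_def by measurable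
    qed simp
    thus ?thesis unfolding Q0 using LIMSEQ_unique tendsto_const by blast
  qed
  have all: "\<bar>\<tau>\<bar> \<le> real j * (c / 4) \<Longrightarrow> (\<integral>s. g \<tau> n s \<partial>lborel) = 0" for j \<tau> n
  proof (induction j arbitrary: \<tau> n)
    case 0
    thus ?case using mom[of n] by (simp add: g_def)
  next
    case (Suc j)
    \<comment> \<open>Scaling by j / (j + 1) reaches the range of the induction hypothesis while
      moving \<tau> by at most \<open>c / 4\<close>.\<close>
    define \<tau>0 where "\<tau>0 = \<tau> * (real j / real (Suc j))"
    have "\<bar>\<tau>0\<bar> = \<bar>\<tau>\<bar> * (real j / real (Suc j))" by (simp add: \<tau>0_def abs_mult)
    also have "\<dots> \<le> (real (Suc j) * (c / 4)) * (real j / real (Suc j))"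
      using Suc.prems by (intro mult_right_mono) auto
    also have "\<dots> = real j * (c / 4)" by (simp del: of_nat_Suc)
    finally have 1: "\<bar>\<tau>0\<bar> \<le> real j * (c / 4)" .
    have "\<tau> - \<tau>0 = \<tau> / real (Suc j)" by (simp add: \<tau>0_def field_simps)
    hence "\<bar>\<tau> - \<tau>0\<bar> = \<bar>\<tau>\<bar> / real (Suc j)" by simp
    also have "\<dots> \<le> (real (Suc j) * (c / 4)) / real (Suc j)"
      using Suc.prems by (intro divide_right_mono) auto
    also have "\<dots> = c / 4" by (simp del: of_nat_Suc)
    finally have "\<bar>\<tau> - \<tau>0\<bar> \<le> c / 4" .
    thus ?case using step[of \<tau>0 \<tau> n] Suc.IH[OF 1] by blast
  qed
  have fourier: "(\<integral>s. exp (\<i> * of_real (\<tau> * s)) * h s \<partial>lborel) = 0" for \<tau>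
  proof -
    obtain j :: nat where "\<bar>\<tau>\<bar> / (c / 4) \<le> real j" using real_arch_simple by blast
    hence "\<bar>\<tau>\<bar> \<le> real j * (c / 4)" using c by (simp add: field_simps)
    from all[OF this, of 0] show ?thesis by (simp add: g_def)
  qed
  have h_int: "integrable lborel h" by (rule integrable_exp_dominated[OF c _ bd]) simp
  \<comment> \<open>The values 1 and -1 of \<sigma> give the two partial fractions of the Poisson
    kernel centred at \<open>y\<close>, up to a constant factor.\<close>
  define ker where "ker = (\<lambda>\<epsilon> \<sigma> s. 1 / (of_real \<epsilon> - \<i> * of_real (\<sigma> * (s - y))) :: complex)"
  have half: "(\<integral>s. h s * ker \<epsilon> \<sigma> s \<partial>lborel) = 0"
    if \<epsilon>: "\<epsilon> > 0" for \<epsilon> \<sigma>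
  proof -
    define z where "z = (\<lambda>s. of_real \<epsilon> - \<i> * of_real (\<sigma> * (s - y)))"
    define f where "f = (\<lambda>s \<tau>. h s * (indicator {0..} \<tau> *\<^sub>R exp (- (of_real \<tau> * z s))))"
    define J where "J = (\<lambda>\<tau>::real. indicator {0..} \<tau> * exp (- \<epsilon> * \<tau>))"
    have J: "integrable lborel J"
    proof (rule Bochner_Integration.integrable_bound[OF integrable_lborel_exp_abs[OF \<epsilon>]])
      show "AE s in lborel. norm (J s) \<le> norm (exp (- \<epsilon> * \<bar>s\<bar>))"
        by (intro always_eventually allI) (auto simp: J_def indicator_def)
    qed (simp add: J_def)
    have nf: "norm (f s \<tau>) = norm (h s) * J \<tau>" for s \<tau>
      by (simp add: f_def J_def z_def norm_mult mult.commute)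
    have fm: "case_prod f \<in> borel_measurable (lborel \<Otimes>\<^sub>M lborel)"
      unfolding f_def z_def by measurable
    have fm1: "f s \<in> borel_measurable lborel" for s unfolding f_def by measurable
    have fi: "integrable (lborel \<Otimes>\<^sub>M lborel) (case_prod f)"
    proof (rule lborel_pair.Fubini_integrable[OF fm])
      have "(\<lambda>s. \<integral>\<tau>. norm (case_prod f (s, \<tau>)) \<partial>lborel) = (\<lambda>s. norm (h s) * (\<integral>\<tau>. J \<tau> \<partial>lborel))"
        using J by (simp add: nf)
      thus "integrable lborel (\<lambda>s. \<integral>\<tau>. norm (case_prod f (s, \<tau>)) \<partial>lborel)" using h_int by simp
      show "AE s in lborel. integrable lborel (\<lambda>\<tau>. case_prod f (s, \<tau>))"
      proof (intro always_eventually allI)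
        fix s
        have "integrable lborel (\<lambda>\<tau>. norm (h s) * J \<tau>)" using J by simp
        hence "integrable lborel (f s)"
          by (rule Bochner_Integration.integrable_bound) (use fm1 in \<open>auto simp: nf intro!: always_eventually\<close>)
        thus "integrable lborel (\<lambda>\<tau>. case_prod f (s, \<tau>))" by simp
      qed
    qed
    have "(\<integral>s. h s * (1 / z s) \<partial>lborel) = (\<integral>s. (\<integral>\<tau>. f s \<tau> \<partial>lborel) \<partial>lborel)"
    proof (rule Bochner_Integration.integral_cong[OF refl])
      fix s
      have "Re (z s) > 0" using \<epsilon> by (simp add: z_def)
      from laplace_one[OF this] show "h s * (1 / z s) = (\<integral>\<tau>. f s \<tau> \<partial>lborel)"
        unfolding f_def by (simp only: integral_mult_right_zero)
    qed
    also have "\<dots> = (\<integral>\<tau>. (\<integral>s. f s \<tau> \<partial>lborel) \<partial>lborel)"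
      by (rule lborel_pair.Fubini_integral[OF fi, symmetric])
    \<comment> \<open>After the exchange of integrals the inner one is a multiple of the Fourier
      transform of \<open>h\<close> at \<open>\<tau> * \<sigma>\<close>.\<close>
    also have "\<dots> = (\<integral>\<tau>. 0 \<partial>(lborel :: real measure))"
    proof (rule Bochner_Integration.integral_cong[OF refl])
      fix \<tau> :: real
      have "f s \<tau> = (indicator {0..} \<tau> *\<^sub>R exp (- of_real (\<tau> * \<epsilon>) - \<i> * of_real (\<tau> * \<sigma> * y))) *
          (exp (\<i> * of_real ((\<tau> * \<sigma>) * s)) * h s)" for s
        by (simp add: f_def z_def algebra_simps exp_diff exp_add exp_minus divide_inverse)
      hence "(\<integral>s. f s \<tau> \<partial>lborel) = (indicator {0..} \<tau> *\<^sub>R exp (- of_real (\<tau> * \<epsilon>) - \<i> * of_real (\<tau> * \<sigma> * y))) *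
          (\<integral>s. exp (\<i> * of_real ((\<tau> * \<sigma>) * s)) * h s \<partial>lborel)"
        by (simp only: integral_mult_right_zero)
      thus "(\<integral>s. f s \<tau> \<partial>lborel) = 0" by (simp only: fourier mult_zero_right)
    qed
    finally show ?thesis by (simp add: z_def ker_def)
  qed
  have half_int: "integrable lborel (\<lambda>s. h s * ker \<epsilon> \<sigma> s)"
    if \<epsilon>: "\<epsilon> > 0" for \<epsilon> \<sigma>
  proof (rule integrable_exp_dominated[OF c])
    show "(\<lambda>s. h s * ker \<epsilon> \<sigma> s) \<in> borel_measurable lborel" unfolding ker_def by measurable
    fix s
    have "\<epsilon> \<le> norm (of_real \<epsilon> - \<i> * of_real (\<sigma> * (s - y)))"
      using complex_Re_le_cmod[of "of_real \<epsilon> - \<i> * of_real (\<sigma> * (s - y))"] by simp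
    hence "norm (ker \<epsilon> \<sigma> s) \<le> 1 / \<epsilon>"
      using \<epsilon> by (simp add: ker_def norm_divide frac_le)
    hence "norm (h s * ker \<epsilon> \<sigma> s) \<le> (K * exp (- c * \<bar>s\<bar>)) * (1 / \<epsilon>)"
      unfolding norm_mult using K by (intro mult_mono bd) auto
    thus "norm (h s * ker \<epsilon> \<sigma> s) \<le> K / \<epsilon> * exp (- c * \<bar>s\<bar>)"
      by (simp add: mult_ac)
  qed
  have poisson: "(\<integral>u. of_real (1 / (1 + u\<^sup>2)) * h (y + \<epsilon> * u) \<partial>lborel) = 0" if \<epsilon>: "\<epsilon> > 0" for \<epsilon>
  proof -
    define P where "P = (\<lambda>s. h s * ker \<epsilon> 1 s +
        h s * ker \<epsilon> (-1) s)"
    have "(\<integral>s. P s \<partial>lborel) = 0"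
      unfolding P_def Bochner_Integration.integral_add[OF half_int[OF \<epsilon>] half_int[OF \<epsilon>]] half[OF \<epsilon>]
      by (rule add_0)
    moreover have "(\<integral>s. P s \<partial>lborel) = \<bar>\<epsilon>\<bar> *\<^sub>R (\<integral>u. P (y + \<epsilon> * u) \<partial>lborel)"
      using \<epsilon> by (intro lborel_integral_real_affine) simp
    ultimately have 0: "(\<integral>u. P (y + \<epsilon> * u) \<partial>lborel) = 0" using \<epsilon> by simp
    have "P (y + \<epsilon> * u) = of_real (2 / \<epsilon>) * (of_real (1 / (1 + u\<^sup>2)) * h (y + \<epsilon> * u))" for u
    proof -
      have n: "(1 - \<i> * of_real u) * (1 + \<i> * of_real u) = of_real (1 + u\<^sup>2)"
        by (simp add: algebra_simps power2_eq_square complex_eq_iff)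
      have nz: "1 - \<i> * of_real u \<noteq> 0" "1 + \<i> * of_real u \<noteq> 0" by (auto simp: complex_eq_iff)
      have "1 / (1 - \<i> * of_real u) + 1 / (1 + \<i> * of_real u) = 2 / ((1 - \<i> * of_real u) * (1 + \<i> * of_real u))"
        using nz by (simp add: add_frac_eq)
      hence s: "1 / (1 - \<i> * of_real u) + 1 / (1 + \<i> * of_real u) = 2 * of_real (1 / (1 + u\<^sup>2))" unfolding n by simp
      have e1: "ker \<epsilon> 1 (y + \<epsilon> * u) = of_real (1 / \<epsilon>) * (1 / (1 - \<i> * of_real u))"
      proof -
        have "of_real \<epsilon> - \<i> * of_real (1 * (y + \<epsilon> * u - y)) = of_real \<epsilon> * (1 - \<i> * of_real u)" by (simp add: algebra_simps)
        thus ?thesis by (simp add: ker_def)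
      qed
      have e2: "ker \<epsilon> (-1) (y + \<epsilon> * u) = of_real (1 / \<epsilon>) * (1 / (1 + \<i> * of_real u))"
      proof -
        have "of_real \<epsilon> - \<i> * of_real (-1 * (y + \<epsilon> * u - y)) = of_real \<epsilon> * (1 + \<i> * of_real u)" by (simp add: algebra_simps)
        thus ?thesis by (simp add: ker_def)
      qed
      have "P (y + \<epsilon> * u) = of_real (1 / \<epsilon>) * ((1 / (1 - \<i> * of_real u) + 1 / (1 + \<i> * of_real u)) * h (y + \<epsilon> * u))"
        unfolding P_def e1 e2 by (simp only: distrib_left distrib_right mult_ac)
      thus ?thesis unfolding s by simp
    qed
    hence "(\<integral>u. P (y + \<epsilon> * u) \<partial>lborel) = of_real (2 / \<epsilon>) * (\<integral>u. of_real (1 / (1 + u\<^sup>2)) * h (y + \<epsilon> * u) \<partial>lborel)"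
      by (simp only: integral_mult_right_zero)
    thus ?thesis using 0 \<epsilon> by simp
  qed
  have hK: "norm (h s) \<le> K" for s
  proof -
    have "K * exp (- c * \<bar>s\<bar>) \<le> K * 1" using K c by (intro mult_left_mono) auto
    thus ?thesis using bd[of s] by linarith
  qed
  \<comment> \<open>In the variable \<open>u\<close> the kernel is fixed and the majorant
    \<open>K * (1 / (1 + u\<^sup>2))\<close> does not depend on \<epsilon>; the limit is
    \<open>h y\<close> times the mass of the kernel.\<close>
  define \<epsilon> where "\<epsilon> = (\<lambda>k. 1 / real (Suc k))"
  have lim: "(\<lambda>k. \<integral>u. of_real (1 / (1 + u\<^sup>2)) * h (y + \<epsilon> k * u) \<partial>lborel) \<longlonglongrightarrow>
      (\<integral>u. of_real (1 / (1 + u\<^sup>2)) * h y \<partial>lborel)"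
  proof (rule integral_dominated_convergence)
    show "integrable lborel (\<lambda>u. K * (1 / (1 + u\<^sup>2)))"
      by (intro integrable_mult_right integrable_cauchy_kernel)
    show "AE u in lborel. (\<lambda>k. of_real (1 / (1 + u\<^sup>2)) * h (y + \<epsilon> k * u)) \<longlonglongrightarrow> of_real (1 / (1 + u\<^sup>2)) * h y"
    proof (intro always_eventually allI)
      fix u
      have "(\<lambda>k. y + \<epsilon> k * u) \<longlonglongrightarrow> y + 0 * u"
        unfolding \<epsilon>_def by (intro tendsto_intros LIMSEQ_Suc[OF lim_1_over_n])
      hence "(\<lambda>k. h (y + \<epsilon> k * u)) \<longlonglongrightarrow> h y"
        using cont by (intro continuous_on_tendsto_compose[of UNIV h]) auto
      thus "(\<lambda>k. of_real (1 / (1 + u\<^sup>2)) * h (y + \<epsilon> k * u)) \<longlonglongrightarrow> of_real (1 / (1 + u\<^sup>2)) * h y"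
        by (intro tendsto_intros)
    qed
    show "AE u in lborel. norm (of_real (1 / (1 + u\<^sup>2)) * h (y + \<epsilon> k * u)) \<le> K * (1 / (1 + u\<^sup>2))" for k
    proof (intro always_eventually allI)
      fix u
      have "norm (of_real (1 / (1 + u\<^sup>2)) * h (y + \<epsilon> k * u)) = (1 / (1 + u\<^sup>2)) * norm (h (y + \<epsilon> k * u))"
        unfolding norm_mult norm_of_real by simp
      also have "\<dots> \<le> (1 / (1 + u\<^sup>2)) * K" by (intro mult_left_mono hK) auto
      finally show "norm (of_real (1 / (1 + u\<^sup>2)) * h (y + \<epsilon> k * u)) \<le> K * (1 / (1 + u\<^sup>2))" by (simp only: mult.commute)
    qed
  qed measurable
  have "(\<integral>u. of_real (1 / (1 + u\<^sup>2)) * h (y + \<epsilon> k * u) \<partial>lborel) = 0" for k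
    by (rule poisson) (simp add: \<epsilon>_def)
  from lim[unfolded this] have "(\<integral>u. of_real (1 / (1 + u\<^sup>2)) * h y \<partial>lborel) = 0"
    by (rule LIMSEQ_unique[OF _ tendsto_const])
  hence z: "(\<integral>u. complex_of_real (1 / (1 + u\<^sup>2)) \<partial>lborel) * h y = 0"
    by (simp only: integral_mult_left_zero)
  have "(\<integral>u. (1 / (1 + u\<^sup>2)) \<partial>lborel) \<noteq> (0::real)"
  proof
    assume "(\<integral>u. (1 / (1 + u\<^sup>2)) \<partial>lborel) = (0::real)"
    hence "AE u::real in lborel. 1 / (1 + u\<^sup>2) = 0"
      using integral_nonneg_eq_0_iff_AE[OF integrable_cauchy_kernel] by auto
    moreover have "1 / (1 + u\<^sup>2) \<noteq> 0" for u :: real by (simp add: add_nonneg_eq_0_iff)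
    ultimately have "AE u::real in lborel. False" by simp
    thus False by (simp add: AE_iff_null emeasure_lborel_UNIV null_sets_def)
  qed
  moreover have "(\<integral>u. complex_of_real (1 / (1 + u\<^sup>2)) \<partial>lborel) = of_real (\<integral>u. (1 / (1 + u\<^sup>2)) \<partial>lborel)"
    by (rule integral_of_real[OF integrable_cauchy_kernel])
  ultimately show ?thesis using z by simp
qed

section \<open>Passage to the imaginary axis\<close>

lemma side_imaginary_axis:
  assumes "\<sigma> = 1 \<or> \<sigma> = -1" "\<sigma> * Re p > 0"
  shows "side \<sigma> (\<lambda>s. \<i> * of_real s) p"
  unfolding side_def
proof (intro exI[of _ 1] allI impI)
  fix r :: real assume r: "r \<ge> 1"
  have "{z. \<sigma> * Re z > 0} = {z. inner (of_real \<sigma>) z > 0}" by (simp add: inner_complex_def)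
  also have "convex \<dots>" by (rule convex_halfspace_gt)
  finally have "connected {z. \<sigma> * Re z > 0}" by (rule convex_connected)
  moreover have "{z. \<sigma> * Re z > 0} \<subseteq> - range (\<lambda>s. \<i> * of_real s)" by auto
  moreover have "of_real (\<sigma> * r) \<in> {z. \<sigma> * Re z > 0}" using assms(1) r by auto
  ultimately show "connected_component (- range (\<lambda>s. \<i> * of_real s)) p (of_real (\<sigma> * r))"
    using assms(2) unfolding connected_component_def by blast
qed

text \<open>Raising \<open>t0\<close> and \<open>t1\<close> while keeping \<open>u0\<close> and
  \<open>u1\<close> raises a, b, c, d equally. As the result is again a parameter record, the
  estimates for \<open>Delta\<close> apply to it.\<close>

definition shift_params :: "nat \<Rightarrow> params \<Rightarrow> params" where
  "shift_params N t = t\<lparr>t0 := t0 t + of_nat N, t1 := t1 t + of_nat N\<rparr>"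

lemma par_shift_params:
  "par_a (shift_params N t) = par_a t + of_nat N" "par_b (shift_params N t) = par_b t + of_nat N"
  "par_c (shift_params N t) = par_c t + of_nat N" "par_d (shift_params N t) = par_d t + of_nat N"
  by (simp_all add: shift_params_def par_a_def par_b_def par_c_def par_d_def)

definition poch_poly :: "complex \<Rightarrow> complex \<Rightarrow> nat \<Rightarrow> complex poly" where
  "poch_poly e \<sigma> N = (\<Prod>k<N. [:e + of_nat k, \<sigma>:])"

lemma poly_poch_poly: "poly (poch_poly e \<sigma> N) x = pochhammer (e + \<sigma> * x) N"
  by (simp add: poch_poly_def poly_prod pochhammer_prod atLeast0LessThan add_ac mult.commute)

text \<open>Each Gamma factor picks up a Pochhammer symbol, which is a polynomial in x, and the
  reciprocal Gamma factors do not involve the parameters.\<close>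

lemma Delta_shift_params:
  "\<exists>\<psi>. \<forall>x. x \<notin> poles {par_a t, par_b t, par_c t, par_d t} {par_a t, par_b t, par_c t, par_d t} \<longrightarrow>
     Delta (shift_params N t) x = poly \<psi> x * Delta t x"
proof -
  define \<psi> where "\<psi> = poch_poly (par_a t) 1 N * poch_poly (par_a t + 1) (-1) N *
    poch_poly (par_b t) 1 N * poch_poly (par_b t + 1) (-1) N *
    poch_poly (par_c t) 1 N * poch_poly (par_c t) (-1) N * poch_poly (par_d t) 1 N * poch_poly (par_d t) (-1) N"
  have G: "Gamma (z + of_nat N) = pochhammer z N * Gamma z" if "z \<notin> \<int>\<^sub>\<le>\<^sub>0" for z :: complex
    using pochhammer_Gamma[OF that] that by (simp add: Gamma_eq_zero_iff)
  show ?thesis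
  proof (intro exI[of _ \<psi>] allI impI)
    fix x assume x: "x \<notin> poles {par_a t, par_b t, par_c t, par_d t} {par_a t, par_b t, par_c t, par_d t}"
    have p: "Gamma (e + of_nat N + x) = poly (poch_poly e 1 N) x * Gamma (e + x)"
        "Gamma (e + of_nat N - x) = poly (poch_poly e (-1) N) x * Gamma (e - x)"
        "Gamma (e + of_nat N + 1 - x) = poly (poch_poly (e + 1) (-1) N) x * Gamma (e + 1 - x)"
      if "e \<in> {par_a t, par_b t, par_c t, par_d t}" for e
    proof -
      have n: "e + x \<notin> \<int>\<^sub>\<le>\<^sub>0" "e - x \<notin> \<int>\<^sub>\<le>\<^sub>0" using not_poles_Gamma[OF x, of e] that by auto
      have "e + 1 - x \<notin> \<int>\<^sub>\<le>\<^sub>0"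
      proof
        assume "e + 1 - x \<in> \<int>\<^sub>\<le>\<^sub>0"
        hence "e + 1 - x - 1 \<in> \<int>\<^sub>\<le>\<^sub>0" by (meson nonpos_Ints_diff_Nats Nats_1)
        thus False using n(2) by (simp add: algebra_simps)
      qed
      from G[OF n(1)] G[OF n(2)] G[OF this] show "Gamma (e + of_nat N + x) = poly (poch_poly e 1 N) x * Gamma (e + x)"
        "Gamma (e + of_nat N - x) = poly (poch_poly e (-1) N) x * Gamma (e - x)"
        "Gamma (e + of_nat N + 1 - x) = poly (poch_poly (e + 1) (-1) N) x * Gamma (e + 1 - x)"
        by (simp_all add: poly_poch_poly algebra_simps)
    qed
    have mem: "par_a t \<in> {par_a t, par_b t, par_c t, par_d t}" "par_b t \<in> {par_a t, par_b t, par_c t, par_d t}"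
      "par_c t \<in> {par_a t, par_b t, par_c t, par_d t}" "par_d t \<in> {par_a t, par_b t, par_c t, par_d t}" by simp_all
    note p_all = p[OF mem(1)] p[OF mem(2)] p[OF mem(3)] p[OF mem(4)]
    show "Delta (shift_params N t) x = poly \<psi> x * Delta t x"
      unfolding Delta_def par_shift_params \<psi>_def poly_mult
      by (simp only: p_all mult_ac)
  qed
qed

text \<open>Positive real parts keep all poles off the axis, so compactness bounds the middle
  segment; the factor \<open>exp ((8 - 2 * pi) * T)\<close> fits this bound under the
  exponential.\<close>

lemma Delta_imaginary_axis_bound:
  assumes "\<And>e. e \<in> {par_a t, par_b t, par_c t, par_d t} \<Longrightarrow> Re e > 0"
  shows "continuous_on UNIV (\<lambda>s. Delta t (\<i> * of_real s))"
    and "\<exists>K. \<forall>s. norm (Delta t (\<i> * of_real s)) \<le> K * exp (- (8 - 2 * pi) * \<bar>s\<bar>)"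
proof -
  define A where "A = {par_a t, par_b t, par_c t, par_d t}"
  have np: "\<i> * of_real s \<in> - poles A A" for s
  proof
    assume "\<i> * of_real s \<in> poles A A"
    then obtain e n where e: "e \<in> A" "\<i> * of_real s = e + of_nat n \<or> \<i> * of_real s = - (e + of_nat n)"
      by (auto simp: poles_def)
    from e(2) have "Re (\<i> * of_real s) = Re (e + of_nat n) \<or> Re (\<i> * of_real s) = Re (- (e + of_nat n))" by metis
    thus False using assms[of e] e(1) by (auto simp: A_def)
  qed
  have "continuous_on (- poles A A) (Delta t)"
    by (rule holomorphic_on_imp_continuous_on[OF holomorphic_Delta(1)[OF A_def]])
  thus cont: "continuous_on UNIV (\<lambda>s. Delta t (\<i> * of_real s))"
    by (rule continuous_on_compose2) (use np in \<open>auto intro!: continuous_intros\<close>)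
  obtain K T where K: "K \<ge> 0" "\<And>x. \<bar>Re x\<bar> \<le> 0 \<Longrightarrow> \<bar>Im x\<bar> \<ge> T \<Longrightarrow> norm (Delta t x) \<le> K * exp (- (8 - 2 * pi) * \<bar>Im x\<bar>)"
    using decay_rateE[OF decay_rate_Delta, of 0 t] by metis
  have "compact ((\<lambda>s. Delta t (\<i> * of_real s)) ` {-T..T})"
    using cont by (intro compact_continuous_image) (auto intro: continuous_on_subset)
  then obtain B where B: "\<And>s. s \<in> {-T..T} \<Longrightarrow> norm (Delta t (\<i> * of_real s)) \<le> B"
    using compact_imp_bounded bounded_iff by (metis image_eqI)
  show "\<exists>K. \<forall>s. norm (Delta t (\<i> * of_real s)) \<le> K * exp (- (8 - 2 * pi) * \<bar>s\<bar>)"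
  proof (intro exI allI)
    fix s
    define r where "r = 8 - 2 * pi"
    have r: "r > 0" using rates_pos(1) by (simp add: r_def)
    show "norm (Delta t (\<i> * of_real s)) \<le> (K + \<bar>B\<bar> * exp ((8 - 2 * pi) * T)) * exp (- (8 - 2 * pi) * \<bar>s\<bar>)"
      unfolding r_def[symmetric]
    proof (cases "\<bar>s\<bar> \<ge> T")
      case True
      hence "norm (Delta t (\<i> * of_real s)) \<le> K * exp (- r * \<bar>s\<bar>)" using K(2)[of "\<i> * of_real s"] by (simp add: r_def)
      also have "\<dots> \<le> (K + \<bar>B\<bar> * exp (r * T)) * exp (- r * \<bar>s\<bar>)" by (intro mult_right_mono) auto
      finally show "norm (Delta t (\<i> * of_real s)) \<le> (K + \<bar>B\<bar> * exp (r * T)) * exp (- r * \<bar>s\<bar>)" .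
    next
      case False
      hence "s \<in> {-T..T}" by auto
      from B[OF this] have "norm (Delta t (\<i> * of_real s)) \<le> \<bar>B\<bar> * 1" by linarith
      also have "\<dots> \<le> \<bar>B\<bar> * exp (r * T - r * \<bar>s\<bar>)" using False r by (intro mult_left_mono) auto
      also have "\<dots> = (\<bar>B\<bar> * exp (r * T)) * exp (- r * \<bar>s\<bar>)" by (simp add: exp_diff exp_minus field_simps)
      also have "\<dots> \<le> (K + \<bar>B\<bar> * exp (r * T)) * exp (- r * \<bar>s\<bar>)" using K(1) by (intro mult_right_mono) auto
      finally show "norm (Delta t (\<i> * of_real s)) \<le> (K + \<bar>B\<bar> * exp (r * T)) * exp (- r * \<bar>s\<bar>)" .
    qed
  qed
qed

lemma form_one_one_nonzero:
  assumes gen: "generic t" and adm: "admissible_contour t C"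
  shows "form t C 1 1 \<noteq> 0"
proof
  assume zero: "form t C 1 1 = 0"
  interpret symmetric_functional t "\<lambda>f. form t C f 1" by (rule symmetric_functional_form[OF gen adm])
  have "form t C (eseq t m) 1 = 0" for m
    using orthogonal[of m 0] zero by (cases m) simp_all
  moreover have "\<exists>c. f = (\<Sum>m<Suc (degree f). smult (c m) (eseq t m))" for f
    by (rule monic_basis) (simp_all add: degree_eseq coeff_eseq)
  ultimately have L0: "form t C f 1 = 0" for f
    using L_sum L_smult by (metis (no_types, lifting) mult_zero_right sum.neutral)
  define A where "A = {par_a t, par_b t, par_c t, par_d t}"
  define N where "N = Suc (nat \<lceil>Max ((\<lambda>e. \<bar>Re e\<bar>) ` A)\<rceil>)"
  have N: "Re e + real N > 0" if "e \<in> A" for e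
  proof -
    have "\<bar>Re e\<bar> \<le> Max ((\<lambda>e. \<bar>Re e\<bar>) ` A)" using that by (intro Max_ge) (auto simp: A_def)
    thus ?thesis unfolding N_def by linarith
  qed
  define t' where "t' = shift_params N t"
  define A' where "A' = {par_a t', par_b t', par_c t', par_d t'}"
  have A': "\<exists>e'\<in>A. e = e' + of_nat N" if "e \<in> A'" for e
    using that unfolding A'_def A_def t'_def par_shift_params by auto
  hence ReA': "Re e > 0" if "e \<in> A'" for e using that N by fastforce
  have sd: "side 1 C (e + of_nat n)" "side (-1) C (- (e + of_nat n))" if "e \<in> A" for e n
    using admissible_sides[OF adm] that unfolding A_def by blast+
  \<comment> \<open>The pole series of the shifted parameters are tails of the original ones, so
    \<open>C\<close> separates them as well.\<close>
  have sd': "side 1 C (e + of_nat n)" "side (-1) C (- (e + of_nat n))" if e: "e \<in> A'" for e n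
  proof -
    obtain e' where "e' \<in> A" "e = e' + of_nat N" using A'[OF e] by blast
    thus "side 1 C (e + of_nat n)" "side (-1) C (- (e + of_nat n))"
      using sd[of e' "N + n"] by (simp_all add: add.assoc)
  qed
  have CP: "p \<notin> range C" if p: "p \<in> poles A A" for p
  proof -
    obtain e n where "e \<in> A" "p = - (e + of_nat n) \<or> p = e + of_nat n" using p by (auto simp: poles_def)
    thus ?thesis using sd[of e n] side_not_range by metis
  qed
  obtain \<psi> where \<psi>: "\<And>x. x \<notin> poles A A \<Longrightarrow> Delta t' x = poly \<psi> x * Delta t x"
    using Delta_shift_params[of t N] unfolding A_def t'_def by blast
  \<comment> \<open>The factor \<psi> is absorbed into the polynomial argument of the form, which
    vanishes on all polynomials.\<close>
  have C0: "line_integral (\<lambda>x. poly q x * Delta t' x) C = 0" for q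
  proof -
    have "C s \<notin> poles A A" for s using CP by blast
    hence "line_integral (\<lambda>x. poly q x * Delta t' x) C = line_integral (\<lambda>x. poly (q * \<psi>) x * Delta t x) C"
      by (intro line_integral_cong) (simp add: \<psi>)
    also have "\<dots> = 0" using L0[of "q * \<psi>"] by (simp add: form_line_integral)
    finally show ?thesis .
  qed
  define C2 :: "real \<Rightarrow> complex" where "C2 = (\<lambda>s. \<i> * of_real s)"
  have C: "tail_curve 0 C" using adm by (rule admissible_tail_curve)
  have C2: "tail_curve 0 C2"
    unfolding tail_curve_def C2_def using straight_piecewise_C1[of 0] by (intro exI[of _ 1]) auto
  have fin: "finite A'" by (simp add: A'_def)
  have line: "line_integral (\<lambda>x. poly q x * Delta t' x) C2 = 0" for q
  proof -
    have "line_integral (\<lambda>x. poly q x * Delta t' x) C = line_integral (\<lambda>x. poly q x * Delta t' x) C2"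
    proof (rule line_integral_cong_contour[OF C C2 _ poles_closed[OF fin fin] poles_finite_strip[OF fin fin]])
      show "side 1 C p \<and> side 1 C2 p \<or> side (- 1) C p \<and> side (- 1) C2 p" if p: "p \<in> poles A' A'" for p
      proof -
        obtain e n where e: "e \<in> A'" "p = - (e + of_nat n) \<or> p = e + of_nat n" using p by (auto simp: poles_def)
        from e(2) show ?thesis
        proof
          assume p: "p = e + of_nat n"
          have "side 1 C2 p" unfolding C2_def using ReA'[OF e(1)] by (intro side_imaginary_axis) (auto simp: p)
          thus ?thesis using sd'(1)[OF e(1)] p by blast
        next
          assume p: "p = - (e + of_nat n)"
          have "side (-1) C2 p" unfolding C2_def using ReA'[OF e(1)] by (intro side_imaginary_axis) (auto simp: p)
          thus ?thesis using sd'(2)[OF e(1)] p by blast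
        qed
      qed
      show "(\<lambda>x. poly q x * Delta t' x) holomorphic_on - poles A' A'"
        using holomorphic_Delta(1)[OF A'_def] by (intro holomorphic_intros)
      show "strip_decay (\<lambda>x. poly q x * Delta t' x)"
        by (rule strip_decay_poly_mult[OF decay_rate_Delta rates_pos(1)])
    qed
    thus ?thesis using C0 by simp
  qed
  define h where "h = (\<lambda>s. Delta t' (\<i> * of_real s))"
  have cont: "continuous_on UNIV h"
    unfolding h_def using ReA' by (intro Delta_imaginary_axis_bound) (auto simp: A'_def)
  obtain K where K: "\<And>s. norm (h s) \<le> K * exp (- (8 - 2 * pi) * \<bar>s\<bar>)"
    using Delta_imaginary_axis_bound(2)[of t'] ReA' unfolding h_def A'_def by blast
  have mom: "(\<integral>s. of_real s ^ n * h s \<partial>lborel) = 0" for n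
  proof -
    have vd: "vector_derivative C2 (at s) = \<i>" for s
      unfolding C2_def by (rule vector_derivative_at) (auto intro!: derivative_eq_intros)
    define g where "g = (\<lambda>s. of_real s ^ n * h s)"
    have r: "(8 - 2 * pi) / 2 > 0" using rates_pos(1) by simp
    have K0: "K \<ge> 0" using order.trans[OF norm_ge_zero K[of 0]] by simp
    have hm [measurable]: "h \<in> borel_measurable borel" using cont by (rule borel_measurable_continuous_onI)
    have "integrable lborel g"
    proof (rule integrable_exp_dominated[OF r])
      show "g \<in> borel_measurable lborel" unfolding g_def by measurable
      fix s
      show "norm (g s) \<le> (fact n / ((8 - 2 * pi) / 2) ^ n * K) * exp (- ((8 - 2 * pi) / 2) * \<bar>s\<bar>)"
        using moment_bound[OF rates_pos(1) K, where s = s and n = n] by (simp add: g_def norm_mult norm_power)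
    qed
    hence "(\<integral>s. g s \<partial>lborel) = integral UNIV g" by (simp add: integral_lborel)
    also have "integral UNIV g = 0"
    proof -
      have "integral UNIV (\<lambda>s. poly (monom 1 n) (C2 s) * Delta t' (C2 s) * vector_derivative C2 (at s)) = 0"
        using line[of "monom 1 n"] by (simp add: line_integral_def)
      \<comment> \<open>Of the powers of \<open>\<i>\<close>, \<open>n\<close> come from the
        monomial on the axis and one from the velocity.\<close>
      also have "(\<lambda>s. poly (monom 1 n) (C2 s) * Delta t' (C2 s) * vector_derivative C2 (at s)) = (\<lambda>s. \<i> ^ Suc n * g s)"
        unfolding vd by (auto simp: C2_def poly_monom g_def h_def power_mult_distrib)
      finally show ?thesis by simp
    qed
    finally show ?thesis by (simp add: g_def)
  qed
  \<comment> \<open>The test point must avoid 0, where \<open>Delta\<close> vanishes; at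
    \<open>\<i>\<close> every factor is nonzero.\<close>
  have "h 1 = 0" by (rule zero_of_moments[OF cont rates_pos(1) K mom])
  moreover have "h 1 \<noteq> 0"
  proof -
    have "Gamma (e + \<i>) \<noteq> 0" "Gamma (e - \<i>) \<noteq> 0" "Gamma (e + 1 - \<i>) \<noteq> 0" if "e \<in> A'" for e
    proof -
      have "z \<notin> \<int>\<^sub>\<le>\<^sub>0" if "Re z > 0" for z using that by (auto elim!: nonpos_Ints_cases)
      moreover have "Re (e + \<i>) > 0" "Re (e - \<i>) > 0" "Re (e + 1 - \<i>) > 0" using ReA'[OF that] by simp_all
      ultimately show "Gamma (e + \<i>) \<noteq> 0" "Gamma (e - \<i>) \<noteq> 0" "Gamma (e + 1 - \<i>) \<noteq> 0"
        unfolding Gamma_eq_zero_iff by blast+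
    qed
    moreover have "rGamma (2 * \<i>) \<noteq> 0" "rGamma (1 - 2 * \<i>) \<noteq> 0"
      unfolding rGamma_eq_zero_iff by (auto intro!: notin_nonpos_Ints_Im)
    ultimately show ?thesis by (simp add: h_def Delta_def A'_def)
  qed
  ultimately show False by contradiction
qed

theorem theorem4p3:
  fixes t :: params and C :: "real \<Rightarrow> complex"
  assumes "generic t" and "admissible_contour t C"
  shows "(\<forall>p. transF t C p \<in> fin_fun t) \<and>
         (\<forall>p. transG t (transF t C p) = smult (norm_const t C) p) \<and>
         (\<forall>f \<in> fin_fun t. transF t C (transG t f) = (\<lambda>g. norm_const t C * f g)) \<and>
         (\<forall>g \<in> uminus ` spec t. weight t (- g) \<noteq> 0 \<longrightarrow>
            form t C (E t g) (E t g) / form t C 1 1 = weight t (- gam t 0) / weight t (- g))"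
  by (intro transforms_inverse symmetric_functional_form form_one_one_nonzero assms)

end
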